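(* Let $(a,c)\in\mathcal{H}^{\mathbb{C}}_0\cap\mathbb{R}^2$. Then there exists a loop $\gamma:[0,1]\to\mathcal{H}^{\mathbb{C}}_0$, based at a point of $\mathrm{DN}$, with $\gamma(1/2)=(a,c)$ such that $H_{a,c}:K^{\mathbb{R}}_{a,c}\to K^{\mathbb{R}}_{a,c}$ is topologically conjugate to $$\sigma|_{\operatorname{Fix}(\rho(\gamma))}:\operatorname{Fix}(\rho(\gamma))\to\operatorname{Fix}(\rho(\gamma)).$$ In fact, let $\alpha:[0,1]\to\mathcal{H}^{\mathbb{C}}_0$ be an arbitrary path that starts at a point $\alpha(0)\in\mathrm{DN}$ and ends at $\alpha(1)=(a,c)$, and let $\gamma:=\bar\alpha^{-1}\cdot\alpha$ be the loop based at $\alpha(0)$ given by $\gamma(t)=\alpha(2t)$ for $0\le t\le 1/2$ and $\gamma(t)=\overline{\alpha(2-2t)}$ for $1/2\le t\le1$. Then $\gamma(1/2)=(a,c)$ and $H_{a,c}:K^{\mathbb{R}}_{a,c}\to K^{\mathbb{R}}_{a,c}$ is topologically conjugate to $\sigma|_{\operatorname{Fix}(\rho(\gamma))}:\operatorname{Fix}(\rho(\gamma))\to\operatorname{Fix}(\rho(\gamma))$ for this loop $\gamma$, and the conjugacy is given by the restriction of $h_{1/2}=h^{\gamma}_{1/2}:K^{\mathbb{C}}_{a,c}\to\Sigma_2$ to $K^{\mathbb{R}}_{a,c}$: it is a homeomorphism $h_{1/2}:K^{\mathbb{R}}_{a,c}\to\operatorname{Fix}(\rho(\gamma))$ with $h_{1/2}\circ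 H_{a,c}=\sigma\circ h_{1/2}$ on $K^{\mathbb{R}}_{a,c}$.
   Context: For $(a,c)\in\mathbb{C}^2$ with $a\neq 0$, let $H_{a,c}:\mathbb{C}^2\to\mathbb{C}^2$, $H_{a,c}(x,y)=(x^2+c-ay,\,x)$ (the complex Hénon map), and $$K^{\mathbb{C}}_{a,c}:=\{p\in\mathbb{C}^2 : \{H_{a,c}^n(p)\}_{n\in\mathbb{Z}}\text{ is bounded}\},\qquad K^{\mathbb{R}}_{a,c}:=K^{\mathbb{C}}_{a,c}\cap\mathbb{R}^2.$$ $K^{\mathbb{C}}_{a,c}$ is compact and $H_{a,c}$-invariant, and so is $K^{\mathbb{R}}_{a,c}$ when $a,c$ are real. Let $\Sigma_2=\{0,1\}^{\mathbb{Z}}$ with the shift $\sigma$, $(\sigma(s))_i=s_{i+1}$, and let $\operatorname{Aut}(\Sigma_2)$ be the group of homeomorphisms of $\Sigma_2$ commuting with $\sigma$. For $\psi\in\operatorname{Aut}(\Sigma_2)$, $\operatorname{Fix}(\psi)=\{s\in\Sigma_2:\psi(s)=s\}$, which is $\sigma$-invariant. (Empty systems are considered topologically conjugate to each other.) A compact invariant set $\Lambda$ of a diffeomorphism $f$ of a manifold $M$ is uniformly hyperbolic if $TM|_\Lambda=E^s\oplus E^u$ with $Tf$-invariant subbundles and there are constants $C>0$, $0<\lambda<1$ such that $\|Tf^n|_{E^s}\|<C\lambda^n$ and $\|Tf^{-n}|_{E^u}\|<C\lambda^n$ for all $n\ge 0$. A hyperbolic full horseshoe is a uniformly hyperbolic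 invariant set on which the map is topologically conjugate to $(\Sigma_2,\sigma)$. Put $$\mathcal{H}^{\mathbb{C}}:=\{(a,c)\in\mathbb{C}^2 : a\neq0,\ H_{a,c}|_{K^{\mathbb{C}}_{a,c}}\text{ is a hyperbolic full horseshoe}\},$$ $$\mathrm{HOV}:=\{(a,c)\in\mathbb{C}^2 : |c|>2(|a|+1)^2,\ a\neq0\},$$ $$\mathrm{DN}:=\{(a,c)\in\mathbb{R}^2 : c<-(5+2\sqrt5)(|a|+1)^2/4,\ a\neq 0\}.$$ It is known that $\mathrm{DN}\subset\mathrm{HOV}\subset\mathcal{H}^{\mathbb{C}}$ and that $K^{\mathbb{C}}_{a,c}\subset\mathbb{R}^2$ for $(a,c)\in\mathrm{DN}$. Let $\mathcal{H}^{\mathbb{C}}_0$ be the connected component of $\mathcal{H}^{\mathbb{C}}$ containing $\mathrm{HOV}$. It is invariant under the coordinatewise complex conjugation $(a,c)\mapsto(\bar a,\bar c)$, and $\bar\alpha$ denotes the image of a path $\alpha$ under this conjugation. Monodromy: let $b\in\mathrm{DN}$ be a basepoint and let $h_0:K^{\mathbb{C}}_{b}\to\Sigma_2$ be a chosen topological conjugacy between $H_b|_{K^{\mathbb{C}}_b}$ and $\sigma$. For a loop $\gamma:[0,1]\to\mathcal{H}^{\mathbb{C}}_0$ based at $b$, hyperbolicity along $\gamma$ gives a unique continuous family of topological conjugacies $h_t=h_t^\gamma:K^{\mathbb{C}}_{\gamma(t)}\to\Sigma_2$ (between $H_{\gamma(t)}$ and $\sigma$), $t\in[0,1]$, starting at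 the given $h_0$; continuity means that $t\mapsto h_t^{-1}(s)\in\mathbb{C}^2$ is continuous for each $s\in\Sigma_2$. The monodromy of $\gamma$ is $\rho(\gamma):=h_1\circ h_0^{-1}\in\operatorname{Aut}(\Sigma_2)$. *)

theory Defs
  imports "HOL-Analysis.Analysis"
begin

definition henon :: "complex \<times> complex \<Rightarrow> complex \<times> complex \<Rightarrow> complex \<times> complex" where
  "henon = (\<lambda>(a, c) (x, y). (x ^ 2 + c - a * y, x))"

text \<open>Iterates with exponent in the integers; only used for bijective \<open>f\<close>.\<close>

definition int_iterate :: "('a \<Rightarrow> 'a) \<Rightarrow> int \<Rightarrow> 'a \<Rightarrow> 'a" where
  "int_iterate f n = (if n \<ge> 0 then f ^^ nat n else (inv f) ^^ nat (- n))"

definition R2 :: "(complex \<times> complex) set" where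
  "R2 = \<real> \<times> \<real>"

definition KC :: "complex \<times> complex \<Rightarrow> (complex \<times> complex) set" where
  "KC p = {z. bounded (range (\<lambda>n::int. int_iterate (henon p) n z))}"

definition KR :: "complex \<times> complex \<Rightarrow> (complex \<times> complex) set" where
  "KR p = KC p \<inter> R2"

text \<open>The space of bi-infinite binary sequences is the type \<open>int \<Rightarrow> bool\<close>, whose
  topology is the product of the discrete topologies on \<open>bool\<close>.\<close>

type_synonym bisequence = "int \<Rightarrow> bool"

definition shift :: "bisequence \<Rightarrow> bisequence" where
  "shift s = (\<lambda>i. s (i + 1))"

definition Fix :: "(bisequence \<Rightarrow> bisequence) \<Rightarrow> bisequence set" where
  "Fix \<psi> = {s. \<psi> s = s}"

definition conjugacy ::
  "('a::topological_space \<Rightarrow> 'a) \<Rightarrow> 'a set \<Rightarrow> ('b::topological_space \<Rightarrow> 'b) \<Rightarrow> 'b set \<Rightarrow> ('a \<Rightarrow> 'b) \<Rightarrow> bool"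
where
  "conjugacy f X g Y h \<longleftrightarrow>
     f ` X \<subseteq> X \<and> g ` Y \<subseteq> Y \<and> (\<exists>k. homeomorphism X Y h k) \<and> (\<forall>x\<in>X. h (f x) = g (h x))"

definition topologically_conjugate ::
  "('a::topological_space \<Rightarrow> 'a) \<Rightarrow> 'a set \<Rightarrow> ('b::topological_space \<Rightarrow> 'b) \<Rightarrow> 'b set \<Rightarrow> bool"
where
  "topologically_conjugate f X g Y \<longleftrightarrow> (\<exists>h. conjugacy f X g Y h)"

text \<open>A (real) subbundle of the trivial tangent bundle over \<open>\<Lambda>\<close>: near every point of
  \<open>\<Lambda>\<close> the fibres have a continuous frame.  The rank may vary between distant points.\<close>

definition subbundle :: "'a::euclidean_space set \<Rightarrow> ('a \<Rightarrow> 'a set) \<Rightarrow> bool" where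
  "subbundle \<Lambda> E \<longleftrightarrow>
     (\<forall>x\<in>\<Lambda>. \<exists>U k. \<exists>e :: nat \<Rightarrow> 'a \<Rightarrow> 'a. open U \<and> x \<in> U \<and>
        (\<forall>i<k. continuous_on (U \<inter> \<Lambda>) (e i)) \<and>
        (\<forall>y \<in> U \<inter> \<Lambda>. inj_on (\<lambda>i. e i y) {..<k} \<and>
            independent ((\<lambda>i. e i y) ` {..<k}) \<and> E y = span ((\<lambda>i. e i y) ` {..<k})))"

text \<open>Here \<open>f\<close> is understood to be a diffeomorphism of the whole space. The conditions
  over unit vectors are bounds on the operator norms of the restricted derivatives.\<close>

definition uniformly_hyperbolic :: "('a::euclidean_space \<Rightarrow> 'a) \<Rightarrow> 'a set \<Rightarrow> bool" where
  "uniformly_hyperbolic f \<Lambda> \<longleftrightarrow>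
     compact \<Lambda> \<and> f ` \<Lambda> = \<Lambda> \<and>
     (\<exists>Es Eu. subbundle \<Lambda> Es \<and> subbundle \<Lambda> Eu \<and>
        (\<forall>x\<in>\<Lambda>. Es x \<inter> Eu x = {0} \<and> {u + v |u v. u \<in> Es x \<and> v \<in> Eu x} = UNIV) \<and>
        (\<forall>x\<in>\<Lambda>. frechet_derivative f (at x) ` Es x = Es (f x) \<and>
                 frechet_derivative f (at x) ` Eu x = Eu (f x)) \<and>
        (\<exists>C>0. \<exists>\<theta>::real. 0 < \<theta> \<and> \<theta> < 1 \<and>
           (\<forall>x\<in>\<Lambda>. \<forall>n::nat.
              (\<forall>v\<in>Es x. norm v = 1 \<longrightarrow>
                 norm (frechet_derivative (f ^^ n) (at x) v) < C * \<theta> ^ n) \<and>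
              (\<forall>v\<in>Eu x. norm v = 1 \<longrightarrow>
                 norm (frechet_derivative ((inv f) ^^ n) (at x) v) < C * \<theta> ^ n))))"

definition hyperbolic_full_horseshoe :: "('a::euclidean_space \<Rightarrow> 'a) \<Rightarrow> 'a set \<Rightarrow> bool" where
  "hyperbolic_full_horseshoe f \<Lambda> \<longleftrightarrow>
     uniformly_hyperbolic f \<Lambda> \<and> topologically_conjugate f \<Lambda> shift UNIV"

definition HC :: "(complex \<times> complex) set" where
  "HC = {(a, c). a \<noteq> 0 \<and> hyperbolic_full_horseshoe (henon (a, c)) (KC (a, c))}"

definition HOV :: "(complex \<times> complex) set" where
  "HOV = {(a, c). cmod c > 2 * (cmod a + 1) ^ 2 \<and> a \<noteq> 0}"

definition DN :: "(complex \<times> complex) set" where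
  "DN = {(a, c). a \<in> \<real> \<and> c \<in> \<real> \<and> a \<noteq> 0 \<and>
           Re c < - (5 + 2 * sqrt 5) * (\<bar>Re a\<bar> + 1) ^ 2 / 4}"

text \<open>Since \<open>HOV\<close> is nonempty, at most one component of \<open>HC\<close> contains it, so the union
  below is just that component.\<close>

definition HC0 :: "(complex \<times> complex) set" where
  "HC0 = \<Union> {C \<in> components HC. HOV \<subseteq> C}"

definition conj2 :: "complex \<times> complex \<Rightarrow> complex \<times> complex" where
  "conj2 = (\<lambda>(a, c). (cnj a, cnj c))"

definition continuous_conjugacies ::
  "(real \<Rightarrow> complex \<times> complex) \<Rightarrow> (real \<Rightarrow> complex \<times> complex \<Rightarrow> bisequence) \<Rightarrow> bool"
where
  "continuous_conjugacies \<gamma> h \<longleftrightarrow>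
     (\<forall>t\<in>{0..1}. conjugacy (henon (\<gamma> t)) (KC (\<gamma> t)) shift UNIV (h t)) \<and>
     (\<forall>s. continuous_on {0..1} (\<lambda>t. inv_into (KC (\<gamma> t)) (h t) s))"

text \<open>The continuation is unique as a family of maps \<open>h t\<close> on \<open>KC (\<gamma> t)\<close> with
  \<open>t \<in> {0..1}\<close>; the choice operator only fixes irrelevant values elsewhere.\<close>

definition continuation ::
  "(real \<Rightarrow> complex \<times> complex) \<Rightarrow> (complex \<times> complex \<Rightarrow> bisequence) \<Rightarrow>
     real \<Rightarrow> complex \<times> complex \<Rightarrow> bisequence"
where
  "continuation \<gamma> h0 =
     (SOME h. continuous_conjugacies \<gamma> h \<and> (\<forall>z \<in> KC (pathstart \<gamma>). h 0 z = h0 z))"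

definition monodromy ::
  "(real \<Rightarrow> complex \<times> complex) \<Rightarrow> (complex \<times> complex \<Rightarrow> bisequence) \<Rightarrow> bisequence \<Rightarrow> bisequence"
where
  "monodromy \<gamma> h0 = continuation \<gamma> h0 1 \<circ> inv_into (KC (pathstart \<gamma>)) h0"

text \<open>First \<open>\<alpha>\<close>, then the reversed conjugate of \<open>\<alpha>\<close>.\<close>

definition symmetric_loop :: "(real \<Rightarrow> complex \<times> complex) \<Rightarrow> real \<Rightarrow> complex \<times> complex" where
  "symmetric_loop \<alpha> = \<alpha> +++ reversepath (conj2 \<circ> \<alpha>)"

definition loop_in :: "(complex \<times> complex) set \<Rightarrow> complex \<times> complex \<Rightarrow> (real \<Rightarrow> complex \<times> complex) \<Rightarrow> bool"
where
  "loop_in S b \<gamma> \<longleftrightarrow>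
     path \<gamma> \<and> path_image \<gamma> \<subseteq> S \<and> pathstart \<gamma> = b \<and> pathfinish \<gamma> = b"

end

theory Submission
  imports Defs
begin

text \<open>Hyperbolicity of \<open>KC p\<close> is equivalent to unique bounded solvability, with a uniform bound, of
  the linear difference equation \<open>V (n + 1) = A n (V n) + W n\<close> along all bounded orbits. In this form
  it passes to nearby parameters by a Neumann series, and Newton's method on bounded sequences carries
  each bounded orbit to a unique nearby bounded orbit of a nearby map. Conversely, since
  \<open>KC p0\<close> is a full shift, every bounded orbit of a nearby map is shadowed by the orbit in \<open>KC p0\<close> with
  the same itinerary. Hence \<open>HC\<close> is open and \<open>KC\<close> is locally trivial over it; conjugacies continue
  uniquely along paths because the fibres are totally disconnected.

  Along \<open>\<gamma> = symmetric_loop \<alpha>\<close> complex conjugation maps \<open>KC (\<gamma> t)\<close> to \<open>KC (\<gamma> (1 - t))\<close>, and it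
  is the identity on \<open>KC (\<gamma> 0)\<close>, which is real. So the families \<open>h (1 - t) \<circ> conj2\<close> and
  \<open>monodromy \<circ> h t\<close> both continue \<open>h 1\<close>, and they agree. At \<open>t = 1/2\<close> the
  monodromy becomes complex conjugation of \<open>KC (a, c)\<close>, whose fixed points are the real points.\<close>

section \<open>Exponential dichotomies of linear difference equations\<close>

text \<open>The condition is Perron's admissibility: the operator sending a bounded sequence
  \<open>V\<close> to \<open>V (n + 1) - A n (V n)\<close> is invertible, with inverse of norm at
  most \<open>M\<close>. It mentions no subspaces, so a perturbation affects only the number
  \<open>M\<close>, whereas a splitting would have to be followed through cone fields or graph
  transforms. Smallness conditions have the shape \<open>M * L \<le> 1/2\<close>, which makes an
  error with Lipschitz constant \<open>L\<close> a contraction by one half; this is the origin of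
  the constant \<open>2 * M\<close> after perturbation and of the radius \<open>1 / (8 * M)\<close>.

  The obstacle to openness of \<open>HC\<close> is that a nearby map might have bounded orbits that
  continue no orbit in \<open>KC p0\<close>. Compactness controls such an orbit only on finite time
  windows, each approximated by its own point of \<open>KC p0\<close>. Joining the windows calls for
  one genuine orbit in \<open>KC p0\<close>; the absence of any constraint on symbol sequences
  supplies it.\<close>

definition dichotomy :: "real \<Rightarrow> (int \<Rightarrow> 'a::real_normed_vector \<Rightarrow> 'a) \<Rightarrow> bool" where
  "dichotomy M A \<longleftrightarrow> M > 0 \<and> (\<forall>n. linear (A n)) \<and>
     (\<forall>W r. (\<forall>n. norm (W n) \<le> r) \<longrightarrow>
        (\<exists>V. (\<forall>n. norm (V n) \<le> M * r) \<and> (\<forall>n. V (n + 1) = A n (V n) + W n))) \<and>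
     (\<forall>V B. (\<forall>n. norm (V n) \<le> B) \<and> (\<forall>n. V (n + 1) = A n (V n)) \<longrightarrow> (\<forall>n. V n = 0))"

lemma dichotomy_pos: "dichotomy M A \<Longrightarrow> M > 0"
  and dichotomy_linear: "dichotomy M A \<Longrightarrow> linear (A n)"
  by (auto simp: dichotomy_def)

lemma dichotomy_solution:
  assumes "dichotomy M A" "\<And>n. norm (W n) \<le> r"
  shows "\<exists>V. (\<forall>n. norm (V n) \<le> M * r) \<and> (\<forall>n. V (n + 1) = A n (V n) + W n)"
  using assms unfolding dichotomy_def by blast

lemma dichotomy_zero:
  assumes "dichotomy M A" "\<And>n. norm (V n) \<le> B" "\<And>n. V (n + 1) = A n (V n)"
  shows "V n = 0"
  using assms unfolding dichotomy_def by blast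

text \<open>Existence yields one solution with the bound \<open>M * r\<close>, and uniqueness
  identifies it with any given bounded one. The a priori bound \<open>B\<close> leaves no trace in
  the estimate.\<close>

lemma dichotomy_bound:
  assumes D: "dichotomy M A" and B: "\<And>n. norm (V n) \<le> B"
    and V: "\<And>n. V (n + 1) = A n (V n) + W n" and r: "\<And>n. norm (W n) \<le> r"
  shows "norm (V n) \<le> M * r"
proof -
  obtain U where U: "\<And>n. norm (U n) \<le> M * r" "\<And>n. U (n + 1) = A n (U n) + W n"
    using dichotomy_solution[OF D, of W, OF r] by blast
  have "V n - U n = 0"
  proof (rule dichotomy_zero[OF D, where V = "\<lambda>n. V n - U n"])
    show "norm (V n - U n) \<le> B + M * r" for n
      using norm_triangle_ineq4[of "V n" "U n"] B[of n] U(1)[of n] by linarith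
    show "V (n + 1) - U (n + 1) = A n (V n - U n)" for n
      by (simp add: V U linear_diff[OF dichotomy_linear[OF D]])
  qed
  with U show ?thesis by simp
qed

text \<open>With \<open>W\<close> as a source of size \<open>L * b\<close>,
  \<open>dichotomy_bound\<close> improves a bound \<open>b\<close> for \<open>V\<close> to
  \<open>b / 2\<close>. As \<open>W\<close> may depend on \<open>V\<close> nonlinearly, this is the
  common uniqueness argument for perturbed linear equations and for differences of nonlinear
  orbits.\<close>

lemma dichotomy_contraction_zero:
  assumes D: "dichotomy M A" and B: "\<And>n. norm (V n) \<le> B"
    and V: "\<And>n. V (n + 1) = A n (V n) + W n"
    and L: "\<And>n. norm (W n) \<le> L * norm (V n)" and L0: "L \<ge> 0" and Lsmall: "M * L \<le> 1/2"
  shows "V n = 0"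
proof -
  have halve: "\<forall>n. norm (V n) \<le> b / 2" if b: "\<forall>n. norm (V n) \<le> b" for b
  proof
    fix n
    have b0: "b \<ge> 0" using b norm_ge_zero order_trans by blast
    have "norm (V n) \<le> M * (L * b)"
    proof (rule dichotomy_bound[OF D, where V = V and W = W, OF B V])
      show "norm (W n) \<le> L * b" for n
        using L[of n] mult_left_mono[OF b[rule_format, of n] L0] by linarith
    qed
    also have "\<dots> \<le> 1/2 * b"
      using mult_right_mono[OF Lsmall b0] by (simp add: mult.assoc)
    finally show "norm (V n) \<le> b / 2" by simp
  qed
  have "\<forall>n. norm (V n) \<le> B / 2 ^ k" for k
  proof (induction k)
    case 0 show ?case using B by simp
  next
    case (Suc k) show ?case using halve[OF Suc] by (simp add: field_simps)
  qed
  moreover have "(\<lambda>k. B / 2 ^ k) \<longlonglongrightarrow> 0"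
    by (rule LIMSEQ_divide_realpow_zero) simp
  ultimately have "norm (V n) \<le> 0"
    by (intro LIMSEQ_le_const[where X = "\<lambda>k. B / 2 ^ k"]) auto
  then show ?thesis by simp
qed

lemma int_bcontfun: "(\<lambda>n::int. f n) \<in> bcontfun" if "\<And>n. norm (f n) \<le> B"
  by (rule bcontfun_normI[OF _ that]) (simp add: continuous_on_open_vimage[OF open_UNIV] open_discrete)

text \<open>The library instance is for metric index spaces only, and \<open>int\<close> is not one.\<close>

lemma complete_int_bcontfun: "complete (UNIV :: (int \<Rightarrow>\<^sub>C 'a::complete_space) set)"
  unfolding complete_def
proof (intro allI impI)
  fix f :: "nat \<Rightarrow> int \<Rightarrow>\<^sub>C 'a" assume "(\<forall>n. f n \<in> UNIV) \<and> Cauchy f"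
  then have "uniformly_Cauchy_on UNIV (\<lambda>k n. apply_bcontfun (f k) n)"
    unfolding uniformly_Cauchy_on_def Cauchy_def by (meson dist_bounded le_less_trans)
  then obtain g where "uniform_limit UNIV f g sequentially"
    using Cauchy_uniformly_convergent uniformly_convergent_on_def by blast
  then obtain l where "f \<longlonglongrightarrow> l"
    by (metis uniform_limit_bcontfunE sequentially_bot)
  then show "\<exists>l\<in>UNIV. f \<longlonglongrightarrow> l" by blast
qed

text \<open>A quantitative implicit function theorem on bounded sequences. With \<open>g\<close> affine it is a
  Neumann series, with \<open>g\<close> quadratic it is Newton's method.\<close>

lemma dichotomy_fixpoint:
  fixes A :: "int \<Rightarrow> 'a::banach \<Rightarrow> 'a"
  assumes D: "dichotomy M A" and \<delta>: "0 \<le> \<delta>"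
    and lip: "\<And>n u v. norm u \<le> \<delta> \<Longrightarrow> norm v \<le> \<delta> \<Longrightarrow> norm (g n u - g n v) \<le> L * norm (u - v)"
    and L0: "L \<ge> 0" and Lsmall: "M * L \<le> 1/2" and g0: "\<And>n. M * norm (g n 0) \<le> \<delta> / 2"
  shows "\<exists>!V. (\<forall>n. norm (V n) \<le> \<delta>) \<and> (\<forall>n. V (n + 1) = A n (V n) + g n (V n))"
proof (rule ex_ex1I)
  have M0: "M > 0" by (rule dichotomy_pos[OF D])
  \<comment> \<open>Half of the budget \<open>\<delta> / M\<close> covers \<open>g n 0\<close>, the
    other half the variation of \<open>g n\<close> on the ball; a source of size
    \<open>\<delta> / M\<close> has a solution of size \<open>\<delta>\<close>.\<close>
  have gb: "norm (g n v) \<le> \<delta> / M" if "norm v \<le> \<delta>" for n v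
  proof -
    have "norm (g n v) \<le> norm (g n 0) + L * norm v"
      using lip[OF that, of 0 n] \<delta> norm_triangle_ineq2[of "g n v" "g n 0"] by simp
    then have "M * norm (g n v) \<le> M * norm (g n 0) + (M * L) * norm v"
      using mult_left_mono[of _ _ M] M0 by (fastforce simp: distrib_left mult.assoc)
    also have "\<dots> \<le> \<delta> / 2 + 1/2 * \<delta>"
      using g0[of n] that Lsmall M0 L0 by (intro add_mono mult_mono) auto
    finally show ?thesis using M0 by (simp add: field_simps)
  qed
  define sol where "sol W = (SOME V. (\<forall>n. norm (V n) \<le> \<delta>) \<and> (\<forall>n. V (n + 1) = A n (V n) + W n))"
    for W :: "int \<Rightarrow> 'a"
  have sol: "(\<forall>n. norm (sol W n) \<le> \<delta>) \<and> (\<forall>n. sol W (n + 1) = A n (sol W n) + W n)"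
    if W: "\<And>n. norm (W n) \<le> \<delta> / M" for W
  proof -
    have "\<exists>V. (\<forall>n. norm (V n) \<le> \<delta>) \<and> (\<forall>n. V (n + 1) = A n (V n) + W n)"
      using dichotomy_solution[of M A W, OF D W] M0 by simp
    then show ?thesis unfolding sol_def by (rule someI_ex)
  qed
  define S :: "(int \<Rightarrow>\<^sub>C 'a) set" where "S = {V. \<forall>n. norm (apply_bcontfun V n) \<le> \<delta>}"
  define F where "F V = Bcontfun (sol (\<lambda>n. g n (apply_bcontfun V n)))" for V :: "int \<Rightarrow>\<^sub>C 'a"
  have F: "apply_bcontfun (F V) = sol (\<lambda>n. g n (V n))" if "V \<in> S" for V
    unfolding F_def
  proof (rule Bcontfun_inverse, rule int_bcontfun)
    show "norm (sol (\<lambda>n. g n (V n)) n) \<le> \<delta>" for n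
      using sol[of "\<lambda>n. g n (V n)"] gb that by (auto simp: S_def)
  qed
  have Fsol: "(\<forall>n. norm (F V n) \<le> \<delta>) \<and> (\<forall>n. F V (n + 1) = A n (F V n) + g n (V n))"
    if "V \<in> S" for V
    unfolding F[OF that] by (rule sol) (use gb that in \<open>auto simp: S_def\<close>)
  \<comment> \<open>\<open>F\<close> solves the linear equation with source
    \<open>g n (V n)\<close>. Its contraction factor is \<open>M * L\<close>: the difference of two
    images is a bounded solution driven by the difference of the sources.\<close>
  have "\<exists>!V. V \<in> S \<and> F V = V"
  proof (rule Banach_fix)
    have S_eq: "S = cball 0 \<delta>"
    proof (intro set_eqI iffI)
      fix V assume "V \<in> S"
      then show "V \<in> cball 0 \<delta>" by (auto simp: S_def norm_bound)
    next
      fix V assume "V \<in> cball (0 :: int \<Rightarrow>\<^sub>C 'a) \<delta>"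
      then show "V \<in> S" using norm_bounded[of V] by (auto simp: S_def intro: order_trans)
    qed
    show "complete S" unfolding S_eq
      by (rule complete_closed_subset[OF closed_cball subset_UNIV complete_int_bcontfun])
    show "S \<noteq> {}" unfolding S_eq using \<delta> by simp
    show "(0::real) \<le> 1/2" "(1/2::real) < 1" by simp_all
    show "F ` S \<subseteq> S" using Fsol by (auto simp: S_def)
    fix U V assume UV: "U \<in> S" "V \<in> S"
    have "dist (F U n) (F V n) \<le> 1/2 * dist U V" for n
    proof -
      have "norm (F U n - F V n) \<le> M * (L * dist U V)"
      proof (rule dichotomy_bound[OF D, where V = "\<lambda>n. F U n - F V n" and W = "\<lambda>n. g n (U n) - g n (V n)"])
        show "norm (F U n - F V n) \<le> \<delta> + \<delta>" for n
          using Fsol[OF UV(1)] Fsol[OF UV(2)] norm_triangle_ineq4[of "F U n" "F V n"]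
          by (smt (verit))
        show "F U (n + 1) - F V (n + 1) = A n (F U n - F V n) + (g n (U n) - g n (V n))" for n
          using Fsol[OF UV(1)] Fsol[OF UV(2)] by (simp add: linear_diff[OF dichotomy_linear[OF D]])
        show "norm (g n (U n) - g n (V n)) \<le> L * dist U V" for n
        proof -
          have "norm (g n (U n) - g n (V n)) \<le> L * dist (U n) (V n)"
            using lip[of "U n" "V n" n] UV by (auto simp: S_def dist_norm)
          also have "\<dots> \<le> L * dist U V" by (intro mult_left_mono dist_bounded L0)
          finally show ?thesis .
        qed
      qed
      also have "\<dots> \<le> 1/2 * dist U V" using mult_right_mono[OF Lsmall zero_le_dist[of U V]]
        by (simp add: mult.assoc)
      finally show ?thesis by (simp add: dist_norm)
    qed
    then show "dist (F U) (F V) \<le> 1/2 * dist U V" by (rule dist_bound)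
  qed
  then obtain V where "V \<in> S" "F V = V" by blast
  then have "(\<forall>n. norm (V n) \<le> \<delta>) \<and> (\<forall>n. V (n + 1) = A n (V n) + g n (V n))"
    using Fsol by fastforce
  then show "\<exists>V. (\<forall>n. norm (V n) \<le> \<delta>) \<and> (\<forall>n. V (n + 1) = A n (V n) + g n (V n))" by blast
next
  fix U V :: "int \<Rightarrow> 'a"
  assume U: "(\<forall>n. norm (U n) \<le> \<delta>) \<and> (\<forall>n. U (n + 1) = A n (U n) + g n (U n))"
     and V: "(\<forall>n. norm (V n) \<le> \<delta>) \<and> (\<forall>n. V (n + 1) = A n (V n) + g n (V n))"
  have "U n - V n = 0" for n
  proof (rule dichotomy_contraction_zero[OF D, where W = "\<lambda>n. g n (U n) - g n (V n)"])
    show "norm (U n - V n) \<le> \<delta> + \<delta>" for n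
      using U V norm_triangle_ineq4[of "U n" "V n"] by (smt (verit))
    show "U (n + 1) - V (n + 1) = A n (U n - V n) + (g n (U n) - g n (V n))" for n
      using U V by (simp add: linear_diff[OF dichotomy_linear[OF D]])
    show "norm (g n (U n) - g n (V n)) \<le> L * norm (U n - V n)" for n
      using lip U V by blast
  qed (use L0 Lsmall in auto)
  then show "U = V" by (auto simp: fun_eq_iff)
qed

text \<open>A solution for \<open>A'\<close> is a solution for \<open>A\<close> with source
  \<open>A' n (V n) - A n (V n) + W n\<close>, so \<open>dichotomy_fixpoint\<close> applies on the
  ball of radius \<open>2 * M * r\<close>. The factor 2 is the geometric series of the contraction
  factor 1/2.\<close>

lemma dichotomy_perturb:
  fixes A :: "int \<Rightarrow> 'a::banach \<Rightarrow> 'a"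
  assumes D: "dichotomy M A" and lin: "\<And>n. linear (A' n)"
    and L: "\<And>n v. norm (A' n v - A n v) \<le> L * norm v" and L0: "L \<ge> 0" and Lsmall: "M * L \<le> 1/2"
  shows "dichotomy (2 * M) A'"
  unfolding dichotomy_def
proof (intro conjI allI impI)
  show "0 < 2 * M" using dichotomy_pos[OF D] by simp
  show "linear (A' n)" for n by (rule lin)
  have linA: "linear (A n)" for n by (rule dichotomy_linear[OF D])
  fix W :: "int \<Rightarrow> 'a" and r assume W: "\<forall>n. norm (W n) \<le> r"
  have r: "r \<ge> 0" using W norm_ge_zero order_trans by blast
  have "\<exists>!V. (\<forall>n. norm (V n) \<le> 2 * M * r) \<and> (\<forall>n. V (n + 1) = A n (V n) + (A' n (V n) - A n (V n) + W n))"
  proof (rule dichotomy_fixpoint[OF D _ _ L0 Lsmall])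
    show "0 \<le> 2 * M * r" using r dichotomy_pos[OF D] by simp
    show "norm (A' n u - A n u + W n - (A' n v - A n v + W n)) \<le> L * norm (u - v)" for n u v
      using L[of n "u - v"] by (simp add: linear_diff[OF lin] linear_diff[OF linA] algebra_simps)
    show "M * norm (A' n 0 - A n 0 + W n) \<le> 2 * M * r / 2" for n
      using W dichotomy_pos[OF D] by (simp add: linear_0[OF lin] linear_0[OF linA])
  qed
  then obtain V where "\<forall>n. norm (V n) \<le> 2 * M * r"
    "\<forall>n. V (n + 1) = A n (V n) + (A' n (V n) - A n (V n) + W n)" by blast
  then show "\<exists>V. (\<forall>n. norm (V n) \<le> 2 * M * r) \<and> (\<forall>n. V (n + 1) = A' n (V n) + W n)"
    by (intro exI[of _ V]) auto
next
  fix V :: "int \<Rightarrow> 'a" and B n assume V: "(\<forall>n. norm (V n) \<le> B) \<and> (\<forall>n. V (n + 1) = A' n (V n))"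
  show "V n = 0"
    by (rule dichotomy_contraction_zero[OF D, where W = "\<lambda>n. A' n (V n) - A n (V n)" and B=B and L = L])
       (use V L L0 Lsmall in auto)
qed

text \<open>Conjugating by the weights \<open>q ^ nat \<bar>n\<bar>\<close> multiplies each \<open>A n\<close> by \<open>q\<close> or \<open>1 / q\<close>, a small
  perturbation when \<open>q\<close> is close to 1.\<close>

lemma dichotomy_decay:
  fixes A :: "int \<Rightarrow> 'a::banach \<Rightarrow> 'a"
  assumes D: "dichotomy M A" and B: "\<And>n v. norm (A n v) \<le> B * norm v"
    and q: "q > 1" and Mq: "M * ((q - 1) * B) \<le> 1/2"
    and V: "\<And>n. V (n + 1) = A n (V n) + W n" and Vb: "\<And>n. norm (V n) \<le> b"
    and r: "\<And>n. q ^ nat \<bar>n + 1\<bar> * norm (W n) \<le> r"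
  shows "q ^ nat \<bar>n\<bar> * norm (V n) \<le> 2 * M * r"
proof -
  define w where "w n = q ^ nat \<bar>n\<bar>" for n :: int
  have w0: "w n > 0" and w1: "w n \<ge> 1" for n using q by (auto simp: w_def)
  have lin: "linear (A n)" for n by (rule dichotomy_linear[OF D])
  have B0: "0 \<le> B * norm v" for v :: 'a using B[of 0 v] norm_ge_zero order_trans by blast
  have ratio: "\<bar>w (n + 1) / w n - 1\<bar> \<le> q - 1" for n
  proof (cases "n \<ge> 0")
    case True
    then have "nat \<bar>n + 1\<bar> = Suc (nat \<bar>n\<bar>)" by simp
    then have "w (n + 1) = q * w n" by (simp only: w_def power_Suc)
    then show ?thesis using q w0[of n] by simp
  next
    case False
    then have "nat \<bar>n\<bar> = Suc (nat \<bar>n + 1\<bar>)" by simp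
    then have "w n = q * w (n + 1)" by (simp only: w_def power_Suc)
    moreover have "\<bar>1 / q - 1\<bar> \<le> q - 1"
    proof -
      have "1 / q \<le> 1" using q by simp
      moreover have "1 - 1 / q = (q - 1) / q" using q by (simp add: field_simps)
      moreover have "(q - 1) / q \<le> q - 1" using q divide_left_mono[of 1 q "q - 1"] by simp
      ultimately show ?thesis by linarith
    qed
    ultimately show ?thesis using q w0[of "n + 1"] by simp
  qed
  let ?A' = "\<lambda>n v. (w (n + 1) / w n) *\<^sub>R A n v"
  \<comment> \<open>On a trivial space the hypothesis permits a negative \<open>B\<close>;
    \<open>max B 0\<close> keeps the Lipschitz constant nonnegative.\<close>
  have pert: "norm (?A' n v - A n v) \<le> (q - 1) * max B 0 * norm v" for n v
  proof -
    have "?A' n v - A n v = (w (n + 1) / w n - 1) *\<^sub>R A n v" by (simp add: scaleR_left_diff_distrib)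
    then have "norm (?A' n v - A n v) = \<bar>w (n + 1) / w n - 1\<bar> * norm (A n v)" by simp
    also have "\<dots> \<le> (q - 1) * (B * norm v)" by (intro mult_mono ratio B) (use q in auto)
    also have "\<dots> \<le> (q - 1) * (max B 0 * norm v)"
      by (intro mult_left_mono mult_right_mono) (use q in auto)
    finally show ?thesis by simp
  qed
  have D': "dichotomy (2 * M) ?A'"
  proof (rule dichotomy_perturb[OF D _ pert])
    show "linear (?A' n)" for n
      by (rule linearI) (simp_all add: linear_add[OF lin] linear_scale[OF lin] scaleR_add_right)
    show "M * ((q - 1) * max B 0) \<le> 1 / 2" using Mq by (auto simp: max_def)
  qed (use q in simp)
  have wW: "norm (w (n + 1) *\<^sub>R W n) \<le> r" for n
    using r[of n] w0[of "n + 1"] by (simp add: w_def)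
  obtain G where G: "\<And>n. norm (G n) \<le> 2 * M * r" "\<And>n. G (n + 1) = ?A' n (G n) + w (n + 1) *\<^sub>R W n"
    using dichotomy_solution[OF D', of "\<lambda>n. w (n + 1) *\<^sub>R W n", OF wW] by blast
  \<comment> \<open>Removing the weights from \<open>G\<close> gives a solution of the original
    equation, bounded because \<open>w n \<ge> 1\<close>. Uniqueness identifies it with
    \<open>V\<close>, so the bound for \<open>G\<close> becomes the decay of
    \<open>V\<close>.\<close>
  have "V n - (1 / w n) *\<^sub>R G n = 0"
  proof (rule dichotomy_zero[OF D, where V = "\<lambda>n. V n - (1 / w n) *\<^sub>R G n"])
    have Mr: "0 \<le> 2 * M * r" using G(1) norm_ge_zero order_trans by blast
    show "norm (V n - (1 / w n) *\<^sub>R G n) \<le> b + 2 * M * r" for n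
    proof -
      have "norm ((1 / w n) *\<^sub>R G n) = norm (G n) / w n" using w0[of n] by simp
      also have "\<dots> \<le> norm (G n) / 1" by (intro divide_left_mono w1) (use w0[of n] in auto)
      finally show ?thesis
        using G(1)[of n] Vb[of n] norm_triangle_ineq4[of "V n" "(1 / w n) *\<^sub>R G n"] by linarith
    qed
    show "V (n + 1) - (1 / w (n + 1)) *\<^sub>R G (n + 1) = A n (V n - (1 / w n) *\<^sub>R G n)" for n
      using w0[of n] w0[of "n + 1"]
      by (simp add: V G(2) linear_diff[OF lin] linear_scale[OF lin] scaleR_add_right)
  qed
  then have "V n = (1 / w n) *\<^sub>R G n" by simp
  then have "w n * norm (V n) = norm (G n)" using w0[of n] by simp
  then show ?thesis using G(1)[of n] by (simp add: w_def)
qed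

section \<open>Orbits of the Henon map\<close>

definition orb :: "complex \<times> complex \<Rightarrow> complex \<times> complex \<Rightarrow> int \<Rightarrow> complex \<times> complex" where
  "orb p z n = int_iterate (henon p) n z"

definition henon_inv :: "complex \<times> complex \<Rightarrow> complex \<times> complex \<Rightarrow> complex \<times> complex" where
  "henon_inv p z = (snd z, ((snd z)\<^sup>2 + snd p - fst z) / fst p)"

definition henon_deriv :: "complex \<times> complex \<Rightarrow> complex \<times> complex \<Rightarrow> complex \<times> complex \<Rightarrow> complex \<times> complex" where
  "henon_deriv p z v = (2 * fst z * fst v - fst p * snd v, fst v)"

lemma henon_eq: "henon p z = ((fst z)\<^sup>2 + snd p - fst p * snd z, fst z)"
  by (simp add: henon_def case_prod_unfold)

lemma henon_henon_inv: "fst p \<noteq> 0 \<Longrightarrow> henon p (henon_inv p z) = z"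
  by (simp add: henon_eq henon_inv_def)

lemma henon_inv_henon: "fst p \<noteq> 0 \<Longrightarrow> henon_inv p (henon p z) = z"
  by (simp add: henon_eq henon_inv_def)

lemma inv_henon: "fst p \<noteq> 0 \<Longrightarrow> inv (henon p) = henon_inv p"
  by (rule inv_unique_comp) (auto simp: henon_henon_inv henon_inv_henon)

lemma orb_0 [simp]: "orb p z 0 = z"
  by (simp add: orb_def int_iterate_def)

lemma orb_nat: "orb p z (int n) = (henon p ^^ n) z"
  by (simp add: orb_def int_iterate_def)

lemma orb_neg: "fst p \<noteq> 0 \<Longrightarrow> orb p z (- int n) = (henon_inv p ^^ n) z"
  by (cases "n = 0") (auto simp: orb_def int_iterate_def inv_henon)

lemma orb_step:
  assumes "fst p \<noteq> 0"
  shows "orb p z (n + 1) = henon p (orb p z n)"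
proof (cases "n \<ge> 0")
  case True
  then obtain k where "n = int k" by (metis zero_le_imp_eq_int)
  then show ?thesis using orb_nat[of p z "Suc k"] by (simp add: orb_nat add.commute)
next
  case False
  then obtain k where k: "n = - int (Suc k)"
    by (metis linorder_not_le not_less_eq_eq negD uminus_add_conv_diff zless_iff_Suc_zadd)
  then have "n + 1 = - int k" by simp
  then show ?thesis
    unfolding k using orb_neg[OF assms, of z k] orb_neg[OF assms, of z "Suc k"]
    by (simp add: henon_henon_inv[OF assms])
qed

lemma orb_back:
  assumes "fst p \<noteq> 0"
  shows "orb p z (n - 1) = henon_inv p (orb p z n)"
  using orb_step[OF assms, of z "n - 1"] henon_inv_henon[OF assms] by simp

lemma orb_unique:
  assumes a: "fst p \<noteq> 0" and \<zeta>: "\<And>n. \<zeta> (n + 1) = henon p (\<zeta> n)"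
  shows "\<zeta> n = orb p (\<zeta> 0) n"
proof (induction n rule: int_induct[where k = 0])
  case base show ?case by simp
next
  case (step1 i) then show ?case by (simp add: \<zeta> orb_step[OF a])
next
  case (step2 i)
  have "\<zeta> (i - 1) = henon_inv p (\<zeta> i)" using \<zeta>[of "i - 1"] henon_inv_henon[OF a] by simp
  with step2 show ?case by (simp add: orb_back[OF a])
qed

lemma orb_add:
  assumes a: "fst p \<noteq> 0"
  shows "orb p (orb p z m) n = orb p z (m + n)"
  using orb_unique[OF a, of "\<lambda>n. orb p z (m + n)" n] orb_step[OF a, of z "m + _"]
  by (simp add: add.assoc[symmetric])

lemma KC_iff: "z \<in> KC p \<longleftrightarrow> bounded (range (orb p z))"
  unfolding KC_def orb_def by simp

lemma KC_I:
  fixes \<zeta> :: "int \<Rightarrow> complex \<times> complex"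
  assumes "fst p \<noteq> 0" "\<And>n. \<zeta> (n + 1) = henon p (\<zeta> n)" "\<And>n. norm (\<zeta> n) \<le> B"
  shows "\<zeta> n \<in> KC p"
proof -
  have "orb p (\<zeta> n) m = \<zeta> (n + m)" for m
    using orb_unique[OF assms(1), of "\<lambda>m. \<zeta> (n + m)" m] assms(2)[of "n + _"]
    by (simp add: add.assoc[symmetric])
  then show ?thesis using assms(3) by (auto simp: KC_iff bounded_iff)
qed

lemma orb_in_KC:
  assumes "fst p \<noteq> 0" "z \<in> KC p"
  shows "orb p z n \<in> KC p"
proof -
  obtain B where "\<And>n. norm (orb p z n) \<le> B" using assms(2) by (auto simp: KC_iff bounded_iff)
  then show ?thesis using KC_I[of p "orb p z" B n] orb_step assms(1) by blast
qed

lemma henon_in_KC: "fst p \<noteq> 0 \<Longrightarrow> z \<in> KC p \<Longrightarrow> henon p z \<in> KC p"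
  using orb_in_KC[of p z 1] orb_step[of p z 0] by simp

lemma henon_image_KC:
  assumes "fst p \<noteq> 0"
  shows "henon p ` KC p = KC p"
proof -
  have "z \<in> henon p ` KC p" if "z \<in> KC p" for z
    using orb_in_KC[OF assms that, of "- 1"] orb_step[OF assms, of z "- 1"] by (metis add.commute imageI orb_0 uminus_add_conv_diff diff_self)
  then show ?thesis using henon_in_KC[OF assms] by blast
qed

section \<open>A priori bounds for bounded orbits\<close>

definition orb_radius :: "complex \<times> complex \<Rightarrow> real" where
  "orb_radius p = 2 + norm (fst p) + norm (snd p)"

text \<open>For \<open>p = (a, c)\<close> the first coordinates obey
  \<open>x (n + 1) = (x n)\<^sup>2 + c - a * x (n - 1)\<close>; solving for the square and taking
  suprema gives the quadratic inequality. It is kept unsolved because \<open>KC_DN_real\<close> uses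
  it in this sharp form, while \<open>orb_radius\<close> suffices elsewhere.\<close>

lemma orb_sup:
  assumes a: "fst p \<noteq> 0" and z: "z \<in> KC p"
  obtains S where "S \<ge> 0" "\<And>n. norm (fst (orb p z n)) \<le> S"
    "S\<^sup>2 \<le> norm (snd p) + (1 + norm (fst p)) * S"
proof -
  define x where "x n = fst (orb p z n)" for n
  define S where "S = (SUP n. norm (x n))"
  obtain B where B: "\<And>n. norm (orb p z n) \<le> B" using z by (auto simp: KC_iff bounded_iff)
  have "norm (x n) \<le> B" for n using B[of n] norm_fst_le[of "fst (orb p z n)" "snd (orb p z n)"]
    by (simp add: x_def)
  then have bdd: "bdd_above (range (\<lambda>n. norm (x n)))" by (auto simp: bdd_above_def)
  have S: "norm (x n) \<le> S" for n unfolding S_def by (rule cSUP_upper[OF UNIV_I bdd])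
  have S0: "S \<ge> 0" using S[of 0] norm_ge_zero order_trans by blast
  have snd: "snd (orb p z n) = x (n - 1)" for n
    using orb_step[OF a, of z "n - 1"] by (simp add: x_def henon_eq)
  have rec: "(x n)\<^sup>2 = x (n + 1) - snd p + fst p * x (n - 1)" for n
    unfolding x_def[of "n + 1"] orb_step[OF a] by (simp add: henon_eq snd x_def)
  have sq: "(norm (x n))\<^sup>2 \<le> norm (snd p) + (1 + norm (fst p)) * S" for n
  proof -
    have "(norm (x n))\<^sup>2 = norm ((x n)\<^sup>2)" by (simp add: norm_power)
    also have "\<dots> \<le> norm (x (n + 1)) + norm (snd p) + norm (fst p) * norm (x (n - 1))"
      unfolding rec using norm_triangle_ineq[of "x (n + 1) - snd p" "fst p * x (n - 1)"]
        norm_triangle_ineq4[of "x (n + 1)" "snd p"] by (simp add: norm_mult)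
    also have "\<dots> \<le> S + norm (snd p) + norm (fst p) * S"
      by (intro add_mono mult_left_mono S) auto
    finally show ?thesis by (simp add: algebra_simps)
  qed
  let ?q = "norm (snd p) + (1 + norm (fst p)) * S"
  have "S \<le> sqrt ?q"
    unfolding S_def by (rule cSUP_least) (use sq S_def in \<open>auto intro: real_le_rsqrt\<close>)
  then have "S\<^sup>2 \<le> ?q" using S0 by (metis real_sqrt_le_iff real_sqrt_unique)
  with S S0 show ?thesis using that unfolding x_def by blast
qed

lemma orb_fst_bound:
  assumes "fst p \<noteq> 0" "z \<in> KC p"
  shows "norm (fst (orb p z n)) \<le> orb_radius p"
proof -
  obtain S where S: "S \<ge> 0" "\<And>n. norm (fst (orb p z n)) \<le> S"
    "S\<^sup>2 \<le> norm (snd p) + (1 + norm (fst p)) * S"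
    using orb_sup[OF assms] by blast
  \<comment> \<open>\<open>orb_radius\<close> is a crude upper bound for the positive root of the
    quadratic inequality, and visibly continuous in the parameter.\<close>
  have "S \<le> orb_radius p"
  proof (rule ccontr)
    assume "\<not> S \<le> orb_radius p"
    then have g: "S > 2 + norm (fst p) + norm (snd p)" by (simp add: orb_radius_def)
    have S1: "S \<ge> 1" using g norm_ge_zero[of "fst p"] norm_ge_zero[of "snd p"] by linarith
    have "S\<^sup>2 \<ge> (2 + norm (fst p) + norm (snd p)) * S"
      unfolding power2_eq_square using g S(1) by (intro mult_right_mono) auto
    moreover have "norm (snd p) * S \<ge> norm (snd p) * 1" using S1 by (intro mult_left_mono) auto
    ultimately have "S \<le> 0" using S(3) by (simp add: algebra_simps)
    then show False using S1 by simp
  qed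
  then show ?thesis using S(2)[of n] by linarith
qed

lemma orb_bound:
  assumes "fst p \<noteq> 0" "z \<in> KC p"
  shows "norm (orb p z n) \<le> 2 * orb_radius p"
proof -
  have "snd (orb p z n) = fst (orb p z (n - 1))"
    using orb_step[OF assms(1), of z "n - 1"] by (simp add: henon_eq)
  then show ?thesis
    using orb_fst_bound[OF assms, of n] orb_fst_bound[OF assms, of "n - 1"]
      norm_Pair_le[of "fst (orb p z n)" "snd (orb p z n)"]
    unfolding prod.collapse by simp
qed

lemma KC_bound: "fst p \<noteq> 0 \<Longrightarrow> z \<in> KC p \<Longrightarrow> norm z \<le> 2 * orb_radius p"
  using orb_bound[of p z 0] by simp

section \<open>Dependence of bounded orbits on the parameter\<close>

lemma tendsto_orb:
  assumes p: "(p \<longlongrightarrow> p0) F" and z: "(z \<longlongrightarrow> z0) F"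
    and a0: "fst p0 \<noteq> 0" and a: "\<forall>\<^sub>F k in F. fst (p k) \<noteq> 0"
  shows "((\<lambda>k. orb (p k) (z k) n) \<longlongrightarrow> orb p0 z0 n) F"
proof -
  have fs: "((\<lambda>k. fst (p k)) \<longlongrightarrow> fst p0) F" "((\<lambda>k. snd (p k)) \<longlongrightarrow> snd p0) F"
    using p by (auto intro: tendsto_fst tendsto_snd)
  have 1: "((\<lambda>k. henon (p k) (w k)) \<longlongrightarrow> henon p0 w0) F" if "(w \<longlongrightarrow> w0) F" for w w0
    unfolding henon_eq by (intro tendsto_intros fs that tendsto_fst[OF that] tendsto_snd[OF that])
  have 2: "((\<lambda>k. henon_inv (p k) (w k)) \<longlongrightarrow> henon_inv p0 w0) F" if "(w \<longlongrightarrow> w0) F" for w w0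
    unfolding henon_inv_def by (intro tendsto_intros fs that tendsto_fst[OF that] tendsto_snd[OF that] a0)
  show ?thesis
  proof (induction n rule: int_induct[where k = 0])
    case base show ?case using z by simp
  next
    case (step1 i)
    show ?case unfolding orb_step[OF a0]
      by (rule Lim_transform_eventually[OF 1[OF step1(2)]])
         (use a in \<open>auto elim!: eventually_mono simp: orb_step\<close>)
  next
    case (step2 i)
    show ?case unfolding orb_back[OF a0]
      by (rule Lim_transform_eventually[OF 2[OF step2(2)]])
         (use a in \<open>auto elim!: eventually_mono simp: orb_back\<close>)
  qed
qed

lemma eventually_fst_nz:
  fixes p :: "'k \<Rightarrow> complex \<times> complex"
  assumes "(p \<longlongrightarrow> p0) F" "fst p0 \<noteq> 0"
  shows "\<forall>\<^sub>F k in F. fst (p k) \<noteq> 0"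
  using tendsto_imp_eventually_ne[OF tendsto_fst[OF assms(1)] assms(2)] .

lemma tendsto_orb_radius: "(p \<longlongrightarrow> p0) F \<Longrightarrow> ((\<lambda>k. orb_radius (p k)) \<longlongrightarrow> orb_radius p0) F"
  unfolding orb_radius_def by (intro tendsto_intros tendsto_fst tendsto_snd)

text \<open>Boundedness by an unspecified constant does not pass to limits, but the explicit bound
  \<open>2 * orb_radius\<close> does: it is continuous in the parameter, and each single iterate
  depends continuously on parameter and point.\<close>

lemma KC_limit:
  assumes p: "(p \<longlongrightarrow> p0) F" and a0: "fst p0 \<noteq> 0" and z: "(z \<longlongrightarrow> z0) F"
    and K: "\<forall>\<^sub>F k in F. z k \<in> KC (p k)" and F: "F \<noteq> bot"
  shows "z0 \<in> KC p0"
proof -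
  have "norm (orb p0 z0 n) \<le> 2 * orb_radius p0" for n
  proof (rule tendsto_le[OF F])
    show "((\<lambda>k. 2 * orb_radius (p k)) \<longlongrightarrow> 2 * orb_radius p0) F"
      by (intro tendsto_intros tendsto_orb_radius p)
    show "((\<lambda>k. norm (orb (p k) (z k) n)) \<longlongrightarrow> norm (orb p0 z0 n)) F"
      by (intro tendsto_norm tendsto_orb p z a0 eventually_fst_nz[OF p a0])
    show "\<forall>\<^sub>F k in F. norm (orb (p k) (z k) n) \<le> 2 * orb_radius (p k)"
      using K eventually_fst_nz[OF p a0] by eventually_elim (rule orb_bound)
  qed
  then show ?thesis by (auto simp: KC_iff bounded_iff)
qed

lemma compact_KC:
  assumes "fst p \<noteq> 0"
  shows "compact (KC p)"
proof -
  have "closed (KC p)"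
    unfolding closed_sequential_limits
    using KC_limit[OF tendsto_const assms, where F = sequentially] by fastforce
  moreover have "bounded (KC p)" using KC_bound[OF assms] unfolding bounded_iff by blast
  ultimately show ?thesis by (simp add: compact_eq_bounded_closed)
qed

lemma KC_subsequence:
  fixes p z :: "nat \<Rightarrow> complex \<times> complex"
  assumes p: "p \<longlonglongrightarrow> p0" and a0: "fst p0 \<noteq> 0" and K: "\<And>k. z k \<in> KC (p k)"
  obtains r z0 where "strict_mono r" "(z \<circ> r) \<longlonglongrightarrow> z0" "z0 \<in> KC p0" "(p \<circ> r) \<longlonglongrightarrow> p0"
proof -
  obtain N where N: "\<And>k. k \<ge> N \<Longrightarrow> fst (p k) \<noteq> 0"
    using eventually_fst_nz[OF p a0] by (auto simp: eventually_sequentially)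
  have "Bseq (\<lambda>k. orb_radius (p k))"
    using tendsto_orb_radius[OF p] by (intro convergent_imp_Bseq) (auto simp: convergent_def)
  then obtain B where B: "\<And>k. norm (orb_radius (p k)) \<le> B" by (auto simp: Bseq_def)
  have "z (k + N) \<in> cball 0 (2 * B)" for k
    using KC_bound[OF N K, of "k + N"] B[of "k + N"] by simp
  then have "\<exists>l\<in>cball 0 (2 * B). \<exists>r. strict_mono r \<and> ((\<lambda>k. z (k + N)) \<circ> r) \<longlonglongrightarrow> l"
    by (intro compact_cball[unfolded compact_def, rule_format])
  then obtain l r where r: "strict_mono r" "((\<lambda>k. z (k + N)) \<circ> r) \<longlonglongrightarrow> l" by blast
  let ?r = "\<lambda>k. r k + N"
  have mono: "strict_mono ?r" using r(1) by (simp add: strict_mono_def)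
  have pr: "(p \<circ> ?r) \<longlonglongrightarrow> p0" by (rule LIMSEQ_subseq_LIMSEQ[OF p mono])
  have zr: "(z \<circ> ?r) \<longlonglongrightarrow> l" using r(2) by (simp add: o_def)
  have "l \<in> KC p0" by (rule KC_limit[OF pr a0 zr]) (use K in auto)
  with mono zr pr that show thesis by blast
qed

text \<open>A closed-graph criterion with moving compact targets \<open>KC (q x)\<close>. Values
  staying away from \<open>g x\<close> would have a convergent subsequence by
  \<open>KC_subsequence\<close>, and \<open>lim\<close> identifies its limit as
  \<open>g x\<close>.\<close>

lemma continuous_on_via_KC:
  fixes g :: "'x::metric_space \<Rightarrow> complex \<times> complex" and q :: "'x \<Rightarrow> complex \<times> complex"
  assumes q: "continuous_on X q" and a: "\<And>x. x \<in> X \<Longrightarrow> fst (q x) \<noteq> 0"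
    and K: "\<And>x. x \<in> X \<Longrightarrow> g x \<in> KC (q x)"
    and lim: "\<And>\<xi> x l. (\<And>k. \<xi> k \<in> X) \<Longrightarrow> x \<in> X \<Longrightarrow> \<xi> \<longlonglongrightarrow> x \<Longrightarrow> (\<lambda>k. g (\<xi> k)) \<longlonglongrightarrow> l \<Longrightarrow> l = g x"
  shows "continuous_on X g"
  unfolding continuous_on_sequentially
proof (intro allI ballI impI)
  fix \<xi> x assume x: "x \<in> X" and \<xi>: "(\<forall>k. \<xi> k \<in> X) \<and> \<xi> \<longlonglongrightarrow> x"
  show "(g \<circ> \<xi>) \<longlonglongrightarrow> g x"
  proof (rule ccontr)
    assume "\<not> (g \<circ> \<xi>) \<longlonglongrightarrow> g x"
    then obtain e where e: "e > 0" "\<not> (\<forall>\<^sub>F k in sequentially. dist ((g \<circ> \<xi>) k) (g x) < e)"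
      by (auto simp: tendsto_iff)
    then have "\<exists>\<^sub>F k in sequentially. dist (g (\<xi> k)) (g x) \<ge> e"
      by (simp add: frequently_def not_le)
    then have "infinite {k. dist (g (\<xi> k)) (g x) \<ge> e}"
      by (simp add: frequently_cofinite[symmetric] cofinite_eq_sequentially)
    from infinite_enumerate[OF this]
    obtain s :: "nat \<Rightarrow> nat" where s: "strict_mono s" "\<And>k. dist (g (\<xi> (s k))) (g x) \<ge> e" by auto
    have \<xi>s: "(\<xi> \<circ> s) \<longlonglongrightarrow> x" by (rule LIMSEQ_subseq_LIMSEQ) (use \<xi> s in auto)
    have "(\<lambda>k. q ((\<xi> \<circ> s) k)) \<longlonglongrightarrow> q x"
      using q \<xi> \<xi>s x unfolding continuous_on_sequentially by (auto simp: o_def)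
    moreover have "g ((\<xi> \<circ> s) k) \<in> KC (q ((\<xi> \<circ> s) k))" for k using K \<xi> by simp
    ultimately obtain r l where r: "strict_mono r" "((\<lambda>k. g ((\<xi> \<circ> s) k)) \<circ> r) \<longlonglongrightarrow> l"
      by (rule KC_subsequence[OF _ a[OF x]])
    have "l = g x"
    proof (rule lim[of "\<xi> \<circ> s \<circ> r"])
      show "(\<xi> \<circ> s \<circ> r) \<longlonglongrightarrow> x" by (rule LIMSEQ_subseq_LIMSEQ[OF \<xi>s r(1)])
    qed (use \<xi> x r(2) in \<open>auto simp: o_def\<close>)
    with r(2) have "(\<lambda>k. dist (g (\<xi> (s (r k)))) (g x)) \<longlonglongrightarrow> 0"
      by (auto simp: o_def intro: tendsto_dist_iff[THEN iffD1])
    then have "e \<le> 0" by (rule LIMSEQ_le_const) (use s(2) in auto)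
    with e(1) show False by simp
  qed
qed

text \<open>Pure compactness: a sequence of counterexamples has a limit in \<open>KC p0\<close>, and
  the finitely many iterates in the window converge together. The argument covers finite windows
  only; \<open>orbit_shadowing\<close> joins them.\<close>

lemma KC_upper_semicontinuous:
  assumes a0: "fst p0 \<noteq> 0" and e: "e > 0"
  shows "\<exists>\<rho>>0. \<forall>p\<in>ball p0 \<rho>. \<forall>z\<in>KC p. \<exists>y\<in>KC p0. \<forall>i. \<bar>i\<bar> \<le> N \<longrightarrow> dist (orb p z i) (orb p0 y i) < e"
proof (rule ccontr)
  assume "\<not> ?thesis"
  then have "\<exists>p z. p \<in> ball p0 (1 / real (Suc k)) \<and> z \<in> KC p \<and>
      (\<forall>y\<in>KC p0. \<exists>i. \<bar>i\<bar> \<le> N \<and> dist (orb p z i) (orb p0 y i) \<ge> e)" for k :: nat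
    by (smt (verit) not_le divide_pos_pos of_nat_0_less_iff zero_less_Suc)
  then obtain p z where p: "\<And>k. p k \<in> ball p0 (1 / real (Suc k))" and z: "\<And>k. z k \<in> KC (p k)"
    and far: "\<And>k y. y \<in> KC p0 \<Longrightarrow> \<exists>i. \<bar>i\<bar> \<le> N \<and> dist (orb (p k) (z k) i) (orb p0 y i) \<ge> e" by metis
  have "p \<longlonglongrightarrow> p0"
  proof (rule metric_tendsto_imp_tendsto[OF LIMSEQ_inverse_real_of_nat], intro always_eventually allI)
    show "dist (p k) p0 \<le> dist (inverse (real (Suc k))) 0" for k
      using p[of k] by (simp add: dist_commute inverse_eq_divide)
  qed
  from KC_subsequence[OF this a0 z]
  obtain r y where r: "(z \<circ> r) \<longlonglongrightarrow> y" "y \<in> KC p0" "(p \<circ> r) \<longlonglongrightarrow> p0" by metis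
  have "\<forall>\<^sub>F k in sequentially. \<forall>i\<in>{-N..N}. dist (orb ((p \<circ> r) k) ((z \<circ> r) k) i) (orb p0 y i) < e"
  proof (rule eventually_ball_finite, simp, rule ballI)
    fix i
    show "\<forall>\<^sub>F k in sequentially. dist (orb ((p \<circ> r) k) ((z \<circ> r) k) i) (orb p0 y i) < e"
      using tendsto_orb[OF r(3,1) a0 eventually_fst_nz[OF r(3) a0], of i] e by (rule tendstoD)
  qed
  then obtain k where k: "\<forall>i\<in>{-N..N}. dist (orb (p (r k)) (z (r k)) i) (orb p0 y i) < e"
    by (auto simp: eventually_sequentially)
  obtain i where "\<bar>i\<bar> \<le> N" "dist (orb (p (r k)) (z (r k)) i) (orb p0 y i) \<ge> e"
    using far[OF r(2)] by blast
  with k show False by (metis abs_le_iff atLeastAtMost_iff minus_le_iff not_le)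
qed

section \<open>Hyperbolic splittings give dichotomies\<close>

lemma has_derivative_henon: "(henon p has_derivative henon_deriv p z) (at z)"
proof -
  have eq: "henon p = (\<lambda>z. ((fst z)\<^sup>2 + snd p - fst p * snd z, fst z))"
    by (simp add: henon_eq fun_eq_iff)
  show ?thesis unfolding eq
    by (auto intro!: derivative_eq_intros simp: henon_deriv_def fun_eq_iff)
qed

definition henon_inv_deriv :: "complex \<times> complex \<Rightarrow> complex \<times> complex \<Rightarrow> complex \<times> complex \<Rightarrow> complex \<times> complex" where
  "henon_inv_deriv p z v = (snd v, (2 * snd z * snd v - fst v) / fst p)"

lemma has_derivative_henon_inv:
  assumes "fst p \<noteq> 0"
  shows "(henon_inv p has_derivative henon_inv_deriv p z) (at z)"
proof -
  have eq: "henon_inv p = (\<lambda>z. (snd z, ((snd z)\<^sup>2 + snd p - fst z) / fst p))"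
    by (simp add: henon_inv_def fun_eq_iff)
  show ?thesis unfolding eq
    by (auto intro!: derivative_eq_intros simp: henon_inv_deriv_def fun_eq_iff assms)
qed

lemma henon_deriv_inverse:
  assumes "fst p \<noteq> 0"
  shows "henon_deriv p z (henon_inv_deriv p (henon p z) v) = v"
    and "henon_inv_deriv p (henon p z) (henon_deriv p z v) = v"
  using assms by (auto simp: henon_deriv_def henon_inv_deriv_def henon_eq prod_eq_iff)

lemma linear_henon_deriv: "linear (henon_deriv p z)"
  by (rule linearI) (simp_all add: henon_deriv_def algebra_simps)

lemma linear_henon_inv_deriv: "linear (henon_inv_deriv p z)"
  by (rule linearI) (simp_all add: henon_inv_deriv_def algebra_simps add_divide_distrib diff_divide_distrib scaleR_conv_of_real)

lemma frechet_derivative_iterate: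
  fixes f :: "'a::real_normed_vector \<Rightarrow> 'a"
  assumes "\<And>z. (f has_derivative D z) (at z)"
  shows "(f ^^ n) differentiable (at z)"
    and "frechet_derivative (f ^^ Suc n) (at z) v = D ((f ^^ n) z) (frechet_derivative (f ^^ n) (at z) v)"
proof -
  have *: "((f ^^ Suc n) has_derivative D ((f ^^ n) z) \<circ> frechet_derivative (f ^^ n) (at z)) (at z)"
    if "(f ^^ n) differentiable (at z)" for n
    unfolding funpow.simps using that frechet_derivative_works assms by (blast intro: diff_chain_at)
  show d: "(f ^^ n) differentiable (at z)" for n
  proof (induction n)
    case 0 show ?case by simp
  next
    case (Suc n) then show ?case using * differentiable_def by blast
  qed
  show "frechet_derivative (f ^^ Suc n) (at z) v = D ((f ^^ n) z) (frechet_derivative (f ^^ n) (at z) v)"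
    using frechet_derivative_at[OF *[OF d]] by (metis comp_apply)
qed

text \<open>The derivative of the n-th iterate for integer n. It is written with
  \<open>frechet_derivative\<close> and \<open>inv\<close> as in
  \<open>uniformly_hyperbolic\<close>, so that the estimates there are literally estimates of
  \<open>cocycle\<close>; the product formula is \<open>cocycle_step\<close>.\<close>

definition cocycle :: "complex \<times> complex \<Rightarrow> complex \<times> complex \<Rightarrow> int \<Rightarrow> complex \<times> complex \<Rightarrow> complex \<times> complex" where
  "cocycle p z n v = (if n \<ge> 0 then frechet_derivative (henon p ^^ nat n) (at z) v
     else frechet_derivative (inv (henon p) ^^ nat (- n)) (at z) v)"

lemma cocycle_0 [simp]: "cocycle p z 0 v = v"
  by (simp add: cocycle_def id_def)

lemma cocycle_nat: "cocycle p z (int n) v = frechet_derivative (henon p ^^ n) (at z) v"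
  by (simp add: cocycle_def)

lemma cocycle_neg: "cocycle p z (- int n) v = frechet_derivative (inv (henon p) ^^ n) (at z) v"
  by (cases "n = 0") (auto simp: cocycle_def id_def)

lemma cocycle_step:
  assumes a: "fst p \<noteq> 0"
  shows "cocycle p z (n + 1) v = henon_deriv p (orb p z n) (cocycle p z n v)"
proof (cases "n \<ge> 0")
  case True
  then obtain k where k: "n = int k" by (metis zero_le_imp_eq_int)
  then have "n + 1 = int (Suc k)" by simp
  then show ?thesis
    unfolding k by (simp only: cocycle_nat orb_nat frechet_derivative_iterate(2)[OF has_derivative_henon])
next
  case False
  then obtain k where k: "n = - int (Suc k)"
    by (metis linorder_not_le not_less_eq_eq negD uminus_add_conv_diff zless_iff_Suc_zadd)
  then have k': "n + 1 = - int k" by simp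
  have "orb p z (- int k) = henon p (orb p z n)" using orb_step[OF a, of z n] k' by simp
  then have "cocycle p z n v = henon_inv_deriv p (henon p (orb p z n)) (cocycle p z (n + 1) v)"
    unfolding k' unfolding k cocycle_neg inv_henon[OF a]
    by (simp only: frechet_derivative_iterate(2)[OF has_derivative_henon_inv[OF a]] orb_neg[OF a])
  then show ?thesis by (simp add: henon_deriv_inverse[OF a])
qed

lemma cocycle_back:
  assumes a: "fst p \<noteq> 0"
  shows "cocycle p z (n - 1) v = henon_inv_deriv p (orb p z n) (cocycle p z n v)"
  using cocycle_step[OF a, of z "n - 1" v] orb_step[OF a, of z "n - 1"] by (simp add: henon_deriv_inverse[OF a])

lemma cocycle_unique:
  assumes a: "fst p \<noteq> 0" and V: "\<And>n. V (n + 1) = henon_deriv p (orb p z n) (V n)"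
  shows "V n = cocycle p z n (V 0)"
proof (induction n rule: int_induct[where k = 0])
  case base show ?case by simp
next
  case (step1 i) then show ?case by (simp add: V cocycle_step[OF a])
next
  case (step2 i)
  have "V (i - 1) = henon_inv_deriv p (orb p z i) (V i)"
    using V[of "i - 1"] orb_step[OF a, of z "i - 1"] by (simp add: henon_deriv_inverse[OF a])
  with step2 show ?case by (simp add: cocycle_back[OF a])
qed

lemma cocycle_add:
  assumes a: "fst p \<noteq> 0"
  shows "cocycle p (orb p z m) n (cocycle p z m v) = cocycle p z (m + n) v"
  using cocycle_unique[OF a, of "\<lambda>n. cocycle p z (m + n) v" "orb p z m" n] cocycle_step[OF a, of z "m + _" v]
  by (simp add: add.assoc[symmetric] orb_add[OF a])

lemma cocycle_cancel:
  assumes "fst p \<noteq> 0"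
  shows "cocycle p (orb p z n) (- n) (cocycle p z n v) = v"
  by (simp add: cocycle_add[OF assms])

lemma linear_cocycle:
  assumes a: "fst p \<noteq> 0"
  shows "linear (cocycle p z n)"
proof (induction n rule: int_induct[where k = 0])
  case base show ?case by (rule linearI) simp_all
next
  case (step1 i)
  then show ?case using linear_compose[OF step1(2) linear_henon_deriv]
    by (simp add: cocycle_step[OF a] o_def)
next
  case (step2 i)
  then show ?case using linear_compose[OF step2(2) linear_henon_inv_deriv]
    by (simp add: cocycle_back[OF a] o_def)
qed

lemma tendsto_cocycle:
  assumes a: "fst p \<noteq> 0" and z: "(z \<longlongrightarrow> z0) F" and v: "(v \<longlongrightarrow> v0) F"
  shows "((\<lambda>k. cocycle p (z k) n (v k)) \<longlongrightarrow> cocycle p z0 n v0) F"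
proof -
  have o: "((\<lambda>k. orb p (z k) n) \<longlongrightarrow> orb p z0 n) F" for n
    by (rule tendsto_orb[OF tendsto_const z a]) (simp add: a)
  show ?thesis
  proof (induction n rule: int_induct[where k = 0])
    case base show ?case using v by simp
  next
    case (step1 i)
    show ?case unfolding cocycle_step[OF a] henon_deriv_def
      by (intro tendsto_intros tendsto_fst[OF o] tendsto_fst[OF step1(2)] tendsto_snd[OF step1(2)])
  next
    case (step2 i)
    show ?case unfolding cocycle_back[OF a] henon_inv_deriv_def
      by (intro tendsto_intros tendsto_snd[OF o] tendsto_fst[OF step2(2)] tendsto_snd[OF step2(2)] a)
  qed
qed

definition deriv_bound :: "complex \<times> complex \<Rightarrow> real" where
  "deriv_bound p = 2 * orb_radius p + norm (fst p) + 1"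

lemma deriv_bound_ge_1: "deriv_bound p \<ge> 1"
  by (simp add: deriv_bound_def orb_radius_def)

lemma henon_deriv_bound:
  assumes "fst p \<noteq> 0" "z \<in> KC p"
  shows "norm (henon_deriv p (orb p z n) v) \<le> deriv_bound p * norm v"
proof -
  have f: "norm (fst v) \<le> norm v" and s: "norm (snd v) \<le> norm v"
    by (metis norm_fst_le prod.collapse, metis norm_snd_le prod.collapse)
  have "norm (henon_deriv p (orb p z n) v)
      \<le> norm (2 * fst (orb p z n) * fst v - fst p * snd v) + norm (fst v)"
    unfolding henon_deriv_def by (rule norm_Pair_le)
  also have "\<dots> \<le> (2 * norm (fst (orb p z n)) * norm (fst v) + norm (fst p) * norm (snd v)) + norm (fst v)"
    using norm_triangle_ineq4[of "2 * fst (orb p z n) * fst v" "fst p * snd v"] by (simp add: norm_mult)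
  also have "\<dots> \<le> (2 * orb_radius p * norm v + norm (fst p) * norm v) + norm v"
    by (intro add_mono mult_mono order_refl f s orb_fst_bound[OF assms]) (auto simp: orb_radius_def)
  finally show ?thesis by (simp add: deriv_bound_def algebra_simps)
qed

lemma cocycle_bound:
  assumes a: "fst p \<noteq> 0" and z: "z \<in> KC p"
  shows "norm (cocycle p z (int n) v) \<le> deriv_bound p ^ n * norm v"
proof (induction n)
  case 0 show ?case by simp
next
  case (Suc n)
  have "cocycle p z (int (Suc n)) v = henon_deriv p (orb p z (int n)) (cocycle p z (int n) v)"
    using cocycle_step[OF a, of z "int n" v] by (simp add: add.commute)
  then have "norm (cocycle p z (int (Suc n)) v) \<le> deriv_bound p * norm (cocycle p z (int n) v)"
    using henon_deriv_bound[OF a z] by simp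
  also have "\<dots> \<le> deriv_bound p * (deriv_bound p ^ n * norm v)"
    using deriv_bound_ge_1[of p] by (intro mult_left_mono Suc) simp
  finally show ?case by (simp add: mult.assoc)
qed

text \<open>One \<open>M\<close> serves all bounded orbits, the counterpart of uniformity in
  hyperbolicity. Positivity is demanded separately because the second clause is vacuous when
  \<open>KC p\<close> is empty.\<close>

definition dichotomous :: "real \<Rightarrow> complex \<times> complex \<Rightarrow> bool" where
  "dichotomous M p \<longleftrightarrow> M > 0 \<and> (\<forall>z\<in>KC p. dichotomy M (\<lambda>n. henon_deriv p (orb p z n)))"

section \<open>Green's function of a hyperbolic splitting\<close>

locale splitting =
  fixes p :: "complex \<times> complex" and Es Eu :: "complex \<times> complex \<Rightarrow> (complex \<times> complex) set"
    and C \<theta> :: real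
  assumes a: "fst p \<noteq> 0"
    and decomp: "\<And>z v. z \<in> KC p \<Longrightarrow> \<exists>u\<in>Es z. v - u \<in> Eu z"
    and inv_s: "\<And>z v n. z \<in> KC p \<Longrightarrow> v \<in> Es z \<Longrightarrow> cocycle p z n v \<in> Es (orb p z n)"
    and inv_u: "\<And>z v n. z \<in> KC p \<Longrightarrow> v \<in> Eu z \<Longrightarrow> cocycle p z n v \<in> Eu (orb p z n)"
    and C: "C > 0" and \<theta>: "0 < \<theta>" "\<theta> < 1"
    and decay_s: "\<And>z v n. z \<in> KC p \<Longrightarrow> v \<in> Es z \<Longrightarrow> norm (cocycle p z (int n) v) \<le> C * \<theta> ^ n * norm v"
    and decay_u: "\<And>z v n. z \<in> KC p \<Longrightarrow> v \<in> Eu z \<Longrightarrow> norm (cocycle p z (- int n) v) \<le> C * \<theta> ^ n * norm v"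
begin

text \<open>Uniform transversality from the dynamics: after \<open>N\<close> steps a stable vector
  is at most half as long and an unstable one at least twice as long, while no vector grows by more
  than \<open>deriv_bound p ^ N\<close>. Nearly cancelling \<open>u\<close> and \<open>w\<close>
  would be torn apart faster than the derivative allows.\<close>

lemma angle:
  obtains Q where "Q > 0"
    "\<And>z u w. z \<in> KC p \<Longrightarrow> u \<in> Es z \<Longrightarrow> w \<in> Eu z \<Longrightarrow> norm u \<le> Q * norm (u + w) \<and> norm w \<le> Q * norm (u + w)"
proof -
  have "(\<lambda>n. C * \<theta> ^ n) \<longlonglongrightarrow> C * 0"
    by (intro tendsto_intros LIMSEQ_realpow_zero) (use \<theta> in auto)
  then have "\<forall>\<^sub>F n in sequentially. C * \<theta> ^ n < 1/2"
    by (rule order_tendstoD) simp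
  then obtain N where N: "C * \<theta> ^ N < 1/2" by (auto simp: eventually_sequentially)
  define Q where "Q = 3 + deriv_bound p ^ N"
  have Q: "Q > 0" using deriv_bound_ge_1[of p] by (simp add: Q_def add_pos_nonneg)
  have "norm u \<le> Q * norm (u + w) \<and> norm w \<le> Q * norm (u + w)"
    if z: "z \<in> KC p" and u: "u \<in> Es z" and w: "w \<in> Eu z" for z u w
  proof -
    let ?T = "cocycle p z (int N)"
    have "norm (?T u) \<le> C * \<theta> ^ N * norm u" by (rule decay_s[OF z u])
    also have "\<dots> \<le> 1/2 * norm u" using N by (intro mult_right_mono) auto
    finally have 1: "norm (?T u) \<le> norm u / 2" by simp
    have "norm w = norm (cocycle p (orb p z (int N)) (- int N) (?T w))"
      by (simp add: cocycle_cancel[OF a])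
    also have "\<dots> \<le> C * \<theta> ^ N * norm (?T w)"
      by (rule decay_u[OF orb_in_KC[OF a z] inv_u[OF z w]])
    also have "\<dots> \<le> 1/2 * norm (?T w)" using N by (intro mult_right_mono) auto
    finally have 2: "2 * norm w \<le> norm (?T w)" by simp
    have "?T w = ?T (u + w) - ?T u" by (simp add: linear_add[OF linear_cocycle[OF a]])
    then have 3: "norm (?T w) \<le> norm (?T (u + w)) + norm (?T u)" by (metis norm_triangle_ineq4)
    have 4: "norm (?T (u + w)) \<le> deriv_bound p ^ N * norm (u + w)" by (rule cocycle_bound[OF a z])
    have 5: "norm u \<le> norm (u + w) + norm w"
      using norm_triangle_ineq4[of "u + w" w] by simp
    have 6: "norm w \<le> norm (u + w) + norm u"
      using norm_triangle_ineq4[of "u + w" u] by simp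
    have "Q * norm (u + w) = 3 * norm (u + w) + deriv_bound p ^ N * norm (u + w)"
      by (simp add: Q_def algebra_simps)
    then show ?thesis using 1 2 3 4 5 6 norm_ge_zero[of "u + w"] norm_ge_zero[of u] norm_ge_zero[of w]
      by (intro conjI; linarith)
  qed
  with Q that show thesis by blast
qed

text \<open>The unstable component of a bounded solution is bounded in forward time, being the
  solution minus a decaying stable part. Pulling it back from time \<open>n\<close> contracts it by
  \<open>C * \<theta> ^ n\<close>, so it vanishes; reversing time removes the stable
  component.\<close>

lemma no_bounded_solution:
  assumes z: "z \<in> KC p" and B: "\<And>n. norm (V n) \<le> B" and V: "\<And>n. V (n + 1) = henon_deriv p (orb p z n) (V n)"
  shows "V n = 0"
proof -
  have Vc: "V n = cocycle p z n (V 0)" for n by (rule cocycle_unique[OF a V])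
  obtain u where u: "u \<in> Es z" and w: "V 0 - u \<in> Eu z" using decomp[OF z] by blast
  define w where "w = V 0 - u"
  have wE: "w \<in> Eu z" using w by (simp add: w_def)
  have split: "V n = cocycle p z n u + cocycle p z n w" for n
    using Vc[of n] linear_add[OF linear_cocycle[OF a], of z n u w] by (simp add: w_def)
  have zero: "norm x \<le> 0" if "\<And>n. norm x \<le> C * \<theta> ^ n * b" for x :: "complex \<times> complex" and b
  proof (rule LIMSEQ_le_const)
    show "(\<lambda>n. C * \<theta> ^ n * b) \<longlonglongrightarrow> 0"
      using tendsto_mult[OF tendsto_mult[OF tendsto_const LIMSEQ_realpow_zero[of \<theta>]] tendsto_const, of C b] \<theta>
      by simp
  qed (use that in auto)
  have pw: "C * \<theta> ^ n * x \<le> C * x" if "x \<ge> 0" for n x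
    using that C \<theta> by (intro mult_right_mono) (auto simp: power_le_one mult_le_cancel_left1)
  have "norm w \<le> C * \<theta> ^ n * (B + C * norm u)" for n
  proof -
    have "norm w = norm (cocycle p (orb p z (int n)) (- int n) (cocycle p z (int n) w))"
      by (simp add: cocycle_cancel[OF a])
    also have "\<dots> \<le> C * \<theta> ^ n * norm (cocycle p z (int n) w)"
      by (rule decay_u[OF orb_in_KC[OF a z] inv_u[OF z wE]])
    also have "norm (cocycle p z (int n) w) \<le> B + C * norm u"
    proof -
      have "cocycle p z (int n) w = V (int n) - cocycle p z (int n) u" by (simp add: split)
      then have "norm (cocycle p z (int n) w) \<le> norm (V (int n)) + norm (cocycle p z (int n) u)"
        by (metis norm_triangle_ineq4)
      then show ?thesis using B[of "int n"] decay_s[OF z u, of n] pw[of "norm u" n] by simp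
    qed
    finally show ?thesis using C \<theta> by (simp add: mult_left_mono)
  qed
  then have w0: "w = 0" using zero by fastforce
  have "norm u \<le> C * \<theta> ^ n * (B + C * norm w)" for n
  proof -
    have "norm u = norm (cocycle p (orb p z (- int n)) (int n) (cocycle p z (- int n) u))"
      by (simp add: cocycle_add[OF a])
    also have "\<dots> \<le> C * \<theta> ^ n * norm (cocycle p z (- int n) u)"
      by (rule decay_s[OF orb_in_KC[OF a z] inv_s[OF z u]])
    also have "norm (cocycle p z (- int n) u) \<le> B + C * norm w"
    proof -
      have "cocycle p z (- int n) u = V (- int n) - cocycle p z (- int n) w" by (simp add: split)
      then have "norm (cocycle p z (- int n) u) \<le> norm (V (- int n)) + norm (cocycle p z (- int n) w)"
        by (metis norm_triangle_ineq4)
      then show ?thesis using B[of "- int n"] decay_u[OF z wE, of n] pw[of "norm w" n] by simp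
    qed
    finally show ?thesis using C \<theta> by (simp add: mult_left_mono)
  qed
  then have u0: "u = 0" using zero by fastforce
  show ?thesis using split[of n] u0 w0 linear_0[OF linear_cocycle[OF a]] by simp
qed

text \<open>The bounded solution is given by Green's function: stable parts are summed over the past and
  unstable parts over the future.\<close>

lemma bounded_solution:
  fixes W :: "int \<Rightarrow> complex \<times> complex"
  assumes z: "z \<in> KC p" and W: "\<And>n. norm (W n) \<le> r"
    and Q: "Q > 0" "\<And>z u w. z \<in> KC p \<Longrightarrow> u \<in> Es z \<Longrightarrow> w \<in> Eu z \<Longrightarrow>
      norm u \<le> Q * norm (u + w) \<and> norm w \<le> Q * norm (u + w)"
  shows "\<exists>V. (\<forall>n. norm (V n) \<le> 2 * C * Q / (1 - \<theta>) * r) \<and>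
    (\<forall>n. V (n + 1) = henon_deriv p (orb p z n) (V n) + W n)"
proof -
  define s where "s n = (SOME u. u \<in> Es (orb p z (n + 1)) \<and> W n - u \<in> Eu (orb p z (n + 1)))" for n
  have s: "s n \<in> Es (orb p z (n + 1))" "W n - s n \<in> Eu (orb p z (n + 1))" for n
    using someI_ex[OF decomp[OF orb_in_KC[OF a z, of "n + 1"], of "W n", unfolded Bex_def]]
    unfolding s_def by blast+
  define u where "u n = W n - s n" for n
  have u: "u n \<in> Eu (orb p z (n + 1))" for n using s by (simp add: u_def)
  have r0: "r \<ge> 0" using W norm_ge_zero order_trans by blast
  have sr: "norm (s n) \<le> Q * r" and ur: "norm (u n) \<le> Q * r" for n
    using Q(2)[OF orb_in_KC[OF a z, of "n + 1"] s(1)[of n] u[of n]] mult_left_mono[OF W[of n] less_imp_le[OF Q(1)]]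
    by (auto simp: u_def)
  \<comment> \<open>\<open>W n\<close> takes effect at time \<open>n + 1\<close>. At time
    \<open>n\<close>, the impulse of index \<open>n - j - 1\<close> has therefore been carried
    forward \<open>j\<close> steps, and the impulse of index \<open>n + j\<close> is carried back
    \<open>j + 1\<close> steps.\<close>
  define f where "f n j = cocycle p (orb p z (n - int j)) (int j) (s (n - int j - 1))" for n and j :: nat
  define g where "g n j = cocycle p (orb p z (n + int j + 1)) (- int (Suc j)) (u (n + int j))" for n and j :: nat
  have fb: "norm (f n j) \<le> C * Q * r * \<theta> ^ j" for n j
  proof -
    have "norm (f n j) \<le> C * \<theta> ^ j * norm (s (n - int j - 1))"
      unfolding f_def by (rule decay_s[OF orb_in_KC[OF a z]]) (use s(1)[of "n - int j - 1"] in simp)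
    also have "\<dots> \<le> C * \<theta> ^ j * (Q * r)" using C \<theta> by (intro mult_left_mono sr) auto
    finally show ?thesis by (simp add: mult_ac)
  qed
  have gb: "norm (g n j) \<le> C * Q * r * \<theta> ^ j" for n j
  proof -
    have "norm (g n j) \<le> C * \<theta> ^ Suc j * norm (u (n + int j))"
      unfolding g_def by (rule decay_u[OF orb_in_KC[OF a z] u])
    also have "\<dots> \<le> C * \<theta> ^ Suc j * (Q * r)" using C \<theta> by (intro mult_left_mono ur) auto
    also have "\<dots> \<le> C * \<theta> ^ j * (Q * r)" using C \<theta> Q r0
      by (intro mult_right_mono mult_left_mono) (auto simp: mult_left_le_one_le)
    finally show ?thesis by (simp add: mult_ac)
  qed
  have geo: "summable (\<lambda>j. C * Q * r * \<theta> ^ j)" "(\<Sum>j. C * Q * r * \<theta> ^ j) = C * Q * r / (1 - \<theta>)"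
    using \<theta> by (auto simp: summable_mult suminf_mult suminf_geometric)
  have sumf: "summable (f n)" and sumg: "summable (g n)" for n
    by (rule summable_comparison_test'[OF geo(1)], rule fb)
       (rule summable_comparison_test'[OF geo(1)], rule gb)
  have nf: "norm (suminf (f n)) \<le> C * Q * r / (1 - \<theta>)" and ng: "norm (suminf (g n)) \<le> C * Q * r / (1 - \<theta>)" for n
    using norm_suminf_le[OF fb geo(1)] norm_suminf_le[OF gb geo(1)] geo(2) by auto
  have bl: "bounded_linear (henon_deriv p w)" for w
    by (simp add: linear_henon_deriv linear_conv_bounded_linear[symmetric])
  have Af: "henon_deriv p (orb p z n) (suminf (f n)) = suminf (f (n + 1)) - s n" for n
  proof -
    have "henon_deriv p (orb p z n) (suminf (f n)) = (\<Sum>j. henon_deriv p (orb p z n) (f n j))"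
      by (rule bounded_linear.suminf[OF bl sumf])
    also have "\<dots> = (\<Sum>j. f (n + 1) (Suc j))"
      using cocycle_step[OF a, of "orb p z (n - int _)" "int _"]
      by (simp add: f_def orb_add[OF a] add.commute)
    also have "\<dots> = suminf (f (n + 1)) - f (n + 1) 0" by (rule suminf_split_head[OF sumf])
    finally show ?thesis by (simp add: f_def)
  qed
  have Ag0: "henon_deriv p (orb p z n) (g n j) = cocycle p (orb p z (n + int j + 1)) (- int j) (u (n + int j))" for n j
    using cocycle_step[OF a, of "orb p z (n + int j + 1)" "- int (Suc j)" "u (n + int j)"]
    by (simp add: g_def orb_add[OF a] algebra_simps)
  have Ag: "henon_deriv p (orb p z n) (suminf (g n)) = suminf (g (n + 1)) + u n" for n
  proof -
    have "henon_deriv p (orb p z n) (suminf (g n)) = (\<Sum>j. henon_deriv p (orb p z n) (g n j))"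
      by (rule bounded_linear.suminf[OF bl sumg])
    also have "\<dots> = (\<Sum>j. henon_deriv p (orb p z n) (g n (Suc j))) + henon_deriv p (orb p z n) (g n 0)"
      using suminf_split_head[OF bounded_linear.summable[OF bl sumg], of "orb p z n" n] by simp
    also have "henon_deriv p (orb p z n) (g n 0) = u n" by (simp only: Ag0) simp
    also have "(\<lambda>j. henon_deriv p (orb p z n) (g n (Suc j))) = g (n + 1)"
      unfolding Ag0 by (auto simp: g_def fun_eq_iff algebra_simps)
    finally show ?thesis .
  qed
  \<comment> \<open>The future sum enters with a minus sign: by \<open>Af\<close> and
    \<open>Ag\<close> the two sums miss the homogeneous equation by \<open>s n\<close> and
    \<open>- u n\<close>, whose difference is \<open>W n\<close>.\<close>
  let ?V = "\<lambda>n. suminf (f n) - suminf (g n)"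
  have "norm (?V n) \<le> 2 * C * Q / (1 - \<theta>) * r" for n
  proof -
    have "norm (?V n) \<le> C * Q * r / (1 - \<theta>) + C * Q * r / (1 - \<theta>)"
      using norm_triangle_ineq4[of "suminf (f n)" "suminf (g n)"] nf[of n] ng[of n] by linarith
    then show ?thesis by simp
  qed
  moreover have "?V (n + 1) = henon_deriv p (orb p z n) (?V n) + W n" for n
    by (simp add: linear_diff[OF linear_henon_deriv] Af Ag u_def)
  ultimately show ?thesis by (intro exI[of _ ?V]) blast
qed

lemma dichotomous: "\<exists>M. dichotomous M p"
proof -
  obtain Q where Q: "Q > 0" "\<And>z u w. z \<in> KC p \<Longrightarrow> u \<in> Es z \<Longrightarrow> w \<in> Eu z \<Longrightarrow>
      norm u \<le> Q * norm (u + w) \<and> norm w \<le> Q * norm (u + w)"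
    using angle by blast
  have "dichotomy (2 * C * Q / (1 - \<theta>)) (\<lambda>n. henon_deriv p (orb p z n))" if z: "z \<in> KC p" for z
    unfolding dichotomy_def
  proof (intro conjI allI impI)
    show "0 < 2 * C * Q / (1 - \<theta>)" using C Q(1) \<theta> by simp
    show "linear (henon_deriv p (orb p z n))" for n by (rule linear_henon_deriv)
    show "\<exists>V. (\<forall>n. norm (V n) \<le> 2 * C * Q / (1 - \<theta>) * r) \<and>
        (\<forall>n. V (n + 1) = henon_deriv p (orb p z n) (V n) + W n)"
      if "\<forall>n. norm (W n) \<le> r" for W r
      by (rule bounded_solution[OF z that[rule_format] Q])
    show "V n = 0" if "(\<forall>n. norm (V n) \<le> B) \<and> (\<forall>n. V (n + 1) = henon_deriv p (orb p z n) (V n))" for V B n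
      using no_bounded_solution[OF z] that by blast
  qed
  moreover have "0 < 2 * C * Q / (1 - \<theta>)" using C Q(1) \<theta> by simp
  ultimately show ?thesis unfolding dichotomous_def by blast
qed

end

section \<open>Dichotomies give hyperbolic splittings\<close>

text \<open>Translation of \<open>uniformly_hyperbolic\<close> into the locale
  \<open>splitting\<close>: invariance is propagated to negative times by injectivity of the
  derivative, and the bounds on unit vectors extend to whole fibres by scaling.\<close>

lemma hyperbolic_imp_dichotomous:
  assumes a: "fst p \<noteq> 0" and hyp: "uniformly_hyperbolic (henon p) (KC p)"
  shows "\<exists>M. dichotomous M p"
proof -
  obtain Es Eu C \<theta> where
        dir: "\<forall>z\<in>KC p. Es z \<inter> Eu z = {0} \<and> {u + v |u v. u \<in> Es z \<and> v \<in> Eu z} = UNIV"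
    and inv: "\<forall>z\<in>KC p. frechet_derivative (henon p) (at z) ` Es z = Es (henon p z) \<and>
      frechet_derivative (henon p) (at z) ` Eu z = Eu (henon p z)"
    and dec: "\<forall>z\<in>KC p. \<forall>n.
       (\<forall>v\<in>Es z. norm v = 1 \<longrightarrow> norm (frechet_derivative (henon p ^^ n) (at z) v) < C * \<theta> ^ n) \<and>
       (\<forall>v\<in>Eu z. norm v = 1 \<longrightarrow> norm (frechet_derivative (inv (henon p) ^^ n) (at z) v) < C * \<theta> ^ n)"
    and sub: "subbundle (KC p) Es" "subbundle (KC p) Eu"
    and C: "C > 0" and \<theta>: "0 < \<theta>" "\<theta> < 1"
    using hyp[unfolded uniformly_hyperbolic_def] by (elim conjE exE) (rule that)
  \<comment> \<open>That a fibre is closed under scaling is contained in \<open>subbundle\<close>,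
    whose local frames exhibit it as a span.\<close>
  have scale: "r *\<^sub>R v \<in> E z" if E: "subbundle (KC p) E" and z: "z \<in> KC p" and v: "v \<in> E z"
    for E :: "complex \<times> complex \<Rightarrow> (complex \<times> complex) set" and r z v
  proof -
    obtain U k and e :: "nat \<Rightarrow> complex \<times> complex \<Rightarrow> complex \<times> complex"
      where "z \<in> U" "\<forall>y\<in>U \<inter> KC p. E y = span ((\<lambda>i. e i y) ` {..<k})"
      using E z unfolding subbundle_def by meson
    then show ?thesis using span_scale z v by auto
  qed
  have unit: "norm (cocycle p z m v) \<le> b * norm v"
    if E: "subbundle (KC p) E" and z: "z \<in> KC p" and v: "v \<in> E z"
      and dec: "\<And>v. v \<in> E z \<Longrightarrow> norm v = 1 \<Longrightarrow> norm (cocycle p z m v) < b" for E z m v b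
  proof (cases "v = 0")
    case True then show ?thesis by (simp add: linear_0[OF linear_cocycle[OF a]])
  next
    case False
    have "norm (cocycle p z m ((1 / norm v) *\<^sub>R v)) < b"
      by (rule dec[OF scale[OF E z v]]) (use False in simp)
    then show ?thesis using False
      by (simp add: linear_scale[OF linear_cocycle[OF a]] field_simps)
  qed
  have inj: "u = v" if "henon_deriv p z u = henon_deriv p z v" for z u v
    using that henon_deriv_inverse(2)[OF a] by metis
  have fd: "frechet_derivative (henon p) (at z) = henon_deriv p z" for z
    using frechet_derivative_at[OF has_derivative_henon] by metis
  have cinv: "cocycle p z n v \<in> E (orb p z n)"
    if inv: "\<And>z. z \<in> KC p \<Longrightarrow> frechet_derivative (henon p) (at z) ` E z = E (henon p z)"
      and z: "z \<in> KC p" and v: "v \<in> E z" for E z n v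
  proof (induction n rule: int_induct[where k = 0])
    case base show ?case using v by simp
  next
    case (step1 i)
    then show ?case using inv[OF orb_in_KC[OF a z], of i] by (auto simp: fd orb_step[OF a] cocycle_step[OF a])
  next
    case (step2 i)
    have "henon_deriv p (orb p z (i - 1)) (cocycle p z (i - 1) v) \<in> henon_deriv p (orb p z (i - 1)) ` E (orb p z (i - 1))"
      using step2 inv[OF orb_in_KC[OF a z], of "i - 1"] orb_step[OF a, of z "i - 1"] cocycle_step[OF a, of z "i - 1" v]
      by (simp add: fd)
    then show ?case using inj by blast
  qed
  interpret splitting p Es Eu C \<theta>
  proof
    show "\<exists>u\<in>Es z. v - u \<in> Eu z" if "z \<in> KC p" for z v
    proof -
      have "v \<in> {u + v |u v. u \<in> Es z \<and> v \<in> Eu z}" using dir that by simp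
      then obtain u w where "v = u + w" "u \<in> Es z" "w \<in> Eu z" by blast
      then show ?thesis by (intro bexI[of _ u]) auto
    qed
    show "cocycle p z n v \<in> Es (orb p z n)" if "z \<in> KC p" "v \<in> Es z" for z v n
      by (rule cinv[of Es, OF _ that]) (use inv in blast)
    show "cocycle p z n v \<in> Eu (orb p z n)" if "z \<in> KC p" "v \<in> Eu z" for z v n
      by (rule cinv[of Eu, OF _ that]) (use inv in blast)
    show "norm (cocycle p z (int n) v) \<le> C * \<theta> ^ n * norm v" if "z \<in> KC p" "v \<in> Es z" for z v n
      by (rule unit[OF sub(1) that]) (use dec that in \<open>simp add: cocycle_nat\<close>)
    show "norm (cocycle p z (- int n) v) \<le> C * \<theta> ^ n * norm v" if "z \<in> KC p" "v \<in> Eu z" for z v n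
      by (rule unit[OF sub(2) that]) (use dec that in \<open>simp add: cocycle_neg\<close>)
  qed (fact a C \<theta>)+
  show ?thesis by (rule dichotomous)
qed

text \<open>The map \<open>S z = P z \<circ> P x + (1 - P z) \<circ> (1 - P x)\<close> is close to the identity for \<open>z\<close> near
  \<open>x\<close> and carries \<open>range (P x)\<close> onto \<open>range (P z)\<close>.\<close>

lemma subbundle_range_projection:
  fixes P :: "'a::euclidean_space \<Rightarrow> 'a \<Rightarrow> 'a"
  assumes lin: "\<And>z. z \<in> \<Lambda> \<Longrightarrow> linear (P z)" and idem: "\<And>z v. z \<in> \<Lambda> \<Longrightarrow> P z (P z v) = P z v"
    and cont: "\<And>v. continuous_on \<Lambda> (\<lambda>z. P z v)"
  shows "subbundle \<Lambda> (\<lambda>z. range (P z))"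
  unfolding subbundle_def
proof
  fix x assume x: "x \<in> \<Lambda>"
  obtain B where B: "B \<subseteq> range (P x)" "independent B" "range (P x) \<subseteq> span B"
    using basis_exists by metis
  have spanB: "span B = range (P x)"
    using B span_minimal[OF B(1) linear_subspace_image[OF lin[OF x] subspace_UNIV]] by blast
  have "finite B" using B(2) by (rule independent_imp_finite)
  then obtain b where b: "bij_betw b {..<card B} B"
    using ex_bij_betw_nat_finite[of B] by (auto simp: atLeast0LessThan)
  define S where "S z v = P z (P x v) + ((v - P x v) - P z (v - P x v))" for z v
  have linS: "linear (S z)" if "z \<in> \<Lambda>" for z
    using lin[OF that] lin[OF x] by (auto simp: S_def intro!: linearI simp: linear_add linear_diff linear_scale scaleR_diff_right scaleR_add_right algebra_simps)
  \<comment> \<open>The sum over the basis dominates the operator norm of \<open>S z - id\<close>,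
    so continuity of each \<open>P z v\<close> in \<open>z\<close> yields invertibility of
    \<open>S z\<close> on a whole ball.\<close>
  have "continuous_on \<Lambda> (\<lambda>z. \<Sum>i\<in>Basis. norm (S z i - i))"
    unfolding S_def by (intro continuous_intros cont)
  from this[unfolded continuous_on_iff, rule_format, OF x, of "1/2"]
  obtain d where d: "d > 0"
    "\<And>z. z \<in> \<Lambda> \<Longrightarrow> dist z x < d \<Longrightarrow> dist (\<Sum>i\<in>Basis. norm (S z i - i)) (\<Sum>i\<in>Basis. norm (S x i - i)) < 1/2"
    by auto
  have "S x v = v" for v
    using idem[OF x] by (simp add: S_def linear_diff[OF lin[OF x]])
  then have near: "(\<Sum>i\<in>Basis. norm (S z i - i)) < 1/2" if "z \<in> ball x d \<inter> \<Lambda>" for z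
    using d(2)[of z] that by (simp add: dist_commute dist_real_def)
  have injS: "inj (S z)" if z: "z \<in> ball x d \<inter> \<Lambda>" for z
  proof -
    have lz: "linear (S z)" using linS z by simp
    have "v = 0" if "S z v = 0" for v
    proof -
      have ld: "linear (\<lambda>v. S z v - v)"
        using lz by (auto intro!: linearI simp: linear_add linear_scale algebra_simps)
      have "norm v = norm (S z v - v)" using that by simp
      also have "S z v - v = (\<Sum>i\<in>Basis. (v \<bullet> i) *\<^sub>R (S z i - i))"
        using linear_sum[OF ld, of "\<lambda>i. (v \<bullet> i) *\<^sub>R i" Basis] linear_scale[OF ld]
        by (simp add: euclidean_representation)
      also have "norm \<dots> \<le> (\<Sum>i\<in>Basis. norm v * norm (S z i - i))"
        by (rule order_trans[OF norm_sum], rule sum_mono)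
           (auto intro!: mult_right_mono simp: Basis_le_norm)
      also have "\<dots> = norm v * (\<Sum>i\<in>Basis. norm (S z i - i))" by (simp add: sum_distrib_left)
      also have "\<dots> \<le> norm v * (1/2)" by (intro mult_left_mono) (use near[OF z] in auto)
      finally show "v = 0" by simp
    qed
    then show ?thesis using linear_injective_0[OF lz] by blast
  qed
  have SP: "S z (P x v) = P z (P x v)" if "z \<in> \<Lambda>" for z v
    by (simp add: S_def idem[OF x] linear_0[OF lin[OF that]])
  have range: "S z ` range (P x) = range (P z)" if z: "z \<in> ball x d \<inter> \<Lambda>" for z
  proof -
    have "P z v \<in> S z ` range (P x)" for v
    proof -
      \<comment> \<open>Since \<open>P z (S z u) = P z (P x u)\<close>, a preimage \<open>u\<close>
        of \<open>P z v\<close> may be replaced by \<open>P x u\<close>, which lies in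
        \<open>range (P x)\<close>.\<close>
      have "surj (S z)" using linear_inj_imp_surj[OF linS injS[OF z]] z by simp
      then obtain u where u: "P z v = S z u" by (metis surjD)
      have "P z v = P z (S z u)" using idem z u[symmetric] by simp
      also have "\<dots> = P z (P x u)"
        using z by (simp add: S_def linear_add[OF lin] linear_diff[OF lin] idem)
      also have "\<dots> = S z (P x u)" using SP z by simp
      finally show ?thesis by simp
    qed
    then show ?thesis using SP z by auto
  qed
  show "\<exists>U k e. open U \<and> x \<in> U \<and> (\<forall>i<k :: nat. continuous_on (U \<inter> \<Lambda>) (e i)) \<and>
        (\<forall>y\<in>U \<inter> \<Lambda>. inj_on (\<lambda>i. e i y) {..<k} \<and> independent ((\<lambda>i. e i y) ` {..<k}) \<and>
          range (P y) = span ((\<lambda>i. e i y) ` {..<k}))"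
  proof (intro exI[of _ "ball x d"] exI[of _ "card B"] exI[of _ "\<lambda>i z. P z (b i)"] conjI allI impI ballI)
    show "open (ball x d)" "x \<in> ball x d" using d(1) by auto
    show "continuous_on (ball x d \<inter> \<Lambda>) (\<lambda>z. P z (b i))" for i
      by (rule continuous_on_subset[OF cont]) auto
    fix z assume z: "z \<in> ball x d \<inter> \<Lambda>"
    have eq: "P z (b i) = S z (b i)" if "i < card B" for i
    proof -
      have "b i \<in> range (P x)" using b that B(1) by (auto simp: bij_betw_def)
      then show ?thesis using SP z by auto
    qed
    have im: "(\<lambda>i. P z (b i)) ` {..<card B} = S z ` B"
    proof -
      have "(\<lambda>i. P z (b i)) ` {..<card B} = (\<lambda>i. S z (b i)) ` {..<card B}"
        by (rule image_cong) (simp_all add: eq)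
      then show ?thesis using b by (simp add: bij_betw_def image_image[symmetric])
    qed
    show "inj_on (\<lambda>i. P z (b i)) {..<card B}"
      using b injS[OF z] eq by (auto simp: bij_betw_def inj_on_def inj_def)
    have lz: "linear (S z)" using linS z by simp
    show "independent ((\<lambda>i. P z (b i)) ` {..<card B})"
      unfolding im by (rule linear_independent_injective_image[OF lz B(2) inj_on_subset[OF injS[OF z] subset_UNIV]])
    show "range (P z) = span ((\<lambda>i. P z (b i)) ` {..<card B})"
      unfolding im linear_span_image[OF lz] spanB range[OF z] ..
  qed
qed

section \<open>Stable and unstable fibres of a dichotomy\<close>

locale dichotomous_henon =
  fixes p :: "complex \<times> complex" and M :: real
  assumes a: "fst p \<noteq> 0" and M: "M > 0"
    and D: "\<And>z. z \<in> KC p \<Longrightarrow> dichotomy M (\<lambda>n. henon_deriv p (orb p z n))"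
begin

text \<open>Boundedness in one time direction, without a rate: on \<open>KC p\<close> the dichotomy
  turns it into exponential decay, see \<open>Es_decay\<close> and \<open>Eu_decay\<close>.\<close>

definition Es where "Es z = {v. bounded (range (\<lambda>n::nat. cocycle p z (int n) v))}"
definition Eu where "Eu z = {v. bounded (range (\<lambda>n::nat. cocycle p z (- int n) v))}"

text \<open>The decay base is as large as the smallness condition of \<open>dichotomy_decay\<close>
  permits: \<open>M * ((q - 1) * deriv_bound p)\<close> equals 1/2.\<close>

definition q where "q = 1 + 1 / (2 * M * deriv_bound p)"

lemma q: "q > 1" "M * ((q - 1) * deriv_bound p) \<le> 1/2"
  using M deriv_bound_ge_1[of p] by (auto simp: q_def)

text \<open>The summands are the constants of the unstable and the stable decay estimate, so that
  one number serves both.\<close>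

definition C where "C = 2 * M * q * deriv_bound p + 2 * M"

lemma C_ge: "C \<ge> 2 * M" "C \<ge> 2 * M * q * deriv_bound p" "C > 0"
  using M q(1) deriv_bound_ge_1[of p] by (auto simp: C_def intro!: add_pos_pos mult_pos_pos)

lemma subspace_Es: "subspace (Es z)" and subspace_Eu: "subspace (Eu z)"
  unfolding Es_def Eu_def subspace_def
  by (auto simp: linear_0[OF linear_cocycle[OF a]] linear_add[OF linear_cocycle[OF a]]
      linear_scale[OF linear_cocycle[OF a]] intro!: bounded_plus_comp bounded_scaleR_comp)

lemma Es_decay:
  assumes z: "z \<in> KC p" and v: "v \<in> Es z"
  shows "q ^ n * norm (cocycle p z (int n) v) \<le> C * norm v"
proof -
  obtain b where b: "\<And>n. norm (cocycle p z (int n) v) \<le> b" using v by (auto simp: Es_def bounded_iff)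
  have b0: "0 \<le> b" using b norm_ge_zero order_trans by blast
  \<comment> \<open>Cutting the solution off before time 0 leaves a bounded two-sided sequence
    driven by the single impulse \<open>v\<close> at index -1. It acts at time 0, where the weight
    is 1, hence the constant \<open>2 * M\<close>.\<close>
  let ?V = "\<lambda>n. if n \<ge> 0 then cocycle p z n v else 0"
  have "q ^ nat \<bar>int n\<bar> * norm (?V (int n)) \<le> 2 * M * norm v"
  proof (rule dichotomy_decay[OF D[OF z] henon_deriv_bound[OF a z] q, where b = b and V = ?V and W = "\<lambda>n. if n = - 1 then v else 0"])
    show "?V (n + 1) = henon_deriv p (orb p z n) (?V n) + (if n = - 1 then v else 0)" for n
      using cocycle_step[OF a, of z n v] by (auto simp: linear_0[OF linear_henon_deriv])
    show "norm (?V n) \<le> b" for n using b[of "nat n"] b0 by (cases "n \<ge> 0") simp_all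
  qed simp
  also have "\<dots> \<le> C * norm v" by (intro mult_right_mono C_ge) simp
  finally show ?thesis by simp
qed

lemma Eu_decay:
  assumes z: "z \<in> KC p" and v: "v \<in> Eu z"
  shows "q ^ n * norm (cocycle p z (- int n) v) \<le> C * norm v"
proof -
  obtain b where b: "\<And>n. norm (cocycle p z (- int n) v) \<le> b" using v by (auto simp: Eu_def bounded_iff)
  have b0: "0 \<le> b" using b norm_ge_zero order_trans by blast
  \<comment> \<open>Cutting off after time 0 costs an impulse at index 0 that cancels
    \<open>henon_deriv p z v\<close>. It acts at time 1, where the weight is \<open>q\<close>; this
    explains the factor \<open>q * deriv_bound p\<close>.\<close>
  let ?V = "\<lambda>n. if n \<le> 0 then cocycle p z n v else 0"
  have "q ^ nat \<bar>- int n\<bar> * norm (?V (- int n)) \<le> 2 * M * (q * deriv_bound p * norm v)"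
  proof (rule dichotomy_decay[OF D[OF z] henon_deriv_bound[OF a z] q, where b = b and V = ?V
        and W = "\<lambda>n. if n = 0 then - henon_deriv p z v else 0"])
    show "?V (n + 1) = henon_deriv p (orb p z n) (?V n) + (if n = 0 then - henon_deriv p z v else 0)" for n
      using cocycle_step[OF a, of z n v] by (auto simp: linear_0[OF linear_henon_deriv])
    show "norm (?V n) \<le> b" for n using b[of "nat (- n)"] b0 by (cases "n \<le> 0") simp_all
    show "q ^ nat \<bar>n + 1\<bar> * norm (if n = 0 then - henon_deriv p z v else 0) \<le> q * deriv_bound p * norm v" for n
      using henon_deriv_bound[OF a z, of 0 v] q(1) deriv_bound_ge_1[of p] by (auto simp: mult.assoc)
  qed
  also have "\<dots> = 2 * M * q * deriv_bound p * norm v" by simp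
  also have "\<dots> \<le> C * norm v" by (intro mult_right_mono C_ge) simp
  finally show ?thesis by simp
qed

lemma Es_inter_Eu:
  assumes z: "z \<in> KC p" and v: "v \<in> Es z" "v \<in> Eu z"
  shows "v = 0"
proof -
  obtain b where b: "\<And>n. norm (cocycle p z (int n) v) \<le> b" using v by (auto simp: Es_def bounded_iff)
  obtain b' where b': "\<And>n. norm (cocycle p z (- int n) v) \<le> b'" using v by (auto simp: Eu_def bounded_iff)
  have "norm (cocycle p z n v) \<le> max b b'" for n
    using b[of "nat n"] b'[of "nat (- n)"] by (cases "n \<ge> 0") auto
  then have "cocycle p z 0 v = 0"
    by (rule dichotomy_zero[OF D[OF z], where V = "\<lambda>n. cocycle p z n v"]) (rule cocycle_step[OF a])
  then show ?thesis by simp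
qed

text \<open>Green's function: the bounded response to an impulse \<open>v\<close> at time 0 jumps from \<open>Eu\<close> to \<open>Es\<close>.\<close>

lemma Es_plus_Eu:
  assumes z: "z \<in> KC p"
  shows "\<exists>u\<in>Es z. v - u \<in> Eu z \<and> norm u \<le> M * norm v"
proof -
  have W: "norm (if n = - 1 then v else 0) \<le> norm v" for n :: int by simp
  obtain G where G: "\<And>n. norm (G n) \<le> M * norm v"
    "\<And>n. G (n + 1) = henon_deriv p (orb p z n) (G n) + (if n = - 1 then v else 0)"
    using dichotomy_solution[OF D[OF z], of "\<lambda>n. if n = - 1 then v else 0", OF W] by blast
  have pos: "cocycle p z (int n) (G 0) = G (int n)" for n
  proof (induction n)
    case (Suc n) then show ?case using G(2)[of "int n"] cocycle_step[OF a, of z "int n" "G 0"] by (simp add: add.commute)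
  qed simp
  have neg: "cocycle p z (- int (Suc n)) (v - G 0) = - G (- int (Suc n))" for n
  proof -
    \<comment> \<open>The induction carries two consecutive times because each backward step uses
      the previous value. Time 0 is exceptional: the impulse \<open>v\<close> makes the value there
      \<open>v - G 0\<close> instead of \<open>- G 0\<close>.\<close>
    have "cocycle p z (- int n) (v - G 0) = (if n = 0 then v - G 0 else - G (- int n)) \<and>
      cocycle p z (- int n - 1) (v - G 0) = - G (- int n - 1)"
    proof (induction n)
      case 0
      have vG: "v - G 0 = henon_deriv p (orb p z (- 1)) (- G (- 1))"
        using G(2)[of "- 1"] by (simp add: linear_neg[OF linear_henon_deriv])
      have "henon_inv_deriv p (henon p (orb p z (- 1))) (v - G 0) = - G (- 1)"
        unfolding vG by (rule henon_deriv_inverse(2)[OF a])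
      then show ?case using cocycle_back[OF a, of z 0 "v - G 0"] orb_step[OF a, of z "- 1"] by simp
    next
      case (Suc n)
      let ?m = "- int (Suc n)"
      have m: "- int n - 1 = ?m" by simp
      have "G ?m = henon_deriv p (orb p z (?m - 1)) (G (?m - 1))" using G(2)[of "?m - 1"] by simp
      then have "- G (?m - 1) = henon_inv_deriv p (orb p z ?m) (- G ?m)"
        using orb_step[OF a, of z "?m - 1"]
        by (simp add: henon_deriv_inverse(2)[OF a] linear_neg[OF linear_henon_inv_deriv])
      then show ?case using Suc cocycle_back[OF a, of z ?m "v - G 0"] unfolding m by simp
    qed
    moreover have "- int n - 1 = - int (Suc n)" by simp
    ultimately show ?thesis by metis
  qed
  have "G 0 \<in> Es z" unfolding Es_def using G(1) by (auto simp: pos bounded_iff)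
  moreover have "v - G 0 \<in> Eu z"
  proof -
    have "norm (cocycle p z (- int n) (v - G 0)) \<le> norm (v - G 0) + M * norm v" for n
    proof (cases n)
      case 0 then show ?thesis using M by simp
    next
      case (Suc m) then show ?thesis using G(1) norm_ge_zero[of "v - G 0"]
        by (simp only: neg norm_minus_cancel) (metis add_increasing)
    qed
    then show ?thesis unfolding Eu_def by (auto simp: bounded_iff)
  qed
  ultimately show ?thesis using G(1)[of 0] by blast
qed

section \<open>The projection onto the stable fibre along the unstable one\<close>

definition Ps where "Ps z v = (THE u. u \<in> Es z \<and> v - u \<in> Eu z)"

lemma decomp_unique:
  assumes z: "z \<in> KC p" and "u \<in> Es z" "v - u \<in> Eu z" "u' \<in> Es z" "v - u' \<in> Eu z"
  shows "u = u'"
proof -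
  have "u - u' \<in> Es z" using assms by (intro subspace_diff[OF subspace_Es])
  moreover have "(v - u') - (v - u) \<in> Eu z" by (rule subspace_diff[OF subspace_Eu assms(5,3)])
  ultimately show ?thesis using Es_inter_Eu[OF z, of "u - u'"] by simp
qed

lemma Ps_eqI: "z \<in> KC p \<Longrightarrow> u \<in> Es z \<Longrightarrow> v - u \<in> Eu z \<Longrightarrow> Ps z v = u"
  unfolding Ps_def by (rule the_equality) (auto intro: decomp_unique)

lemma Ps:
  assumes z: "z \<in> KC p"
  shows "Ps z v \<in> Es z" "v - Ps z v \<in> Eu z" "norm (Ps z v) \<le> M * norm v"
  using Es_plus_Eu[OF z, of v] Ps_eqI[OF z, of _ v] by auto

lemma linear_Ps:
  assumes z: "z \<in> KC p"
  shows "linear (Ps z)"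
proof (rule linearI)
  show "Ps z (v + w) = Ps z v + Ps z w" for v w
    using subspace_add[OF subspace_Es Ps(1)[OF z] Ps(1)[OF z]]
      subspace_add[OF subspace_Eu Ps(2)[OF z, of v] Ps(2)[OF z, of w]]
    by (intro Ps_eqI[OF z]) (auto simp: algebra_simps)
  show "Ps z (r *\<^sub>R v) = r *\<^sub>R Ps z v" for r v
    using subspace_scale[OF subspace_Es Ps(1)[OF z]] subspace_scale[OF subspace_Eu Ps(2)[OF z, of v], of r]
    by (intro Ps_eqI[OF z]) (auto simp: algebra_simps)
qed

lemma range_Ps: "z \<in> KC p \<Longrightarrow> range (Ps z) = Es z"
  and Ps_Es: "z \<in> KC p \<Longrightarrow> u \<in> Es z \<Longrightarrow> Ps z u = u"
proof -
  show *: "Ps z u = u" if "z \<in> KC p" "u \<in> Es z" for z u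
    using that subspace_0[OF subspace_Eu] by (intro Ps_eqI) auto
  show "range (Ps z) = Es z" if z: "z \<in> KC p" for z
    using Ps(1)[OF z] *[OF z] by (metis image_subsetI rangeI subsetI subset_antisym)
qed

lemma range_Pu:
  assumes z: "z \<in> KC p"
  shows "range (\<lambda>v. v - Ps z v) = Eu z"
proof -
  have "u = u - Ps z u" if "u \<in> Eu z" for u
    using that subspace_0[OF subspace_Es] Ps_eqI[OF z, of 0 u] by simp
  then show ?thesis using Ps(2)[OF z] by blast
qed

text \<open>Closed graph in the compact ball of radius \<open>M * norm v\<close>. Mere boundedness
  of half-orbits is not closed in \<open>z\<close>, but the decay estimates bound a whole half-orbit
  by \<open>C\<close> times its initial norm, uniformly in \<open>z\<close>, and such a bound
  survives the limit.\<close>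

lemma continuous_on_Ps: "continuous_on (KC p) (\<lambda>z. Ps z v)"
proof (rule continuous_from_closed_graph)
  show "compact (cball (0 :: complex \<times> complex) (M * norm v))" by simp
  show "(\<lambda>z. Ps z v) \<in> KC p \<rightarrow> cball 0 (M * norm v)" using Ps(3) by simp
  show "closed ((\<lambda>z. (z, Ps z v)) ` KC p)"
    unfolding closed_sequential_limits
  proof (intro allI impI, elim conjE)
    fix X l assume X: "\<forall>n. X n \<in> (\<lambda>z. (z, Ps z v)) ` KC p" and lim: "X \<longlonglongrightarrow> l"
    define z where "z k = fst (X k)" for k
    have zK: "z k \<in> KC p" and Xz: "X k = (z k, Ps (z k) v)" for k
      using X[rule_format, of k] by (auto simp: z_def)
    obtain z0 u where l: "l = (z0, u)" by (cases l)
    have zl: "z \<longlonglongrightarrow> z0" using tendsto_fst[OF lim] by (simp add: z_def[abs_def] l)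
    have ul: "(\<lambda>k. Ps (z k) v) \<longlonglongrightarrow> u" using tendsto_snd[OF lim] by (simp add: Xz l)
    have z0: "z0 \<in> KC p"
      using compact_imp_closed[OF compact_KC[OF a]] zK zl unfolding closed_sequential_limits by blast
    have vl: "(\<lambda>k. v - Ps (z k) v) \<longlonglongrightarrow> v - u" by (intro tendsto_intros ul)
    have pw: "norm x \<le> b" if "q ^ n * norm x \<le> b" for x :: "complex \<times> complex" and n b
    proof -
      have "1 * norm x \<le> q ^ n * norm x" using q(1) by (intro mult_right_mono) auto
      with that show ?thesis by simp
    qed
    have "norm (cocycle p z0 (int n) u) \<le> C * norm u" for n
    proof (rule LIMSEQ_le)
      show "(\<lambda>k. norm (cocycle p (z k) (int n) (Ps (z k) v))) \<longlonglongrightarrow> norm (cocycle p z0 (int n) u)"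
        by (intro tendsto_norm tendsto_cocycle a zl ul)
      show "(\<lambda>k. C * norm (Ps (z k) v)) \<longlonglongrightarrow> C * norm u" by (intro tendsto_intros ul)
    qed (use pw Es_decay[OF zK Ps(1)[OF zK]] in blast)
    then have "u \<in> Es z0" by (auto simp: Es_def bounded_iff)
    moreover have "norm (cocycle p z0 (- int n) (v - u)) \<le> C * norm (v - u)" for n
    proof (rule LIMSEQ_le)
      show "(\<lambda>k. norm (cocycle p (z k) (- int n) (v - Ps (z k) v))) \<longlonglongrightarrow> norm (cocycle p z0 (- int n) (v - u))"
        by (intro tendsto_norm tendsto_cocycle a zl vl)
      show "(\<lambda>k. C * norm (v - Ps (z k) v)) \<longlonglongrightarrow> C * norm (v - u)" by (intro tendsto_intros ul)
    qed (use pw Eu_decay[OF zK Ps(2)[OF zK]] in blast)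
    then have "v - u \<in> Eu z0" by (auto simp: Eu_def bounded_iff)
    ultimately have "Ps z0 v = u" by (rule Ps_eqI[OF z0])
    then show "l \<in> (\<lambda>z. (z, Ps z v)) ` KC p" using z0 l by auto
  qed
qed

lemma subbundle_Es: "subbundle (KC p) Es"
proof -
  have "subbundle (KC p) (\<lambda>z. range (Ps z))"
    by (rule subbundle_range_projection) (auto simp: linear_Ps Ps_Es Ps(1) continuous_on_Ps)
  then show ?thesis unfolding subbundle_def by (simp add: range_Ps)
qed

lemma subbundle_Eu: "subbundle (KC p) Eu"
proof -
  have "subbundle (KC p) (\<lambda>z. range (\<lambda>v. v - Ps z v))"
  proof (rule subbundle_range_projection)
    show "linear (\<lambda>v. v - Ps z v)" if "z \<in> KC p" for z
      using linear_add[OF linear_Ps[OF that]] linear_scale[OF linear_Ps[OF that]]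
      by (intro linearI) (simp_all add: scaleR_diff_right)
    show "v - Ps z v - Ps z (v - Ps z v) = v - Ps z v" if "z \<in> KC p" for z v
      by (simp add: linear_diff[OF linear_Ps[OF that]] Ps_Es[OF that Ps(1)[OF that]])
    show "continuous_on (KC p) (\<lambda>z. v - Ps z v)" for v
      by (intro continuous_intros continuous_on_Ps)
  qed
  then show ?thesis unfolding subbundle_def by (simp add: range_Pu)
qed

lemma bounded_shift:
  fixes f :: "int \<Rightarrow> 'b::real_normed_vector"
  assumes "bounded (range (\<lambda>n::nat. f (int n)))"
  shows "bounded (range (\<lambda>n::nat. f (m + int n)))"
proof -
  have "f (m + int n) \<in> f ` {m..0} \<union> range (\<lambda>n::nat. f (int n))" for n
  proof (cases "m + int n \<ge> 0")
    case True then show ?thesis by (metis UnI2 nonneg_int_cases rangeI)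
  qed auto
  then have "range (\<lambda>n::nat. f (m + int n)) \<subseteq> f ` {m..0} \<union> range (\<lambda>n::nat. f (int n))" by blast
  moreover have "bounded (f ` {m..0} \<union> range (\<lambda>n::nat. f (int n)))"
    using assms by (simp add: finite_imp_bounded)
  ultimately show ?thesis by (rule bounded_subset[rotated])
qed

lemma Es_invariant: "v \<in> Es z \<Longrightarrow> cocycle p z m v \<in> Es (orb p z m)"
  unfolding Es_def using bounded_shift[of "\<lambda>n. cocycle p z n v" m] by (simp add: cocycle_add[OF a])

lemma Eu_invariant: "v \<in> Eu z \<Longrightarrow> cocycle p z m v \<in> Eu (orb p z m)"
  unfolding Eu_def using bounded_shift[of "\<lambda>n. cocycle p z (- n) v" "- m"] by (simp add: cocycle_add[OF a])

lemma image_henon_deriv: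
  assumes "\<And>z v m. v \<in> E z \<Longrightarrow> cocycle p z m v \<in> E (orb p z m)"
  shows "frechet_derivative (henon p) (at z) ` E z = E (henon p z)"
proof -
  have fd: "frechet_derivative (henon p) (at z) = cocycle p z 1"
    using frechet_derivative_at[OF has_derivative_henon, of p z] cocycle_step[OF a, of z 0] by (auto simp: fun_eq_iff)
  have o: "orb p z 1 = henon p z" using orb_step[OF a, of z 0] by simp
  have "v \<in> cocycle p z 1 ` E z" if "v \<in> E (orb p z 1)" for v
  proof (rule image_eqI)
    show "cocycle p (orb p z 1) (- 1) v \<in> E z"
      using assms[OF that, of "- 1"] by (simp add: orb_add[OF a])
    show "v = cocycle p z 1 (cocycle p (orb p z 1) (- 1) v)"
      using cocycle_add[OF a, of "orb p z 1" "- 1" 1 v] by (simp add: orb_add[OF a])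
  qed
  then show ?thesis using assms[of _ z 1] unfolding fd o[symmetric] by blast
qed

lemma uniformly_hyperbolic: "uniformly_hyperbolic (henon p) (KC p)"
  unfolding uniformly_hyperbolic_def
proof (intro conjI, rule compact_KC[OF a], rule henon_image_KC[OF a],
    rule exI[of _ Es], rule exI[of _ Eu], intro conjI ballI)
  show "subbundle (KC p) Es" "subbundle (KC p) Eu" by (rule subbundle_Es subbundle_Eu)+
  fix z assume z: "z \<in> KC p"
  show "Es z \<inter> Eu z = {0}"
    using Es_inter_Eu[OF z] subspace_0[OF subspace_Es] subspace_0[OF subspace_Eu] by blast
  have "v \<in> {u + v |u v. u \<in> Es z \<and> v \<in> Eu z}" for v
    using Ps[OF z, of v] by (intro CollectI exI[of _ "Ps z v"] exI[of _ "v - Ps z v"]) simp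
  then show "{u + v |u v. u \<in> Es z \<and> v \<in> Eu z} = UNIV" by blast
  show "frechet_derivative (henon p) (at z) ` Es z = Es (henon p z)"
    by (rule image_henon_deriv[OF Es_invariant])
  show "frechet_derivative (henon p) (at z) ` Eu z = Eu (henon p z)"
    by (rule image_henon_deriv[OF Eu_invariant])
next
  \<comment> \<open>\<open>uniformly_hyperbolic\<close> asks for strict inequalities, hence
    \<open>C + 1\<close> in place of \<open>C\<close>; the contraction rate is
    \<open>1 / q\<close>.\<close>
  have lt: "x < (C + 1) * (1 / q) ^ n" if "q ^ n * x \<le> C" for n x
  proof -
    have qn: "q ^ n > 0" using q(1) by simp
    have "q ^ n * x < C + 1" using that by simp
    then show ?thesis using qn by (simp add: power_divide field_simps)
  qed
  have C1: "C + 1 > 0" using C_ge(3) by simp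
  show "\<exists>C>0. \<exists>\<theta>>0. \<theta> < 1 \<and> (\<forall>x\<in>KC p. \<forall>n. (\<forall>v\<in>Es x. norm v = 1 \<longrightarrow>
            norm (frechet_derivative (henon p ^^ n) (at x) v) < C * \<theta> ^ n) \<and>
         (\<forall>v\<in>Eu x. norm v = 1 \<longrightarrow>
            norm (frechet_derivative (inv (henon p) ^^ n) (at x) v) < C * \<theta> ^ n))"
  proof (rule exI[of _ "C + 1"], rule conjI[OF C1], rule exI[of _ "1 / q"], intro conjI ballI allI impI)
    show "1 / q > 0" "1 / q < 1" using q(1) by auto
    fix z n and v :: "complex \<times> complex" assume z: "z \<in> KC p" and v: "norm v = 1"
    show "norm (frechet_derivative (henon p ^^ n) (at z) v) < (C + 1) * (1 / q) ^ n" if "v \<in> Es z"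
      using lt[OF Es_decay[OF z that, of n, unfolded v mult_1_right]] by (simp add: cocycle_nat)
    show "norm (frechet_derivative (inv (henon p) ^^ n) (at z) v) < (C + 1) * (1 / q) ^ n" if "v \<in> Eu z"
      using lt[OF Eu_decay[OF z that, of n, unfolded v mult_1_right]] by (simp add: cocycle_neg)
  qed
qed

end

lemma uniformly_hyperbolic_henon_iff:
  assumes "fst p \<noteq> 0"
  shows "uniformly_hyperbolic (henon p) (KC p) \<longleftrightarrow> (\<exists>M. dichotomous M p)"
proof
  assume "\<exists>M. dichotomous M p"
  then obtain M where "dichotomous M p" by blast
  then interpret dichotomous_henon p M using assms by unfold_locales (auto simp: dichotomous_def)
  show "uniformly_hyperbolic (henon p) (KC p)" by (rule uniformly_hyperbolic)
qed (rule hyperbolic_imp_dichotomous[OF assms])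

section \<open>Structural stability\<close>

lemma conjugacy_inv_into:
  "conjugacy f X g Y h \<longleftrightarrow> f ` X \<subseteq> X \<and> g ` Y \<subseteq> Y \<and> homeomorphism X Y h (inv_into X h) \<and> (\<forall>x\<in>X. h (f x) = g (h x))"
proof -
  have "homeomorphism X Y h (inv_into X h)" if "homeomorphism X Y h k" for k
  proof (rule homeomorphism_cong[OF that refl refl refl])
    have "inj_on h X" using that by (metis homeomorphism_apply1 inj_on_inverseI)
    then show "inv_into X h y = k y" if "y \<in> Y" for y
      using that \<open>homeomorphism X Y h k\<close> by (metis homeomorphism_def imageI inv_into_f_f)
  qed
  then show ?thesis unfolding conjugacy_def by blast
qed

lemma conjugacyD:
  assumes "conjugacy f X g Y h"
  shows "x \<in> X \<Longrightarrow> h x \<in> Y" "x \<in> X \<Longrightarrow> f x \<in> X" "x \<in> X \<Longrightarrow> h (f x) = g (h x)"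
    "continuous_on X h" "continuous_on Y (inv_into X h)"
    "y \<in> Y \<Longrightarrow> inv_into X h y \<in> X" "y \<in> Y \<Longrightarrow> h (inv_into X h y) = y"
    "x \<in> X \<Longrightarrow> inv_into X h (h x) = x"
  using assms unfolding conjugacy_inv_into homeomorphism_def by blast+

lemma conjugacyI:
  assumes "f ` X \<subseteq> X" "g ` Y \<subseteq> Y" "homeomorphism X Y h k" "\<And>x. x \<in> X \<Longrightarrow> h (f x) = g (h x)"
  shows "conjugacy f X g Y h"
  using assms unfolding conjugacy_def by blast

lemma conjugacy_compose:
  assumes h: "conjugacy f X g Y h" and k: "conjugacy g Y u Z k"
  shows "conjugacy f X u Z (k \<circ> h)"
proof (rule conjugacyI)
  show "homeomorphism X Z (k \<circ> h) (inv_into X h \<circ> inv_into Y k)"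
    by (rule homeomorphism_compose[where T = Y]) (use h k in \<open>simp_all add: conjugacy_inv_into\<close>)
qed (use h k conjugacyD(1,3)[OF h] conjugacyD(3)[OF k] in \<open>auto simp: conjugacy_def\<close>)

lemma conjugacy_inverse:
  assumes h: "conjugacy f X g Y h"
  shows "conjugacy g Y f X (inv_into X h)"
proof (rule conjugacyI)
  show "homeomorphism Y X (inv_into X h) h"
    using h unfolding conjugacy_inv_into by (simp add: homeomorphism_symD)
  show "inv_into X h (g y) = f (inv_into X h y)" if "y \<in> Y" for y
    using conjugacyD[OF h] that by metis
qed (use h in \<open>auto simp: conjugacy_def\<close>)

lemma conjugacy_cong:
  assumes "conjugacy f X g Y h" "\<And>x. x \<in> X \<Longrightarrow> h' x = h x"
  shows "conjugacy f X g Y h'"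
  using assms unfolding conjugacy_def
  by (auto intro: homeomorphism_cong[where g' = "_"])

lemma inv_into_eqI:
  assumes "conjugacy f X g Y h" "x \<in> X" "h x = y"
  shows "inv_into X h y = x"
  using conjugacyD(8)[OF assms(1,2)] assms(3) by simp

section \<open>Itineraries of bounded orbits\<close>

lemma itinerary_orb:
  assumes a: "fst p \<noteq> 0" and h: "conjugacy (henon p) (KC p) shift UNIV h" and z: "z \<in> KC p"
  shows "h (orb p z n) i = h z (i + n)"
proof -
  have "h (orb p z n) = (\<lambda>i. h z (i + n))"
  proof (induction n rule: int_induct[where k = 0])
    case base show ?case by simp
  next
    case (step1 n)
    then show ?case using conjugacyD(3)[OF h orb_in_KC[OF a z], of n] unfolding orb_step[OF a]
      by (simp add: shift_def algebra_simps)
  next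
    case (step2 n)
    have "h (orb p z n) = shift (h (orb p z (n - 1)))"
      using conjugacyD(3)[OF h orb_in_KC[OF a z], of "n - 1"] orb_step[OF a, of z "n - 1"] by simp
    then have "h (orb p z (n - 1)) (j + 1) = h z (j + n)" for j
      using step2(2) by (metis shift_def)
    from this[of "_ - 1"] show ?case by (auto simp: fun_eq_iff algebra_simps)
  qed
  then show ?thesis by simp
qed

lemma itinerary_tendsto:
  fixes h :: "complex \<times> complex \<Rightarrow> bisequence"
  assumes h: "conjugacy f X shift UNIV h" and z: "(z \<longlongrightarrow> w) F" "\<forall>\<^sub>F k in F. z k \<in> X" "w \<in> X"
  shows "\<forall>\<^sub>F k in F. h (z k) i = h w i"
proof -
  have "continuous_on X (\<lambda>z. h z i)"
    by (rule continuous_on_product_then_coordinatewise[OF conjugacyD(4)[OF h]])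
  from continuous_on_tendsto_compose[OF this z(1,3,2)] show ?thesis
    by (simp add: tendsto_discrete)
qed

text \<open>The points of \<open>KC p\<close> with central symbol \<open>True\<close> and those with
  \<open>False\<close> form disjoint compact sets, hence sets a positive distance apart.\<close>

lemma nearby_points_same_symbol:
  assumes a: "fst p \<noteq> 0" and h: "conjugacy (henon p) (KC p) shift UNIV h"
  shows "\<exists>e>0. \<forall>z\<in>KC p. \<forall>w\<in>KC p. dist z w < e \<longrightarrow> h z 0 = h w 0"
proof -
  have K: "compact (KC p)" by (rule compact_KC[OF a])
  have "continuous_on (KC p) (\<lambda>z. h z 0)"
    by (rule continuous_on_product_then_coordinatewise[OF conjugacyD(4)[OF h]])
  then have cl: "closed ((\<lambda>z. h z 0) -` {b} \<inter> KC p)" for b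
    using continuous_on_closed_vimage[OF compact_imp_closed[OF K]] by blast
  have "compact ((\<lambda>z. h z 0) -` {True} \<inter> KC p)"
    using compact_Int_closed[OF K cl[of True]] by (simp add: Int_absorb1 Int_commute)
  moreover have "((\<lambda>z. h z 0) -` {True} \<inter> KC p) \<inter> ((\<lambda>z. h z 0) -` {False} \<inter> KC p) = {}" by blast
  ultimately obtain e where e: "e > 0"
    "\<forall>z\<in>(\<lambda>z. h z 0) -` {True} \<inter> KC p. \<forall>w\<in>(\<lambda>z. h z 0) -` {False} \<inter> KC p. e \<le> dist z w"
    using separate_compact_closed[OF _ cl[of False]] by meson
  have "h z 0 = h w 0" if "z \<in> KC p" "w \<in> KC p" "dist z w < e" for z w
    using e(2)[rule_format, of z w] e(2)[rule_format, of w z] that by (auto simp: dist_commute)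
  with e(1) show ?thesis by blast
qed

text \<open>Uniform continuity of the inverse conjugacy, by compactness: limits of two sequences
  that agree on growing windows have the same full itinerary and therefore coincide.\<close>

lemma same_itinerary_close:
  assumes a: "fst p \<noteq> 0" and h: "conjugacy (henon p) (KC p) shift UNIV h" and e: "e > 0"
  shows "\<exists>N::nat. \<forall>z\<in>KC p. \<forall>w\<in>KC p. (\<forall>i. \<bar>i\<bar> \<le> int N \<longrightarrow> h z i = h w i) \<longrightarrow> dist z w < e"
proof (rule ccontr)
  assume "\<not> ?thesis"
  then have "\<exists>z w. z \<in> KC p \<and> w \<in> KC p \<and> (\<forall>i. \<bar>i\<bar> \<le> int k \<longrightarrow> h z i = h w i) \<and> dist z w \<ge> e" for k :: nat
    by (meson not_le)
  then obtain z w where zw: "\<And>k. z k \<in> KC p" "\<And>k. w k \<in> KC p"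
    "\<And>k i. \<bar>i\<bar> \<le> int k \<Longrightarrow> h (z k) i = h (w k) i" "\<And>k. dist (z k) (w k) \<ge> e" by metis
  obtain r z0 where r: "strict_mono r" "(z \<circ> r) \<longlonglongrightarrow> z0" "z0 \<in> KC p"
    by (rule KC_subsequence[OF tendsto_const a zw(1)]) (rule that)
  have wr: "(w \<circ> r) k \<in> KC p" for k using zw(2) by simp
  obtain r' w0 where r': "strict_mono r'" "((w \<circ> r) \<circ> r') \<longlonglongrightarrow> w0" "w0 \<in> KC p"
    by (rule KC_subsequence[OF tendsto_const a wr]) (rule that)
  have z': "((z \<circ> r) \<circ> r') \<longlonglongrightarrow> z0" by (rule LIMSEQ_subseq_LIMSEQ[OF r(2) r'(1)])
  have "h z0 i = h w0 i" for i
  proof -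
    have "\<forall>\<^sub>F k in sequentially. h (((z \<circ> r) \<circ> r') k) i = h z0 i"
      by (rule itinerary_tendsto[OF h z']) (use zw r in auto)
    moreover have "\<forall>\<^sub>F k in sequentially. h (((w \<circ> r) \<circ> r') k) i = h w0 i"
      by (rule itinerary_tendsto[OF h r'(2)]) (use zw r' in auto)
    moreover have "\<forall>\<^sub>F k in sequentially. h (((z \<circ> r) \<circ> r') k) i = h (((w \<circ> r) \<circ> r') k) i"
      using eventually_ge_at_top[of "nat \<bar>i\<bar>"]
    proof eventually_elim
      case (elim k)
      have "k \<le> r (r' k)" using seq_suble[OF r(1)] seq_suble[OF r'(1)] order_trans by blast
      then show ?case using elim zw(3) by simp
    qed
    ultimately have "\<forall>\<^sub>F k in sequentially. h z0 i = h w0 i" by eventually_elim simp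
    then show ?thesis by simp
  qed
  then have eq: "h z0 = h w0" by (rule ext)
  have "z0 = inv_into (KC p) h (h z0)" by (rule sym[OF conjugacyD(8)[OF h r(3)]])
  also have "\<dots> = w0" unfolding eq by (rule conjugacyD(8)[OF h r'(3)])
  finally have "z0 = w0" .
  have "(\<lambda>k. dist (((z \<circ> r) \<circ> r') k) (((w \<circ> r) \<circ> r') k)) \<longlonglongrightarrow> dist z0 w0"
    using tendsto_dist[OF z' r'(2)] .
  then have "e \<le> dist z0 w0" by (rule LIMSEQ_le_const) (use zw(4) in auto)
  with \<open>z0 = w0\<close> e show False by simp
qed

text \<open>Since every bisequence is an itinerary, the symbols read off along an orbit of a nearby map
  are the itinerary of some point of \<open>KC p0\<close>.\<close>

lemma orbit_shadowing:
  assumes a0: "fst p0 \<noteq> 0" and h: "conjugacy (henon p0) (KC p0) shift UNIV h" and e: "e > 0"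
  shows "\<exists>\<rho>>0. \<forall>p\<in>ball p0 \<rho>. fst p \<noteq> 0 \<longrightarrow>
    (\<forall>z\<in>KC p. \<exists>y\<in>KC p0. \<forall>n. dist (orb p z n) (orb p0 y n) < e)"
proof -
  obtain d where d: "d > 0" "\<And>z w. z \<in> KC p0 \<Longrightarrow> w \<in> KC p0 \<Longrightarrow> dist z w < d \<Longrightarrow> h z 0 = h w 0"
    using nearby_points_same_symbol[OF a0 h] by metis
  obtain N :: nat where N: "\<And>z w. z \<in> KC p0 \<Longrightarrow> w \<in> KC p0 \<Longrightarrow>
      (\<And>i. \<bar>i\<bar> \<le> int N \<Longrightarrow> h z i = h w i) \<Longrightarrow> dist z w < e / 2"
    using same_itinerary_close[OF a0 h, of "e / 2"] e by (metis half_gt_zero)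
  \<comment> \<open>\<open>d / 2\<close> because two window approximations are compared through the
    orbit of \<open>z\<close>; \<open>e / 2\<close> because the final estimate has two
    terms.\<close>
  define \<epsilon> where "\<epsilon> = min (d / 2) (e / 2)"
  have \<epsilon>: "\<epsilon> > 0" using d(1) e by (simp add: \<epsilon>_def)
  obtain \<rho> where \<rho>: "\<rho> > 0" "\<And>p z. p \<in> ball p0 \<rho> \<Longrightarrow> z \<in> KC p \<Longrightarrow>
      \<exists>y\<in>KC p0. \<forall>i. \<bar>i\<bar> \<le> int N \<longrightarrow> dist (orb p z i) (orb p0 y i) < \<epsilon>"
    using KC_upper_semicontinuous[OF a0 \<epsilon>, of "int N"] by metis
  show ?thesis
  proof (intro exI[of _ \<rho>] conjI \<rho>(1) ballI impI)
    fix p z assume p: "p \<in> ball p0 \<rho>" and a: "fst p \<noteq> 0" and z: "z \<in> KC p"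
    have "\<exists>y. y \<in> KC p0 \<and> (\<forall>i. \<bar>i\<bar> \<le> int N \<longrightarrow> dist (orb p z (n + i)) (orb p0 y i) < \<epsilon>)" for n
      using \<rho>(2)[OF p orb_in_KC[OF a z, of n]] by (auto simp: orb_add[OF a])
    then obtain y where y: "\<And>n. y n \<in> KC p0"
      "\<And>n i. \<bar>i\<bar> \<le> int N \<Longrightarrow> dist (orb p z (n + i)) (orb p0 (y n) i) < \<epsilon>" by metis
    define s where "s n = h (y n) 0" for n
    \<comment> \<open>Consistency of the windows: although \<open>y n\<close> and
      \<open>y (n + i)\<close> are chosen independently, both follow the orbit of \<open>z\<close>
      at time \<open>n + i\<close>, so their symbols there coincide.\<close>
    have sy: "h (y n) i = s (n + i)" if "\<bar>i\<bar> \<le> int N" for n i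
    proof -
      have "dist (orb p0 (y n) i) (y (n + i)) \<le> dist (orb p z (n + i)) (orb p0 (y n) i) + dist (orb p z (n + i)) (y (n + i))"
        by (rule dist_triangle3)
      also have "\<dots> < d" using y(2)[OF that, of n] y(2)[of 0 "n + i"] by (simp add: \<epsilon>_def)
      finally have "h (orb p0 (y n) i) 0 = h (y (n + i)) 0" by (intro d(2) orb_in_KC a0 y)
      then show ?thesis using itinerary_orb[OF a0 h y(1), of n i 0] by (simp add: s_def)
    qed
    define x where "x = inv_into (KC p0) h s"
    have x: "x \<in> KC p0" "h x = s" using conjugacyD(6,7)[OF h] by (simp_all add: x_def)
    have "dist (orb p z n) (orb p0 x n) < e" for n
    proof -
      have "dist (y n) (orb p0 x n) < e / 2"
      proof (rule N[OF y(1) orb_in_KC[OF a0 x(1)]])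
        show "h (y n) i = h (orb p0 x n) i" if "\<bar>i\<bar> \<le> int N" for i
          using sy[OF that] by (simp add: itinerary_orb[OF a0 h x(1)] x(2) add.commute)
      qed
      moreover have "dist (orb p z n) (y n) < e / 2" using y(2)[of 0 n] by (simp add: \<epsilon>_def)
      ultimately show ?thesis using dist_triangle[of "orb p z n" "orb p0 x n" "y n"] by linarith
    qed
    with x(1) show "\<exists>y\<in>KC p0. \<forall>n. dist (orb p z n) (orb p0 y n) < e" by blast
  qed
qed

section \<open>Continuation of orbits and local triviality of \<open>KC\<close>\<close>

lemma dist_fst_le_dist: "norm (fst x - fst y) \<le> dist x y" and dist_snd_le_dist: "norm (snd x - snd y) \<le> dist x y"
  for x y :: "'a::real_normed_vector \<times> 'b::real_normed_vector"
  using dist_fst_le[of x y] dist_snd_le[of x y] by (simp_all add: dist_norm)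

lemma norm_fst_le': "norm (fst x) \<le> norm x" and norm_snd_le': "norm (snd x) \<le> norm x"
  for x :: "'a::real_normed_vector \<times> 'b::real_normed_vector"
  by (metis norm_fst_le prod.collapse, metis norm_snd_le prod.collapse)

text \<open>For the deviation \<open>V\<close> from the orbit of \<open>y\<close>, the orbit
  equation of \<open>p\<close> is the linear equation with source \<open>?g n (V n)\<close>. As the
  map is quadratic, \<open>?g\<close> is exactly a square plus parameter errors, with Lipschitz
  constant \<open>2 * \<delta> + dist p p0\<close> on the \<open>\<delta>\<close>-ball. The choice
  of \<open>\<delta>\<close> and the bound on \<open>dist p p0\<close> each contribute at most 1/4
  to the product with \<open>M\<close>; \<open>small\<close> controls the error at
  \<open>V = 0\<close>.\<close>

lemma orbit_continuation:
  assumes a0: "fst p0 \<noteq> 0" and a: "fst p \<noteq> 0" and D: "dichotomous M p0"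
    and y: "y \<in> KC p0" and \<delta>: "\<delta> = 1 / (8 * M)" and \<eta>: "dist p p0 \<le> 1 / (4 * M)"
    and small: "M * (dist p p0 * (1 + 2 * orb_radius p0)) \<le> \<delta> / 2"
  shows "\<exists>!z. z \<in> KC p \<and> (\<forall>n. dist (orb p z n) (orb p0 y n) \<le> \<delta>)"
proof -
  let ?A = "\<lambda>n. henon_deriv p0 (orb p0 y n)"
  have M: "M > 0" and Dy: "dichotomy M ?A" using D y by (auto simp: dichotomous_def)
  have \<delta>0: "\<delta> > 0" using M \<delta> by simp
  let ?g = "\<lambda>n v. henon p (orb p0 y n + v) - henon p0 (orb p0 y n) - ?A n v"
  have ex: "\<exists>!V. (\<forall>n. norm (V n) \<le> \<delta>) \<and> (\<forall>n. V (n + 1) = ?A n (V n) + ?g n (V n))"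
  proof (rule dichotomy_fixpoint[OF Dy])
    show "0 \<le> \<delta>" using \<delta>0 by simp
    show "0 \<le> 2 * \<delta> + dist p p0" using \<delta>0 by simp
    have "M * (2 * \<delta> + dist p p0) = 1/4 + M * dist p p0" using M \<delta> by (simp add: field_simps)
    also have "M * dist p p0 \<le> 1/4" using mult_left_mono[OF \<eta>, of M] M by simp
    finally show "M * (2 * \<delta> + dist p p0) \<le> 1/2" by simp
    show "norm (?g n u - ?g n v) \<le> (2 * \<delta> + dist p p0) * norm (u - v)"
      if "norm u \<le> \<delta>" "norm v \<le> \<delta>" for n u v
    proof -
      have "?g n u - ?g n v = ((fst u + fst v) * (fst u - fst v) - (fst p - fst p0) * (snd u - snd v), 0)"
        by (simp add: henon_eq henon_deriv_def algebra_simps power2_eq_square)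
      then have "norm (?g n u - ?g n v) = norm ((fst u + fst v) * (fst u - fst v) - (fst p - fst p0) * (snd u - snd v))"
        by simp
      also have "\<dots> \<le> norm (fst u + fst v) * norm (fst u - fst v) + norm (fst p - fst p0) * norm (snd u - snd v)"
        by (metis norm_mult norm_triangle_ineq4)
      also have "\<dots> \<le> (2 * \<delta>) * norm (u - v) + dist p p0 * norm (u - v)"
      proof (intro add_mono mult_mono dist_fst_le_dist)
        show "norm (fst u + fst v) \<le> 2 * \<delta>"
          using norm_triangle_ineq[of "fst u" "fst v"] norm_fst_le'[of u] norm_fst_le'[of v] that by linarith
        show "norm (fst u - fst v) \<le> norm (u - v)" "norm (snd u - snd v) \<le> norm (u - v)"
          using norm_fst_le'[of "u - v"] norm_snd_le'[of "u - v"] by simp_all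
      qed (use \<delta>0 in auto)
      finally show ?thesis by (simp add: algebra_simps)
    qed
    show "M * norm (?g n 0) \<le> \<delta> / 2" for n
    proof -
      have "?g n 0 = (snd p - snd p0 - (fst p - fst p0) * snd (orb p0 y n), 0)"
        by (simp add: henon_eq henon_deriv_def algebra_simps)
      then have "norm (?g n 0) \<le> norm (snd p - snd p0) + norm (fst p - fst p0) * norm (snd (orb p0 y n))"
        by (simp add: norm_mult[symmetric] norm_triangle_ineq4)
      also have "\<dots> \<le> dist p p0 + dist p p0 * (2 * orb_radius p0)"
        by (intro add_mono mult_mono dist_fst_le_dist dist_snd_le_dist order_trans[OF norm_snd_le' orb_bound[OF a0 y]]) auto
      finally have "M * norm (?g n 0) \<le> M * (dist p p0 * (1 + 2 * orb_radius p0))"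
        using M by (intro mult_left_mono) (auto simp: algebra_simps)
      with small show ?thesis by linarith
    qed
  qed
  have eq: "?A n v + ?g n v = henon p (orb p0 y n + v) - orb p0 y (n + 1)" for n v
    by (simp add: orb_step[OF a0])
  obtain V where V: "\<And>n. norm (V n) \<le> \<delta>" "\<And>n. V (n + 1) = henon p (orb p0 y n + V n) - orb p0 y (n + 1)"
    using ex unfolding eq by blast
  let ?\<zeta> = "\<lambda>n. orb p0 y n + V n"
  have step: "?\<zeta> (n + 1) = henon p (?\<zeta> n)" for n using V(2)[of n] by simp
  have bd: "norm (?\<zeta> n) \<le> 2 * orb_radius p0 + \<delta>" for n
    using norm_triangle_ineq[of "orb p0 y n" "V n"] orb_bound[OF a0 y, of n] V(1)[of n] by linarith
  have \<zeta>: "?\<zeta> n = orb p (?\<zeta> 0) n" for n by (rule orb_unique[of p ?\<zeta> n, OF a step])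
  show ?thesis
  proof (rule ex1I[of _ "?\<zeta> 0"])
    have "dist (orb p (?\<zeta> 0) n) (orb p0 y n) \<le> \<delta>" for n
      unfolding \<zeta>[symmetric] using V(1) by (simp add: dist_norm)
    then show "?\<zeta> 0 \<in> KC p \<and> (\<forall>n. dist (orb p (?\<zeta> 0) n) (orb p0 y n) \<le> \<delta>)"
      using KC_I[of p ?\<zeta> _ 0, OF a step bd] by blast
    fix z assume z: "z \<in> KC p \<and> (\<forall>n. dist (orb p z n) (orb p0 y n) \<le> \<delta>)"
    let ?U = "\<lambda>n. orb p z n - orb p0 y n"
    have U1: "\<forall>n. norm (?U n) \<le> \<delta>" using z by (simp add: dist_norm)
    have U2: "\<forall>n. ?U (n + 1) = ?A n (?U n) + ?g n (?U n)" unfolding eq by (simp add: orb_step[OF a])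
    have V2: "\<forall>n. V (n + 1) = ?A n (V n) + ?g n (V n)" unfolding eq using V(2) by blast
    have "?U = V"
      by (rule trans[OF sym[OF the1_equality[OF ex, of ?U, OF conjI[OF U1 U2]]]
            the1_equality[OF ex, of V, OF conjI[OF allI[OF V(1)] V2]]])
    then have "?U 0 = V 0" by (rule fun_cong)
    then show "z = ?\<zeta> 0" by (simp add: algebra_simps)
  qed
qed

text \<open>The difference of two orbits of one map solves the linear equation up to the square of
  its first coordinate, an error with factor \<open>1 / (2 * M)\<close>. The radius exceeds
  \<open>2 * \<delta>\<close> for \<open>\<delta> = 1 / (8 * M)\<close>, so the lemma covers two
  orbits that are both \<open>\<delta>\<close>-close to a third.\<close>

lemma orbit_expansive:
  assumes a: "fst p \<noteq> 0" and D: "dichotomous M p" and y: "y \<in> KC p" and w: "w \<in> KC p"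
    and close: "\<And>n. dist (orb p y n) (orb p w n) \<le> 1 / (2 * M)"
  shows "y = w"
proof -
  have M: "M > 0" and Dy: "dichotomy M (\<lambda>n. henon_deriv p (orb p y n))"
    using D y by (auto simp: dichotomous_def)
  let ?V = "\<lambda>n. orb p w n - orb p y n"
  have V: "norm (?V n) \<le> 1 / (2 * M)" for n using close[of n] by (simp add: dist_norm norm_minus_commute)
  have "?V 0 = 0"
  proof (rule dichotomy_contraction_zero[OF Dy, where V = ?V and W = "\<lambda>n. ((fst (?V n))\<^sup>2, 0)"])
    show "norm (?V n) \<le> 1 / (2 * M)" for n by (rule V)
    show "?V (n + 1) = henon_deriv p (orb p y n) (?V n) + ((fst (?V n))\<^sup>2, 0)" for n
      unfolding orb_step[OF a] by (simp add: henon_eq henon_deriv_def algebra_simps power2_eq_square)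
    show "norm ((fst (?V n))\<^sup>2, 0 :: complex) \<le> 1 / (2 * M) * norm (?V n)" for n
    proof -
      have "norm ((fst (?V n))\<^sup>2, 0 :: complex) = norm (fst (?V n)) * norm (fst (?V n))"
        by (simp add: power2_eq_square norm_mult)
      also have "\<dots> \<le> 1 / (2 * M) * norm (?V n)"
        using M by (intro mult_mono norm_fst_le' order_trans[OF norm_fst_le' V]) auto
      finally show ?thesis .
    qed
  qed (use M in auto)
  then show ?thesis by simp
qed

text \<open>The derivative is affine in the point, so along \<open>\<delta>\<close>-close orbits the
  two derivatives differ by at most \<open>2 * \<delta> + dist p p0\<close>; the budget is that of
  \<open>orbit_continuation\<close>.\<close>

lemma dichotomous_perturb:
  assumes a0: "fst p0 \<noteq> 0" and a: "fst p \<noteq> 0" and D: "dichotomous M p0" and \<delta>: "\<delta> = 1 / (8 * M)"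
    and \<eta>: "dist p p0 \<le> 1 / (4 * M)"
    and sh: "\<And>z. z \<in> KC p \<Longrightarrow> \<exists>y\<in>KC p0. \<forall>n. dist (orb p z n) (orb p0 y n) \<le> \<delta>"
  shows "dichotomous (2 * M) p"
  unfolding dichotomous_def
proof (intro conjI ballI)
  have M: "M > 0" using D by (simp add: dichotomous_def)
  then show "2 * M > 0" by simp
  fix z assume "z \<in> KC p"
  then obtain y where y: "y \<in> KC p0" "\<And>n. dist (orb p z n) (orb p0 y n) \<le> \<delta>" using sh by blast
  show "dichotomy (2 * M) (\<lambda>n. henon_deriv p (orb p z n))"
  proof (rule dichotomy_perturb)
    show "dichotomy M (\<lambda>n. henon_deriv p0 (orb p0 y n))" using D y(1) by (simp add: dichotomous_def)
    show "linear (henon_deriv p (orb p z n))" for n by (rule linear_henon_deriv)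
    show "norm (henon_deriv p (orb p z n) v - henon_deriv p0 (orb p0 y n) v) \<le> (2 * \<delta> + dist p p0) * norm v" for n v
    proof -
      have "henon_deriv p (orb p z n) v - henon_deriv p0 (orb p0 y n) v =
        (2 * (fst (orb p z n) - fst (orb p0 y n)) * fst v - (fst p - fst p0) * snd v, 0)"
        by (simp add: henon_deriv_def algebra_simps)
      then have "norm (henon_deriv p (orb p z n) v - henon_deriv p0 (orb p0 y n) v) \<le>
        norm (2 * (fst (orb p z n) - fst (orb p0 y n)) * fst v) + norm ((fst p - fst p0) * snd v)"
        by (simp add: norm_triangle_ineq4)
      also have "\<dots> = 2 * norm (fst (orb p z n) - fst (orb p0 y n)) * norm (fst v) + norm (fst p - fst p0) * norm (snd v)"
        by (simp only: norm_mult norm_numeral)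
      also have "\<dots> \<le> 2 * \<delta> * norm v + dist p p0 * norm v"
        using M \<delta> by (intro add_mono mult_mono mult_left_mono norm_fst_le' norm_snd_le' dist_fst_le_dist
            order_trans[OF dist_fst_le_dist y(2)]) auto
      finally show ?thesis by (simp add: algebra_simps)
    qed
    show "0 \<le> 2 * \<delta> + dist p p0" using M \<delta> by simp
    have "M * (2 * \<delta> + dist p p0) = 1/4 + M * dist p p0" using M \<delta> by (simp add: field_simps)
    also have "M * dist p p0 \<le> 1/4" using mult_left_mono[OF \<eta>, of M] M by simp
    finally show "M * (2 * \<delta> + dist p p0) \<le> 1/2" by simp
  qed
qed

lemma HC_iff: "p \<in> HC \<longleftrightarrow> fst p \<noteq> 0 \<and> (\<exists>M. dichotomous M p) \<and> (\<exists>h. conjugacy (henon p) (KC p) shift UNIV h)"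
proof (cases p)
  case (Pair a c)
  show ?thesis
    unfolding Pair HC_def hyperbolic_full_horseshoe_def topologically_conjugate_def
    using uniformly_hyperbolic_henon_iff[of "(a, c)"] by auto
qed

text \<open>\<open>\<Phi>\<close> and \<open>\<Psi>\<close> are the two readings of one relation,
  that two orbits stay \<open>\<delta>\<close>-close: \<open>orbit_continuation\<close> gives
  existence and uniqueness in one direction, \<open>orbit_shadowing\<close> and
  \<open>orbit_expansive\<close> in the other. Continuity of \<open>\<Phi>\<close> in the parameter
  serves to construct families of conjugacies, joint continuity of \<open>\<Psi>\<close> to follow
  moving points.\<close>

lemma local_trivialisation:
  assumes p0: "p0 \<in> HC"
  obtains \<rho> \<Phi> \<Psi> where "\<rho> > 0" "ball p0 \<rho> \<subseteq> HC"
    "\<And>p. p \<in> ball p0 \<rho> \<Longrightarrow> conjugacy (henon p0) (KC p0) (henon p) (KC p) (\<Phi> p)"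
    "\<And>p. p \<in> ball p0 \<rho> \<Longrightarrow> conjugacy (henon p) (KC p) (henon p0) (KC p0) (\<Psi> p)"
    "\<And>p y. p \<in> ball p0 \<rho> \<Longrightarrow> y \<in> KC p0 \<Longrightarrow> \<Psi> p (\<Phi> p y) = y"
    "\<And>p z. p \<in> ball p0 \<rho> \<Longrightarrow> z \<in> KC p \<Longrightarrow> \<Phi> p (\<Psi> p z) = z"
    "\<And>y. y \<in> KC p0 \<Longrightarrow> continuous_on (ball p0 \<rho>) (\<lambda>p. \<Phi> p y)"
    "continuous_on (SIGMA p:ball p0 \<rho>. KC p) (\<lambda>(p, z). \<Psi> p z)"
proof -
  obtain M h where a0: "fst p0 \<noteq> 0" and D: "dichotomous M p0" and h: "conjugacy (henon p0) (KC p0) shift UNIV h"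
    using p0 by (auto simp: HC_iff)
  have M: "M > 0" using D by (simp add: dichotomous_def)
  define \<delta> where "\<delta> = 1 / (8 * M)"
  have \<delta>0: "\<delta> > 0" using M by (simp add: \<delta>_def)
  obtain \<rho>1 where \<rho>1: "\<rho>1 > 0" "\<And>p z. p \<in> ball p0 \<rho>1 \<Longrightarrow> fst p \<noteq> 0 \<Longrightarrow> z \<in> KC p \<Longrightarrow>
     \<exists>y\<in>KC p0. \<forall>n. dist (orb p z n) (orb p0 y n) < \<delta>"
    using orbit_shadowing[OF a0 h \<delta>0] by metis
  \<comment> \<open>In order: the range of \<open>orbit_shadowing\<close>, nonvanishing of
    \<open>fst p\<close>, the Lipschitz budget, and the size of the initial Newton error.\<close>
  define \<rho> where "\<rho> = Min {\<rho>1, norm (fst p0), 1 / (4 * M), \<delta> / 2 / (M * (1 + 2 * orb_radius p0))}"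
  have R: "1 + 2 * orb_radius p0 > 0" by (simp add: orb_radius_def add_pos_nonneg)
  have \<rho>0: "\<rho> > 0" using \<rho>1(1) a0 M \<delta>0 R by (simp add: \<rho>_def)
  have \<rho>le: "\<rho> \<le> \<rho>1" "\<rho> \<le> norm (fst p0)" "\<rho> \<le> 1 / (4 * M)" "\<rho> \<le> \<delta> / 2 / (M * (1 + 2 * orb_radius p0))"
    by (auto simp: \<rho>_def)
  have a: "fst p \<noteq> 0" if "p \<in> ball p0 \<rho>" for p
    using that \<rho>le(2) dist_fst_le_dist[of p0 p] by auto
  have \<eta>: "dist p p0 \<le> 1 / (4 * M)" if "p \<in> ball p0 \<rho>" for p
    using that \<rho>le(3) by (simp add: dist_commute)
  have small: "M * (dist p p0 * (1 + 2 * orb_radius p0)) \<le> \<delta> / 2" if "p \<in> ball p0 \<rho>" for p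
  proof -
    have "dist p p0 \<le> \<delta> / 2 / (M * (1 + 2 * orb_radius p0))" using that \<rho>le(4) by (simp add: dist_commute)
    then have "dist p p0 * (M * (1 + 2 * orb_radius p0)) \<le> \<delta> / 2"
      using M R by (simp add: pos_le_divide_eq)
    then show ?thesis by (simp add: mult_ac)
  qed
  let ?rel = "\<lambda>p y z. \<forall>n. dist (orb p z n) (orb p0 y n) \<le> \<delta>"
  have ex1: "\<exists>!z. z \<in> KC p \<and> ?rel p y z" if "p \<in> ball p0 \<rho>" "y \<in> KC p0" for p y
    by (rule orbit_continuation[OF a0 a[OF that(1)] D that(2) \<delta>_def \<eta>[OF that(1)] small[OF that(1)]])
  have ex2: "\<exists>y\<in>KC p0. ?rel p y z" if "p \<in> ball p0 \<rho>" "z \<in> KC p" for p z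
    using \<rho>1(2)[of p z] that a[OF that(1)] \<rho>le(1) by (fastforce intro: less_imp_le)
  have un2: "y = y'" if "y \<in> KC p0" "y' \<in> KC p0" "?rel p y z" "?rel p y' z" for p y y' z
  proof (rule orbit_expansive[OF a0 D that(1,2)])
    fix n
    have "dist (orb p0 y n) (orb p0 y' n) \<le> dist (orb p z n) (orb p0 y n) + dist (orb p z n) (orb p0 y' n)"
      by (rule dist_triangle3)
    also have "\<dots> \<le> \<delta> + \<delta>" using that by (intro add_mono) auto
    also have "\<dots> \<le> 1 / (2 * M)" using M by (simp add: \<delta>_def field_simps)
    finally show "dist (orb p0 y n) (orb p0 y' n) \<le> 1 / (2 * M)" .
  qed
  define \<Phi> where "\<Phi> p y = (THE z. z \<in> KC p \<and> ?rel p y z)" for p y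
  define \<Psi> where "\<Psi> p z = (THE y. y \<in> KC p0 \<and> ?rel p y z)" for p z
  have \<Phi>: "\<Phi> p y \<in> KC p" "?rel p y (\<Phi> p y)" if "p \<in> ball p0 \<rho>" "y \<in> KC p0" for p y
    using theI'[OF ex1[OF that]] unfolding \<Phi>_def by blast+
  have \<Phi>I: "\<Phi> p y = z" if "p \<in> ball p0 \<rho>" "y \<in> KC p0" "z \<in> KC p" "?rel p y z" for p y z
    unfolding \<Phi>_def by (rule the1_equality[OF ex1]) (use that in auto)
  have \<Psi>I: "\<Psi> p z = y" if "y \<in> KC p0" "?rel p y z" for p y z
    unfolding \<Psi>_def by (rule the_equality) (use that un2 in blast)+
  have \<Psi>: "\<Psi> p z \<in> KC p0" "?rel p (\<Psi> p z) z" if "p \<in> ball p0 \<rho>" "z \<in> KC p" for p z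
    using ex2[OF that] \<Psi>I by metis+
  have inv1: "\<Psi> p (\<Phi> p y) = y" if "p \<in> ball p0 \<rho>" "y \<in> KC p0" for p y
    by (rule \<Psi>I[OF that(2) \<Phi>(2)[OF that]])
  have inv2: "\<Phi> p (\<Psi> p z) = z" if "p \<in> ball p0 \<rho>" "z \<in> KC p" for p z
    by (rule \<Phi>I[OF that(1) \<Psi>(1)[OF that] that(2) \<Psi>(2)[OF that]])
  \<comment> \<open>The relation is closed in the parameter and both points, since it consists of
    non-strict inequalities between single iterates. Together with uniqueness this supplies the
    closed graphs of both maps.\<close>
  have limit_rel: "?rel p y z"
    if p: "\<xi> \<longlonglongrightarrow> p" "p \<in> ball p0 \<rho>" and y: "\<upsilon> \<longlonglongrightarrow> y" and z: "\<zeta> \<longlonglongrightarrow> z"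
      and r: "\<And>k. ?rel (\<xi> k) (\<upsilon> k) (\<zeta> k)" for \<xi> \<upsilon> \<zeta> :: "nat \<Rightarrow> complex \<times> complex" and p y z
  proof
    fix n
    have "(\<lambda>k. dist (orb (\<xi> k) (\<zeta> k) n) (orb p0 (\<upsilon> k) n)) \<longlonglongrightarrow> dist (orb p z n) (orb p0 y n)"
      by (intro tendsto_dist tendsto_orb p(1) z y tendsto_const a0 a[OF p(2)] eventually_fst_nz[OF p(1) a[OF p(2)]]
          always_eventually allI)
    then show "dist (orb p z n) (orb p0 y n) \<le> \<delta>" by (rule LIMSEQ_le_const2) (use r in auto)
  qed
  have cont\<Phi>: "continuous_on (ball p0 \<rho> \<times> KC p0) (\<lambda>py. \<Phi> (fst py) (snd py))"
  proof (rule continuous_on_via_KC[where q = fst])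
    fix \<xi> x l assume \<xi>: "\<And>k. \<xi> k \<in> ball p0 \<rho> \<times> KC p0" and x: "x \<in> ball p0 \<rho> \<times> KC p0"
      and lim: "\<xi> \<longlonglongrightarrow> x" "(\<lambda>k. \<Phi> (fst (\<xi> k)) (snd (\<xi> k))) \<longlonglongrightarrow> l"
    have m: "fst (\<xi> k) \<in> ball p0 \<rho>" "snd (\<xi> k) \<in> KC p0" for k using \<xi>[of k] by (simp_all add: mem_Times_iff)
    have mx: "fst x \<in> ball p0 \<rho>" "snd x \<in> KC p0" using x by (simp_all add: mem_Times_iff)
    have "l \<in> KC (fst x)"
      by (rule KC_limit[OF tendsto_fst[OF lim(1)] a[OF mx(1)] lim(2)]) (use \<Phi>(1) m in auto)
    moreover have "?rel (fst x) (snd x) l"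
      by (rule limit_rel[OF tendsto_fst[OF lim(1)] mx(1) tendsto_snd[OF lim(1)] lim(2)]) (use \<Phi>(2) m in auto)
    ultimately show "l = \<Phi> (fst x) (snd x)" using \<Phi>I[OF mx] by simp
  qed (use a \<Phi>(1) in \<open>auto intro: continuous_intros\<close>)
  have cont\<Psi>: "continuous_on (SIGMA p:ball p0 \<rho>. KC p) (\<lambda>pz. \<Psi> (fst pz) (snd pz))"
  proof (rule continuous_on_via_KC[where q = "\<lambda>_. p0"])
    fix \<xi> x l assume \<xi>: "\<And>k. \<xi> k \<in> (SIGMA p:ball p0 \<rho>. KC p)" and x: "x \<in> (SIGMA p:ball p0 \<rho>. KC p)"
      and lim: "\<xi> \<longlonglongrightarrow> x" "(\<lambda>k. \<Psi> (fst (\<xi> k)) (snd (\<xi> k))) \<longlonglongrightarrow> l"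
    have m: "fst (\<xi> k) \<in> ball p0 \<rho>" "snd (\<xi> k) \<in> KC (fst (\<xi> k))" for k using \<xi>[of k] by auto
    have mx: "fst x \<in> ball p0 \<rho>" "snd x \<in> KC (fst x)" using x by auto
    have "l \<in> KC p0"
      by (rule KC_limit[OF tendsto_const a0 lim(2)]) (use \<Psi>(1) m in auto)
    moreover have "?rel (fst x) l (snd x)"
      by (rule limit_rel[OF tendsto_fst[OF lim(1)] mx(1) lim(2) tendsto_snd[OF lim(1)]]) (use \<Psi>(2) m in auto)
    ultimately show "l = \<Psi> (fst x) (snd x)" using \<Psi>I by metis
  qed (use a0 \<Psi>(1) in \<open>auto intro: continuous_intros\<close>)
  have homeo: "homeomorphism (KC p0) (KC p) (\<Phi> p) (\<Psi> p)" if p: "p \<in> ball p0 \<rho>" for p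
  proof (rule homeomorphismI)
    show "continuous_on (KC p0) (\<Phi> p)"
    proof -
      have "continuous_on (KC p0) (\<lambda>y. (\<lambda>py. \<Phi> (fst py) (snd py)) (p, y))"
        by (rule continuous_on_compose2[OF cont\<Phi>]) (use p in \<open>auto intro!: continuous_intros\<close>)
      then show ?thesis by simp
    qed
    show "continuous_on (KC p) (\<Psi> p)"
    proof -
      have "continuous_on (KC p) (\<lambda>y. (\<lambda>py. \<Psi> (fst py) (snd py)) (p, y))"
        by (rule continuous_on_compose2[OF cont\<Psi>]) (use p in \<open>auto intro!: continuous_intros\<close>)
      then show ?thesis by simp
    qed
    show "\<Phi> p ` KC p0 \<subseteq> KC p" "\<Psi> p ` KC p \<subseteq> KC p0" using \<Phi>(1)[OF p] \<Psi>(1)[OF p] by blast+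
  qed (rule inv1[OF p], assumption, rule inv2[OF p], assumption)
  \<comment> \<open>Equivariance follows from uniqueness: applying both maps shifts the time index
    by one, and the relation quantifies over all times.\<close>
  have equi: "\<Phi> p (henon p0 y) = henon p (\<Phi> p y)" if p: "p \<in> ball p0 \<rho>" and y: "y \<in> KC p0" for p y
  proof (rule \<Phi>I[OF p henon_in_KC[OF a0 y] henon_in_KC[OF a[OF p] \<Phi>(1)[OF p y]]], rule allI)
    fix n
    have "orb q (henon q w) n = orb q w (1 + n)" if "fst q \<noteq> 0" for q w
      using orb_add[OF that, of w 1 n] orb_step[OF that, of w 0] by simp
    then show "dist (orb p (henon p (\<Phi> p y)) n) (orb p0 (henon p0 y) n) \<le> \<delta>"
      using a[OF p] a0 \<Phi>(2)[OF p y] by simp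
  qed
  have conj: "conjugacy (henon p0) (KC p0) (henon p) (KC p) (\<Phi> p)" if p: "p \<in> ball p0 \<rho>" for p
    by (rule conjugacyI[where k = "\<Psi> p"]) (use henon_in_KC[OF a0] henon_in_KC[OF a[OF p]] homeo[OF p] equi[OF p] in blast)+
  have conj': "conjugacy (henon p) (KC p) (henon p0) (KC p0) (\<Psi> p)" if p: "p \<in> ball p0 \<rho>" for p
  proof (rule conjugacy_cong[OF conjugacy_inverse[OF conj[OF p]]])
    show "\<Psi> p z = inv_into (KC p0) (\<Phi> p) z" if "z \<in> KC p" for z
      using inv_into_eqI[OF conj[OF p] \<Psi>(1)[OF p that] inv2[OF p that]] by simp
  qed
  have "ball p0 \<rho> \<subseteq> HC"
  proof
    fix p assume p: "p \<in> ball p0 \<rho>"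
    have "dichotomous (2 * M) p"
      by (rule dichotomous_perturb[OF a0 a[OF p] D \<delta>_def \<eta>[OF p] ex2[OF p]])
    then show "p \<in> HC" unfolding HC_iff
      using a[OF p] conjugacy_compose[OF conj'[OF p] h] by blast
  qed
  moreover have "continuous_on (ball p0 \<rho>) (\<lambda>p. \<Phi> p y)" if "y \<in> KC p0" for y
  proof -
    have "continuous_on (ball p0 \<rho>) (\<lambda>p. (\<lambda>py. \<Phi> (fst py) (snd py)) (p, y))"
      by (rule continuous_on_compose2[OF cont\<Phi>]) (use that in \<open>auto intro!: continuous_intros\<close>)
    then show ?thesis by simp
  qed
  moreover have "continuous_on (SIGMA p:ball p0 \<rho>. KC p) (\<lambda>(p, z). \<Psi> p z)"
    using cont\<Psi> by (simp add: case_prod_unfold)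
  ultimately show thesis using that[OF \<rho>0 _ conj conj' inv1 inv2] by blast
qed

lemma open_HC: "open HC"
  unfolding open_contains_ball
proof
  fix p assume p: "p \<in> HC"
  show "\<exists>e>0. ball p e \<subseteq> HC"
  proof (rule local_trivialisation[OF p])
    fix \<rho> assume "\<rho> > 0" "ball p \<rho> \<subseteq> HC"
    then show "\<exists>e>0. ball p e \<subseteq> HC" by blast
  qed
qed

section \<open>Real parameters and complex conjugation\<close>

lemma sqrt5_gt_2: "sqrt 5 > 2"
  by (rule real_less_rsqrt) simp

lemma DN_subset_HOV: "DN \<subseteq> HOV"
proof
  fix p assume "p \<in> DN"
  then obtain a c where p: "p = (a, c)" and a: "a \<in> \<real>" "a \<noteq> 0" and c: "c \<in> \<real>"
    and lt: "Re c < - (5 + 2 * sqrt 5) * (\<bar>Re a\<bar> + 1)\<^sup>2 / 4"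
    by (auto simp: DN_def)
  have na: "cmod a = \<bar>Re a\<bar>" and nc: "cmod c = \<bar>Re c\<bar>"
    using a c by (auto simp: in_Reals_norm)
  have "2 * (\<bar>Re a\<bar> + 1)\<^sup>2 \<le> (5 + 2 * sqrt 5) / 4 * (\<bar>Re a\<bar> + 1)\<^sup>2"
    using sqrt5_gt_2 by (intro mult_right_mono) auto
  also have "\<dots> < - Re c" using lt by (simp add: field_simps)
  also have "\<dots> \<le> cmod c" unfolding nc by simp
  finally show "p \<in> HOV" using a(2) by (simp add: p HOV_def na)
qed

lemma DN_nonempty: "DN \<noteq> {}"
proof -
  have "sqrt 5 \<le> 5" by (rule real_le_lsqrt) simp_all
  then have "(1, - 100) \<in> DN" by (auto simp: DN_def)
  then show ?thesis by blast
qed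

lemma HOV_nonempty: "HOV \<noteq> {}"
proof
  assume "HOV = {}"
  with DN_subset_HOV have "DN = {}" by simp
  with DN_nonempty show False by (rule notE)
qed

text \<open>On a bounded orbit \<open>\<bar>Re x\<bar>\<close> exceeds half of \<open>1 + \<bar>a\<bar>\<close>: this is where the constant
  \<open>(5 + 2 * sqrt 5) / 4\<close> comes from. The imaginary part of \<open>x\<^sup>2 = x' - c + a * x''\<close> then makes
  the supremum of \<open>\<bar>Im x\<bar>\<close> contract.\<close>

lemma KC_DN_real:
  assumes p: "p \<in> DN"
  shows "KC p \<subseteq> R2"
proof
  fix z assume z: "z \<in> KC p"
  obtain a c where pe: "p = (a, c)" by (cases p)
  have a: "a \<in> \<real>" "a \<noteq> 0" and c: "c \<in> \<real>"
    and lt: "Re c < - (5 + 2 * sqrt 5) * (\<bar>Re a\<bar> + 1)\<^sup>2 / 4"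
    using p by (auto simp: DN_def pe)
  have fp: "fst p \<noteq> 0" using a by (simp add: pe)
  define m where "m = 1 + \<bar>Re a\<bar>"
  define \<gamma> where "\<gamma> = - Re c"
  have m: "m \<ge> 1" by (simp add: m_def)
  have \<gamma>: "\<gamma> > (5 + 2 * sqrt 5) / 4 * m\<^sup>2" using lt by (simp add: \<gamma>_def m_def add.commute field_simps)
  have \<gamma>0: "\<gamma> > 0" by (rule order_le_less_trans[OF _ \<gamma>]) simp
  have na: "cmod a = \<bar>Re a\<bar>" and nc: "cmod c = \<gamma>"
    using a c \<gamma>0 by (auto simp: in_Reals_norm \<gamma>_def)
  have Im0: "Im a = 0" "Im c = 0" using a c by (auto simp: complex_is_Real_iff)
  obtain S where S: "S \<ge> 0" "\<And>n. norm (fst (orb p z n)) \<le> S"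
    "S\<^sup>2 \<le> norm (snd p) + (1 + norm (fst p)) * S"
    using orb_sup[OF fp z] by blast
  have SS: "S\<^sup>2 \<le> \<gamma> + m * S" using S(3) by (simp add: pe na nc m_def)
  have margin: "\<gamma> - m * S > m\<^sup>2 / 4"
  proof (rule ccontr)
    assume neg: "\<not> \<gamma> - m * S > m\<^sup>2 / 4"
    \<comment> \<open>In terms of \<open>T\<close> the quadratic bound for \<open>S\<close> reads
      \<open>T\<^sup>2 - m\<^sup>2 * T \<le> m\<^sup>2 * \<gamma>\<close>. Its left side increases
      for \<open>T \<ge> m\<^sup>2 / 2\<close>, so \<open>T \<ge> u\<close> would give the same
      inequality for \<open>u\<close>.\<close>
    define T where "T = m * S"
    define u where "u = \<gamma> - m\<^sup>2 / 4"
    have Tu: "T \<ge> u" using neg by (simp add: T_def u_def)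
    have "m\<^sup>2 * 2 \<le> (5 + 2 * sqrt 5) / 4 * m\<^sup>2" using sqrt5_gt_2
      by (subst mult.commute, intro mult_right_mono) auto
    then have u2: "u \<ge> m\<^sup>2" using \<gamma> zero_le_power2[of m] unfolding u_def by linarith
    have "m\<^sup>2 * S\<^sup>2 \<le> m\<^sup>2 * (\<gamma> + m * S)" by (intro mult_left_mono SS) simp
    then have 1: "T\<^sup>2 \<le> m\<^sup>2 * \<gamma> + m\<^sup>2 * T" by (simp add: T_def power_mult_distrib algebra_simps)
    have "(T - u) * (T + u - m\<^sup>2) \<ge> 0" using Tu u2 zero_le_power2[of m] by (intro mult_nonneg_nonneg; linarith)
    then have 2: "u\<^sup>2 - m\<^sup>2 * u \<le> T\<^sup>2 - m\<^sup>2 * T" by (simp add: algebra_simps power2_eq_square)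
    \<comment> \<open>\<open>u\<^sup>2 - m\<^sup>2 * u - m\<^sup>2 * \<gamma>\<close> is a quadratic
      polynomial in \<open>\<gamma>\<close> with roots
      \<open>(5 - 2 * sqrt 5) / 4 * m\<^sup>2\<close> and
      \<open>(5 + 2 * sqrt 5) / 4 * m\<^sup>2\<close>. Beyond the larger root, the threshold of
      \<open>DN\<close>, it is positive.\<close>
    have "\<gamma> > (5 - 2 * sqrt 5) / 4 * m\<^sup>2"
      by (rule order_le_less_trans[OF _ \<gamma>]) (intro mult_right_mono, auto)
    then have "(\<gamma> - (5 + 2 * sqrt 5) / 4 * m\<^sup>2) * (\<gamma> - (5 - 2 * sqrt 5) / 4 * m\<^sup>2) > 0"
      using \<gamma> by simp
    also have "(\<gamma> - (5 + 2 * sqrt 5) / 4 * m\<^sup>2) * (\<gamma> - (5 - 2 * sqrt 5) / 4 * m\<^sup>2) =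
        \<gamma>\<^sup>2 - 5 / 2 * m\<^sup>2 * \<gamma> + (25 - 4 * (sqrt 5)\<^sup>2) / 16 * (m\<^sup>2)\<^sup>2"
      by (simp add: field_simps power2_eq_square)
    also have "\<dots> = u\<^sup>2 - m\<^sup>2 * u - m\<^sup>2 * \<gamma>"
      by (simp add: u_def field_simps power2_eq_square)
    finally show False using 1 2 by simp
  qed
  define x where "x n = fst (orb p z n)" for n
  have snd: "snd (orb p z n) = x (n - 1)" for n
    using orb_step[OF fp, of z "n - 1"] by (simp add: x_def henon_eq)
  have rec: "(x n)\<^sup>2 = x (n + 1) - c + a * x (n - 1)" for n
  proof -
    have "x (n + 1) = (x n)\<^sup>2 + snd p - fst p * x (n - 1)"
      unfolding x_def[of "n + 1"] orb_step[OF fp] by (simp add: henon_eq snd x_def)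
    then show ?thesis by (simp add: pe)
  qed
  have xS: "\<bar>Re (x n)\<bar> \<le> S" "\<bar>Im (x n)\<bar> \<le> S" for n
    using S(2)[of n] abs_Re_le_cmod[of "x n"] abs_Im_le_cmod[of "x n"] by (auto simp: x_def)
  define \<omega> where "\<omega> = sqrt (\<gamma> - m * S)"
  have \<omega>: "\<omega> > m / 2"
    unfolding \<omega>_def using margin by (intro real_less_rsqrt) (simp add: power_divide)
  have Re: "\<bar>Re (x n)\<bar> \<ge> \<omega>" for n
  proof -
    have "(Re (x n))\<^sup>2 - (Im (x n))\<^sup>2 = Re (x (n + 1)) + \<gamma> + Re a * Re (x (n - 1))"
      using arg_cong[OF rec[of n], of Re] Im0 by (simp add: Re_power2 \<gamma>_def)
    moreover have "\<bar>Re a * Re (x (n - 1))\<bar> \<le> \<bar>Re a\<bar> * S"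
      unfolding abs_mult by (intro mult_left_mono xS) simp
    moreover have "m * S = S + \<bar>Re a\<bar> * S" by (simp add: m_def algebra_simps)
    moreover have "(Im (x n))\<^sup>2 \<ge> 0" by simp
    ultimately have "(Re (x n))\<^sup>2 \<ge> \<gamma> - m * S" using xS(1)[of "n + 1"] by linarith
    then have "sqrt (\<gamma> - m * S) \<le> sqrt ((Re (x n))\<^sup>2)" by (rule real_sqrt_le_mono)
    then show ?thesis by (simp add: \<omega>_def)
  qed
  define r where "r = m / (2 * \<omega>)"
  have r: "0 \<le> r" "r < 1" using \<omega> m by (auto simp: r_def)
  have contract: "\<forall>n. \<bar>Im (x n)\<bar> \<le> r * Y" if Y: "\<forall>n. \<bar>Im (x n)\<bar> \<le> Y" for Y
  proof
    fix n
    have "2 * Re (x n) * Im (x n) = Im (x (n + 1)) + Re a * Im (x (n - 1))"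
      using arg_cong[OF rec[of n], of Im] Im0 by (simp add: Im_power2)
    then have "2 * \<bar>Re (x n)\<bar> * \<bar>Im (x n)\<bar> = \<bar>Im (x (n + 1)) + Re a * Im (x (n - 1))\<bar>"
      by (metis abs_mult abs_numeral)
    also have "\<dots> \<le> \<bar>Im (x (n + 1))\<bar> + \<bar>Re a\<bar> * \<bar>Im (x (n - 1))\<bar>"
      by (metis abs_mult abs_triangle_ineq)
    also have "\<dots> \<le> Y + \<bar>Re a\<bar> * Y" using Y by (intro add_mono mult_left_mono) auto
    also have "\<dots> = m * Y" by (simp add: m_def algebra_simps)
    finally have "2 * \<bar>Re (x n)\<bar> * \<bar>Im (x n)\<bar> \<le> m * Y" .
    moreover have "2 * \<omega> * \<bar>Im (x n)\<bar> \<le> 2 * \<bar>Re (x n)\<bar> * \<bar>Im (x n)\<bar>"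
      using Re[of n] by (intro mult_right_mono mult_left_mono) auto
    ultimately have "2 * \<omega> * \<bar>Im (x n)\<bar> \<le> m * Y" by linarith
    then show "\<bar>Im (x n)\<bar> \<le> r * Y" using \<omega> m by (simp add: r_def field_simps)
  qed
  have "\<forall>n. \<bar>Im (x n)\<bar> \<le> r ^ k * S" for k
  proof (induction k)
    case 0 show ?case using xS by simp
  next
    case (Suc k) then show ?case using contract[OF Suc] by (simp add: mult.assoc)
  qed
  then have "\<bar>Im (x n)\<bar> \<le> 0" for n
  proof (intro LIMSEQ_le_const)
    show "(\<lambda>k. r ^ k * S) \<longlonglongrightarrow> 0"
      using tendsto_mult_right[OF LIMSEQ_realpow_zero[OF r], of S] by simp
  qed blast
  then have "Im (x n) = 0" for n by simp
  moreover have "fst z = x 0" "snd z = x (- 1)" using snd[of 0] by (simp_all add: x_def)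
  ultimately have "fst z \<in> \<real>" "snd z \<in> \<real>" by (simp_all add: complex_is_Real_iff)
  then show "z \<in> R2" by (simp add: R2_def mem_Times_iff)
qed

section \<open>Complex conjugation of orbits and parameters\<close>

lemma conj2_conj2 [simp]: "conj2 (conj2 z) = z"
  by (cases z) (simp add: conj2_def)

lemma conj2_eq: "conj2 z = (cnj (fst z), cnj (snd z))"
  by (simp add: conj2_def case_prod_unfold)

lemma conj2_fixed_iff: "conj2 z = z \<longleftrightarrow> z \<in> R2"
  by (cases z) (auto simp: conj2_eq R2_def Reals_cnj_iff)

lemma norm_conj2 [simp]: "norm (conj2 z) = norm z"
  by (cases z) (simp add: conj2_eq norm_Pair)

lemma conj2_add: "conj2 (u + v) = conj2 u + conj2 v"
  by (simp add: conj2_eq)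

lemma continuous_on_conj2: "continuous_on X conj2"
  unfolding conj2_def case_prod_unfold by (intro continuous_intros)

lemma henon_conj2: "henon (conj2 p) (conj2 z) = conj2 (henon p z)"
  by (simp add: henon_eq conj2_eq)

lemma henon_deriv_conj2: "henon_deriv (conj2 p) (conj2 z) (conj2 v) = conj2 (henon_deriv p z v)"
  by (simp add: henon_deriv_def conj2_eq)

lemma fst_conj2: "fst (conj2 p) = cnj (fst p)"
  by (simp add: conj2_eq)

lemma orb_conj2:
  assumes "fst p \<noteq> 0"
  shows "orb (conj2 p) (conj2 z) n = conj2 (orb p z n)"
  using orb_unique[of "conj2 p" "\<lambda>n. conj2 (orb p z n)" n] assms
  by (simp add: fst_conj2 orb_step[OF assms] henon_conj2)

lemma KC_conj2_I:
  assumes "fst p \<noteq> 0" "z \<in> KC p"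
  shows "conj2 z \<in> KC (conj2 p)"
  using assms by (simp add: KC_iff bounded_iff orb_conj2)

lemma conjugacy_conj2:
  assumes "fst p \<noteq> 0"
  shows "conjugacy (henon p) (KC p) (henon (conj2 p)) (KC (conj2 p)) conj2"
proof (rule conjugacyI)
  have "conj2 z \<in> KC p" if "z \<in> KC (conj2 p)" for z
    using KC_conj2_I[of "conj2 p" z] that assms by (simp add: fst_conj2)
  then show "homeomorphism (KC p) (KC (conj2 p)) conj2 conj2"
    using KC_conj2_I[OF assms] by (intro homeomorphismI continuous_on_conj2) auto
  show "henon p ` KC p \<subseteq> KC p" "henon (conj2 p) ` KC (conj2 p) \<subseteq> KC (conj2 p)"
    using henon_in_KC[of p] henon_in_KC[of "conj2 p"] assms unfolding fst_conj2 complex_cnj_zero_iff by blast+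
qed (simp add: henon_conj2)

lemma dichotomous_conj2:
  assumes a: "fst p \<noteq> 0" and D: "dichotomous M p"
  shows "dichotomous M (conj2 p)"
  unfolding dichotomous_def
proof (intro conjI ballI)
  show "M > 0" using D by (simp add: dichotomous_def)
  fix z assume z: "z \<in> KC (conj2 p)"
  have "conj2 z \<in> KC p" using KC_conj2_I[of "conj2 p" z] z a by (simp add: fst_conj2)
  then have Dz: "dichotomy M (\<lambda>n. henon_deriv p (orb p (conj2 z) n))" using D by (simp add: dichotomous_def)
  have A: "henon_deriv (conj2 p) (orb (conj2 p) z n) v = conj2 (henon_deriv p (orb p (conj2 z) n) (conj2 v))" for n v
    using orb_conj2[OF a, of "conj2 z" n] henon_deriv_conj2[of p "orb p (conj2 z) n" "conj2 v"] by simp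
  show "dichotomy M (\<lambda>n. henon_deriv (conj2 p) (orb (conj2 p) z n))"
    unfolding dichotomy_def
  proof (intro conjI allI impI)
    show "M > 0" using D by (simp add: dichotomous_def)
    show "linear (henon_deriv (conj2 p) (orb (conj2 p) z n))" for n by (rule linear_henon_deriv)
  next
    fix W :: "int \<Rightarrow> complex \<times> complex" and r assume W: "\<forall>n. norm (W n) \<le> r"
    have W': "norm (conj2 (W n)) \<le> r" for n using W by simp
    obtain V where V: "\<And>n. norm (V n) \<le> M * r"
      "\<And>n. V (n + 1) = henon_deriv p (orb p (conj2 z) n) (V n) + conj2 (W n)"
      using dichotomy_solution[OF Dz, of "\<lambda>n. conj2 (W n)", OF W'] by blast
    show "\<exists>V. (\<forall>n. norm (V n) \<le> M * r) \<and>
        (\<forall>n. V (n + 1) = henon_deriv (conj2 p) (orb (conj2 p) z n) (V n) + W n)"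
      by (rule exI[of _ "\<lambda>n. conj2 (V n)"]) (simp add: V conj2_add A)
  next
    fix V :: "int \<Rightarrow> complex \<times> complex" and B n
    assume V: "(\<forall>n. norm (V n) \<le> B) \<and> (\<forall>n. V (n + 1) = henon_deriv (conj2 p) (orb (conj2 p) z n) (V n))"
    have "conj2 (V n) = 0"
    proof (rule dichotomy_zero[OF Dz, where V = "\<lambda>n. conj2 (V n)"])
      show "norm (conj2 (V n)) \<le> B" for n using V by simp
      show "conj2 (V (n + 1)) = henon_deriv p (orb p (conj2 z) n) (conj2 (V n))" for n
        using V by (simp add: A)
    qed
    then show "V n = 0" by (metis norm_conj2 norm_eq_zero)
  qed
qed

lemma conj2_HC:
  assumes "p \<in> HC"
  shows "conj2 p \<in> HC"
proof -
  obtain M h where a: "fst p \<noteq> 0" and D: "dichotomous M p" and h: "conjugacy (henon p) (KC p) shift UNIV h"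
    using assms by (auto simp: HC_iff)
  have "conjugacy (henon (conj2 p)) (KC (conj2 p)) shift UNIV (h \<circ> inv_into (KC p) conj2)"
    by (rule conjugacy_compose[OF conjugacy_inverse[OF conjugacy_conj2[OF a]] h])
  with dichotomous_conj2[OF a D] a show ?thesis unfolding HC_iff by (auto simp: fst_conj2)
qed

text \<open>A point of \<open>HC0\<close> provides a component of \<open>HC\<close> containing
  \<open>HOV\<close>, and with it the inclusion of \<open>HOV\<close> in \<open>HC\<close>;
  nonemptiness of \<open>HOV\<close> makes that component unique.\<close>

lemma HC0_component:
  assumes "p \<in> HC0"
  shows "HC0 \<in> components HC" "HOV \<subseteq> HC0"
proof -
  obtain C where C: "C \<in> components HC" "HOV \<subseteq> C" using assms by (auto simp: HC0_def)
  have "C' = C" if "C' \<in> components HC" "HOV \<subseteq> C'" for C'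
    using components_nonoverlap[OF that(1) C(1)] HOV_nonempty that(2) C(2) by blast
  then have "{C \<in> components HC. HOV \<subseteq> C} = {C}" using C by blast
  then have "HC0 = C" by (simp add: HC0_def)
  then show "HC0 \<in> components HC" "HOV \<subseteq> HC0" using C by simp_all
qed

lemma HC0_subset_HC: "HC0 \<subseteq> HC"
  using in_components_subset by (auto simp: HC0_def)

lemma path_connected_HC0: "path_connected HC0"
proof (cases "HC0 = {}")
  case False
  then have "HC0 \<in> components HC" using HC0_component by blast
  then show ?thesis
    by (intro connected_open_path_connected open_components[OF open_HC] in_components_connected)
qed simp

text \<open>Conjugation fixes the points of \<open>DN\<close>, which lie in \<open>HC0\<close>. The
  image of \<open>HC0\<close> is thus a connected subset of \<open>HC\<close> meeting
  \<open>HC0\<close>, and maximality of components absorbs it.\<close>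

lemma conj2_HC0:
  assumes "p \<in> HC0"
  shows "conj2 p \<in> HC0"
proof -
  have "conj2 ` HC0 \<subseteq> HC0"
  proof (rule components_maximal[OF HC0_component(1)[OF assms]])
    show "connected (conj2 ` HC0)"
      by (intro connected_continuous_image continuous_on_conj2 path_connected_imp_connected path_connected_HC0)
    show "conj2 ` HC0 \<subseteq> HC" using conj2_HC HC0_subset_HC by blast
    obtain b where b: "b \<in> DN" using DN_nonempty by blast
    have "conj2 b = b" using b by (auto simp: conj2_fixed_iff R2_def DN_def)
    moreover have "b \<in> HC0" using b DN_subset_HOV HC0_component(2)[OF assms] by blast
    ultimately show "HC0 \<inter> conj2 ` HC0 \<noteq> {}" by (metis IntI empty_iff imageI)
  qed
  then show ?thesis using assms by blast
qed

section \<open>Continuation of conjugacies along paths\<close>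

text \<open>\<open>continuous_conjugacies\<close> over an arbitrary time interval, so that families
  can be restricted and glued.\<close>

definition conj_family ::
  "(real \<Rightarrow> complex \<times> complex) \<Rightarrow> real \<Rightarrow> real \<Rightarrow> (real \<Rightarrow> complex \<times> complex \<Rightarrow> bisequence) \<Rightarrow> bool"
where
  "conj_family \<gamma> u v h \<longleftrightarrow>
     (\<forall>t\<in>{u..v}. conjugacy (henon (\<gamma> t)) (KC (\<gamma> t)) shift UNIV (h t)) \<and>
     (\<forall>s. continuous_on {u..v} (\<lambda>t. inv_into (KC (\<gamma> t)) (h t) s))"

lemma continuous_conjugacies_eq: "continuous_conjugacies \<gamma> h \<longleftrightarrow> conj_family \<gamma> 0 1 h"
  by (simp add: continuous_conjugacies_def conj_family_def)

lemma conj_family_conjugacy: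
  "conj_family \<gamma> u v h \<Longrightarrow> t \<in> {u..v} \<Longrightarrow> conjugacy (henon (\<gamma> t)) (KC (\<gamma> t)) shift UNIV (h t)"
  by (simp add: conj_family_def)

lemma conj_family_continuous:
  "conj_family \<gamma> u v h \<Longrightarrow> continuous_on {u..v} (\<lambda>t. inv_into (KC (\<gamma> t)) (h t) s)"
  by (simp add: conj_family_def)

lemma conj_family_subset:
  assumes "conj_family \<gamma> u v h" "{u'..v'} \<subseteq> {u..v}"
  shows "conj_family \<gamma> u' v' h"
  unfolding conj_family_def
  using conj_family_conjugacy[OF assms(1)] continuous_on_subset[OF conj_family_continuous[OF assms(1)] assms(2)] assms(2)
  by blast

lemma inv_into_conjugacy_cong:
  assumes h: "conjugacy f X g UNIV h" and eq: "\<And>x. x \<in> X \<Longrightarrow> h' x = h x"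
  shows "inv_into X h' s = inv_into X h s"
  by (rule inv_into_eqI[OF conjugacy_cong[OF h eq] conjugacyD(6)[OF h UNIV_I]])
     (simp_all add: eq conjugacyD(6,7)[OF h])

text \<open>Each coordinate is a continuous map from an interval to a discrete space;
  \<open>of_bool\<close> turns it into a real function with finite range.\<close>

lemma continuous_bisequence_constant:
  fixes f :: "real \<Rightarrow> bisequence"
  assumes "continuous_on {u..v} f" "u \<le> v"
  shows "f u = f v"
proof
  fix i
  have "continuous_on {u..v} (\<lambda>t. f t i)"
    by (rule continuous_on_product_then_coordinatewise[OF assms(1)])
  then have c: "continuous_on {u..v} (\<lambda>t. of_bool (f t i) :: real)"
    using continuous_on_compose2[of UNIV of_bool "{u..v}" "\<lambda>t. f t i"] by simp
  have "finite ((\<lambda>t. of_bool (f t i) :: real) ` {u..v})"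
    by (rule finite_subset[of _ "{0, 1}"]) auto
  from continuous_finite_range_constant[OF _ c this]
  obtain y :: real where "\<forall>t\<in>{u..v}. of_bool (f t i) = y" by (auto simp: constant_on_def)
  then have "of_bool (f u i) = y" "of_bool (f v i) = y" using assms(2) by simp_all
  then show "f u i = f v i" by (metis of_bool_eq_iff)
qed

text \<open>In the trivialisation over a ball, a continuous family of conjugacies moves the point with a
  given itinerary continuously inside the Cantor set \<open>KC p0\<close>, hence not at all.\<close>

lemma local_continuation:
  assumes p0: "p0 \<in> HC"
  obtains \<rho> where "\<rho> > 0"
    "\<And>\<gamma> u v g. u \<le> v \<Longrightarrow> continuous_on {u..v} \<gamma> \<Longrightarrow> \<gamma> ` {u..v} \<subseteq> ball p0 \<rho> \<Longrightarrow>
      conjugacy (henon (\<gamma> u)) (KC (\<gamma> u)) shift UNIV g \<Longrightarrow>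
      \<exists>h. conj_family \<gamma> u v h \<and> (\<forall>z\<in>KC (\<gamma> u). h u z = g z)"
    "\<And>\<gamma> u v h h'. u \<le> v \<Longrightarrow> continuous_on {u..v} \<gamma> \<Longrightarrow> \<gamma> ` {u..v} \<subseteq> ball p0 \<rho> \<Longrightarrow>
      conj_family \<gamma> u v h \<Longrightarrow> conj_family \<gamma> u v h' \<Longrightarrow> (\<And>z. z \<in> KC (\<gamma> u) \<Longrightarrow> h u z = h' u z) \<Longrightarrow>
      (\<forall>z\<in>KC (\<gamma> v). h v z = h' v z)"
proof (rule local_trivialisation[OF p0])
  fix \<rho> \<Phi> \<Psi>
  assume \<rho>: "\<rho> > 0" and "ball p0 \<rho> \<subseteq> HC"
    and c\<Phi>: "\<And>p. p \<in> ball p0 \<rho> \<Longrightarrow> conjugacy (henon p0) (KC p0) (henon p) (KC p) (\<Phi> p)"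
    and c\<Psi>: "\<And>p. p \<in> ball p0 \<rho> \<Longrightarrow> conjugacy (henon p) (KC p) (henon p0) (KC p0) (\<Psi> p)"
    and inv1: "\<And>p y. p \<in> ball p0 \<rho> \<Longrightarrow> y \<in> KC p0 \<Longrightarrow> \<Psi> p (\<Phi> p y) = y"
    and inv2: "\<And>p z. p \<in> ball p0 \<rho> \<Longrightarrow> z \<in> KC p \<Longrightarrow> \<Phi> p (\<Psi> p z) = z"
    and cont\<Phi>: "\<And>y. y \<in> KC p0 \<Longrightarrow> continuous_on (ball p0 \<rho>) (\<lambda>p. \<Phi> p y)"
    and cont\<Psi>: "continuous_on (SIGMA p:ball p0 \<rho>. KC p) (\<lambda>(p, z). \<Psi> p z)"
  obtain k where k: "conjugacy (henon p0) (KC p0) shift UNIV k" using p0 by (auto simp: HC_iff)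
  show thesis
  proof (rule that[OF \<rho>])
    fix \<gamma> :: "real \<Rightarrow> complex \<times> complex" and u v g
    assume uv: "u \<le> v" and cont: "continuous_on {u..v} \<gamma>" and im: "\<gamma> ` {u..v} \<subseteq> ball p0 \<rho>"
      and g: "conjugacy (henon (\<gamma> u)) (KC (\<gamma> u)) shift UNIV g"
    have ball: "\<gamma> t \<in> ball p0 \<rho>" if "t \<in> {u..v}" for t using im that by blast
    have u: "\<gamma> u \<in> ball p0 \<rho>" by (rule ball) (use uv in simp)
    \<comment> \<open>Transport back to time \<open>u\<close> through the fixed fibre
      \<open>KC p0\<close>, followed by \<open>g\<close>. The point with itinerary \<open>s\<close>
      then has a constant coordinate \<open>y\<close> in \<open>KC p0\<close> and moves as
      \<open>\<Phi> (\<gamma> t) y\<close>.\<close>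
    let ?h = "\<lambda>t. g \<circ> \<Phi> (\<gamma> u) \<circ> \<Psi> (\<gamma> t)"
    have conj: "conjugacy (henon (\<gamma> t)) (KC (\<gamma> t)) shift UNIV (?h t)" if "t \<in> {u..v}" for t
      using conjugacy_compose[OF conjugacy_compose[OF c\<Psi>[OF ball[OF that]] c\<Phi>[OF u]] g]
      by (simp add: o_assoc)
    have "continuous_on {u..v} (\<lambda>t. inv_into (KC (\<gamma> t)) (?h t) s)" for s
    proof -
      define w where "w = inv_into (KC (\<gamma> u)) g s"
      have w: "w \<in> KC (\<gamma> u)" "g w = s" unfolding w_def by (rule conjugacyD(6,7)[OF g UNIV_I])+
      define y where "y = \<Psi> (\<gamma> u) w"
      have y: "y \<in> KC p0" "\<Phi> (\<gamma> u) y = w" using conjugacyD(1)[OF c\<Psi>[OF u] w(1)] inv2[OF u w(1)] by (simp_all add: y_def)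
      have "inv_into (KC (\<gamma> t)) (?h t) s = \<Phi> (\<gamma> t) y" if t: "t \<in> {u..v}" for t
        by (rule inv_into_eqI[OF conj[OF t] conjugacyD(1)[OF c\<Phi>[OF ball[OF t]] y(1)]])
           (simp add: inv1[OF ball[OF t] y(1)] y(2) w(2))
      then show ?thesis
        by (intro continuous_on_eq[OF continuous_on_compose2[OF cont\<Phi>[OF y(1)] cont im]]) simp
    qed
    then have "conj_family \<gamma> u v ?h" using conj unfolding conj_family_def by blast
    moreover have "\<forall>z\<in>KC (\<gamma> u). ?h u z = g z" using inv2[OF u] by simp
    ultimately show "\<exists>h. conj_family \<gamma> u v h \<and> (\<forall>z\<in>KC (\<gamma> u). h u z = g z)"
      by (intro exI[of _ ?h] conjI)
  next
    fix \<gamma> :: "real \<Rightarrow> complex \<times> complex" and u v h h'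
    assume uv: "u \<le> v" and cont: "continuous_on {u..v} \<gamma>" and im: "\<gamma> ` {u..v} \<subseteq> ball p0 \<rho>"
      and h: "conj_family \<gamma> u v h" and h': "conj_family \<gamma> u v h'"
      and eq: "\<And>z. z \<in> KC (\<gamma> u) \<Longrightarrow> h u z = h' u z"
    have ball: "\<gamma> t \<in> ball p0 \<rho>" if "t \<in> {u..v}" for t using im that by blast
    have u: "u \<in> {u..v}" and v: "v \<in> {u..v}" using uv by simp_all
    define \<zeta> where "\<zeta> h t s = inv_into (KC (\<gamma> t)) (h t) s" for h :: "real \<Rightarrow> complex \<times> complex \<Rightarrow> bisequence" and t s
    have \<zeta>K: "\<zeta> h t s \<in> KC (\<gamma> t)" "h t (\<zeta> h t s) = s" if "conj_family \<gamma> u v h" "t \<in> {u..v}" for h t s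
      unfolding \<zeta>_def by (rule conjugacyD(6,7)[OF conj_family_conjugacy[OF that] UNIV_I])+
    have const: "\<Psi> (\<gamma> u) (\<zeta> h u s) = \<Psi> (\<gamma> v) (\<zeta> h v s)" if h: "conj_family \<gamma> u v h" for h s
    proof -
      have c1: "continuous_on {u..v} (\<lambda>t. (\<gamma> t, \<zeta> h t s))"
        unfolding \<zeta>_def by (intro continuous_on_Pair cont conj_family_continuous[OF h])
      have "continuous_on {u..v} (\<lambda>t. (\<lambda>(p, z). \<Psi> p z) (\<gamma> t, \<zeta> h t s))"
        by (rule continuous_on_compose2[OF cont\<Psi> c1]) (use ball \<zeta>K(1)[OF h] in auto)
      then have c2: "continuous_on {u..v} (\<lambda>t. \<Psi> (\<gamma> t) (\<zeta> h t s))" by simp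
      have K: "\<Psi> (\<gamma> t) (\<zeta> h t s) \<in> KC p0" if "t \<in> {u..v}" for t
        by (rule conjugacyD(1)[OF c\<Psi>[OF ball[OF that]] \<zeta>K(1)[OF h that]])
      have "continuous_on {u..v} (\<lambda>t. k (\<Psi> (\<gamma> t) (\<zeta> h t s)))"
        by (rule continuous_on_compose2[OF conjugacyD(4)[OF k] c2]) (use K in blast)
      then have "k (\<Psi> (\<gamma> u) (\<zeta> h u s)) = k (\<Psi> (\<gamma> v) (\<zeta> h v s))"
        using uv by (rule continuous_bisequence_constant)
      then have "inv_into (KC p0) k (k (\<Psi> (\<gamma> u) (\<zeta> h u s))) = inv_into (KC p0) k (k (\<Psi> (\<gamma> v) (\<zeta> h v s)))"
        by (rule arg_cong)
      then show ?thesis unfolding conjugacyD(8)[OF k K[OF u]] conjugacyD(8)[OF k K[OF v]] .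
    qed
    have same: "\<zeta> h v s = \<zeta> h' v s" for s
    proof -
      have "\<zeta> h u s = \<zeta> h' u s"
        unfolding \<zeta>_def by (rule inv_into_conjugacy_cong[OF conj_family_conjugacy[OF h' u] eq])
      then have "\<Psi> (\<gamma> v) (\<zeta> h v s) = \<Psi> (\<gamma> v) (\<zeta> h' v s)"
        using const[OF h, of s] const[OF h', of s] by simp
      then have "\<Phi> (\<gamma> v) (\<Psi> (\<gamma> v) (\<zeta> h v s)) = \<Phi> (\<gamma> v) (\<Psi> (\<gamma> v) (\<zeta> h' v s))" by (rule arg_cong)
      then show ?thesis unfolding inv2[OF ball[OF v] \<zeta>K(1)[OF h v]] inv2[OF ball[OF v] \<zeta>K(1)[OF h' v]] .
    qed
    show "\<forall>z\<in>KC (\<gamma> v). h v z = h' v z"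
    proof
      fix z assume z: "z \<in> KC (\<gamma> v)"
      have "\<zeta> h v (h v z) = z" unfolding \<zeta>_def by (rule conjugacyD(8)[OF conj_family_conjugacy[OF h v] z])
      then show "h v z = h' v z" using same[of "h v z"] \<zeta>K(2)[OF h' v, of "h v z"] by simp
    qed
  qed
qed

lemma conj_family_glue:
  assumes h: "conj_family \<gamma> u v h" and h': "conj_family \<gamma> v w h'" and uvw: "u \<le> v" "v \<le> w"
    and eq: "\<And>z. z \<in> KC (\<gamma> v) \<Longrightarrow> h' v z = h v z"
  shows "conj_family \<gamma> u w (\<lambda>t. if t \<le> v then h t else h' t)"
  unfolding conj_family_def
proof (intro conjI ballI allI)
  show "conjugacy (henon (\<gamma> t)) (KC (\<gamma> t)) shift UNIV (if t \<le> v then h t else h' t)" if "t \<in> {u..w}" for t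
    using that conj_family_conjugacy[OF h, of t] conj_family_conjugacy[OF h', of t] by auto
  fix s
  have v: "v \<in> {u..v}" using uvw by simp
  have "continuous_on ({u..v} \<union> {v..w})
      (\<lambda>t. if t \<le> v then inv_into (KC (\<gamma> t)) (h t) s else inv_into (KC (\<gamma> t)) (h' t) s)"
  proof (rule continuous_on_cases)
    show "\<forall>t. t \<in> {u..v} \<and> \<not> t \<le> v \<or> t \<in> {v..w} \<and> t \<le> v \<longrightarrow>
        inv_into (KC (\<gamma> t)) (h t) s = inv_into (KC (\<gamma> t)) (h' t) s"
      using inv_into_conjugacy_cong[OF conj_family_conjugacy[OF h v] eq, of s] by auto
  qed (use conj_family_continuous[OF h] conj_family_continuous[OF h'] in auto)
  also have "{u..v} \<union> {v..w} = {u..w}" using uvw by auto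
  finally show "continuous_on {u..w} (\<lambda>t. inv_into (KC (\<gamma> t)) (if t \<le> v then h t else h' t) s)"
    by (simp add: if_distrib[where f = "\<lambda>k. inv_into _ k s"] cong: if_cong)
qed

lemma path_near_point:
  assumes cont: "continuous_on {0..1::real} \<gamma>" and x: "x \<in> {0..1}" and \<rho>: "\<rho> > 0"
  shows "\<exists>d>0. \<forall>u v. 0 \<le> u \<and> v \<le> 1 \<and> u \<le> x \<and> x \<le> v \<and> v - u < d \<longrightarrow> \<gamma> ` {u..v} \<subseteq> ball (\<gamma> x) \<rho>"
proof -
  from cont[unfolded continuous_on_iff, rule_format, OF x \<rho>]
  obtain d where d: "d > 0" "\<And>t. t \<in> {0..1} \<Longrightarrow> dist t x < d \<Longrightarrow> dist (\<gamma> t) (\<gamma> x) < \<rho>" by blast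
  have "\<gamma> ` {u..v} \<subseteq> ball (\<gamma> x) \<rho>" if "0 \<le> u" "v \<le> 1" "u \<le> x" "x \<le> v" "v - u < d" for u v
    using that d(2) by (auto simp: dist_real_def dist_commute)
  with d(1) show ?thesis by blast
qed

lemma continuation_exists:
  assumes cont: "continuous_on {0..1} \<gamma>" and im: "\<gamma> ` {0..1} \<subseteq> HC"
    and g: "conjugacy (henon (\<gamma> 0)) (KC (\<gamma> 0)) shift UNIV g"
  shows "\<exists>h. conj_family \<gamma> 0 1 h \<and> (\<forall>z\<in>KC (\<gamma> 0). h 0 z = g z)"
proof -
  \<comment> \<open>Quantifying over every initial conjugacy at \<open>u\<close> makes the property
    composable, as the end of one piece becomes the start of the next. The range conditions are
    premises because \<open>Bolzano\<close> also presents intervals that leave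
    \<open>{0..1}\<close>.\<close>
  define P where "P u v \<longleftrightarrow> (0 \<le> u \<longrightarrow> u \<le> v \<longrightarrow> v \<le> 1 \<longrightarrow>
    (\<forall>g. conjugacy (henon (\<gamma> u)) (KC (\<gamma> u)) shift UNIV g \<longrightarrow>
      (\<exists>h. conj_family \<gamma> u v h \<and> (\<forall>z\<in>KC (\<gamma> u). h u z = g z))))" for u v
  have "P 0 1"
  proof (rule Bolzano)
    show "(0::real) \<le> 1" by simp
  next
    fix u v w assume P: "P u v" "P v w" and uvw: "u \<le> v" "v \<le> w"
    show "P u w"
      unfolding P_def
    proof (intro impI allI)
      fix g assume uw: "0 \<le> u" "u \<le> w" "w \<le> 1" and g: "conjugacy (henon (\<gamma> u)) (KC (\<gamma> u)) shift UNIV g"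
      obtain h where h: "conj_family \<gamma> u v h" "\<forall>z\<in>KC (\<gamma> u). h u z = g z"
        using P(1) uw uvw g unfolding P_def by (meson order_trans)
      have "conjugacy (henon (\<gamma> v)) (KC (\<gamma> v)) shift UNIV (h v)"
        by (rule conj_family_conjugacy[OF h(1)]) (use uvw in simp)
      then obtain h' where h': "conj_family \<gamma> v w h'" "\<forall>z\<in>KC (\<gamma> v). h' v z = h v z"
        using P(2) uw uvw unfolding P_def by (meson order_trans)
      have "conj_family \<gamma> u w (\<lambda>t. if t \<le> v then h t else h' t)"
        by (rule conj_family_glue[OF h(1) h'(1) uvw]) (use h'(2) in blast)
      moreover have "\<forall>z\<in>KC (\<gamma> u). (if u \<le> v then h u else h' u) z = g z" using h(2) uvw by simp
      ultimately show "\<exists>h. conj_family \<gamma> u w h \<and> (\<forall>z\<in>KC (\<gamma> u). h u z = g z)"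
        by (intro exI[of _ "\<lambda>t. if t \<le> v then h t else h' t"] conjI)
    qed
  next
    fix x :: real assume "0 \<le> x" "x \<le> 1"
    then have x: "x \<in> {0..1}" by simp
    then have xH: "\<gamma> x \<in> HC" using im by blast
    show "\<exists>d>0. \<forall>a b. a \<le> x \<and> x \<le> b \<and> b - a < d \<longrightarrow> P a b"
    proof (rule local_continuation[OF xH])
      fix \<rho> assume \<rho>: "\<rho> > 0"
        and ex: "\<And>\<gamma>' u v g. u \<le> v \<Longrightarrow> continuous_on {u..v} \<gamma>' \<Longrightarrow> \<gamma>' ` {u..v} \<subseteq> ball (\<gamma> x) \<rho> \<Longrightarrow>
          conjugacy (henon (\<gamma>' u)) (KC (\<gamma>' u)) shift UNIV g \<Longrightarrow>
          \<exists>h. conj_family \<gamma>' u v h \<and> (\<forall>z\<in>KC (\<gamma>' u). h u z = g z)"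
      obtain d where d: "d > 0" "\<And>u v. 0 \<le> u \<Longrightarrow> v \<le> 1 \<Longrightarrow> u \<le> x \<Longrightarrow> x \<le> v \<Longrightarrow> v - u < d \<Longrightarrow>
          \<gamma> ` {u..v} \<subseteq> ball (\<gamma> x) \<rho>"
        using path_near_point[OF cont x \<rho>] by blast
      show ?thesis
      proof (intro exI[of _ d] conjI d(1) allI impI)
        fix u v assume uv: "u \<le> x \<and> x \<le> v \<and> v - u < d"
        show "P u v"
          unfolding P_def
        proof (intro impI allI)
          fix g assume b: "0 \<le> u" "u \<le> v" "v \<le> 1" and g: "conjugacy (henon (\<gamma> u)) (KC (\<gamma> u)) shift UNIV g"
          have "continuous_on {u..v} \<gamma>" by (rule continuous_on_subset[OF cont]) (use b in auto)
          from ex[OF b(2) this d(2) g] show "\<exists>h. conj_family \<gamma> u v h \<and> (\<forall>z\<in>KC (\<gamma> u). h u z = g z)"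
            using uv b by blast
        qed
      qed
    qed
  qed
  then show ?thesis using g by (simp add: P_def)
qed

lemma continuation_unique:
  assumes cont: "continuous_on {0..1} \<gamma>" and im: "\<gamma> ` {0..1} \<subseteq> HC"
    and h: "conj_family \<gamma> 0 1 h" and h': "conj_family \<gamma> 0 1 h'"
    and eq: "\<And>z. z \<in> KC (\<gamma> 0) \<Longrightarrow> h 0 z = h' 0 z" and t: "t \<in> {0..1}" and z: "z \<in> KC (\<gamma> t)"
  shows "h t z = h' t z"
proof -
  \<comment> \<open>Agreement is propagated from \<open>u\<close> to \<open>v\<close> rather than
    asserted, so that it composes over adjacent intervals; bisecting \<open>{0..t}\<close> carries
    it from 0 to \<open>t\<close>.\<close>
  define P where "P u v \<longleftrightarrow> (0 \<le> u \<longrightarrow> u \<le> v \<longrightarrow> v \<le> 1 \<longrightarrow>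
    (\<forall>z\<in>KC (\<gamma> u). h u z = h' u z) \<longrightarrow> (\<forall>z\<in>KC (\<gamma> v). h v z = h' v z))" for u v
  have "P 0 t"
  proof (rule Bolzano)
    show "0 \<le> t" using t by simp
    show "P u w" if "P u v" "P v w" "u \<le> v" "v \<le> w" for u v w
      using that unfolding P_def by (meson order_trans)
  next
    fix x :: real assume "0 \<le> x" "x \<le> t"
    then have x: "x \<in> {0..1}" using t by simp
    then have xH: "\<gamma> x \<in> HC" using im by blast
    show "\<exists>d>0. \<forall>a b. a \<le> x \<and> x \<le> b \<and> b - a < d \<longrightarrow> P a b"
    proof (rule local_continuation[OF xH])
      fix \<rho> assume \<rho>: "\<rho> > 0"
        and un: "\<And>\<gamma>' u v h h'. u \<le> v \<Longrightarrow> continuous_on {u..v} \<gamma>' \<Longrightarrow> \<gamma>' ` {u..v} \<subseteq> ball (\<gamma> x) \<rho> \<Longrightarrow>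
          conj_family \<gamma>' u v h \<Longrightarrow> conj_family \<gamma>' u v h' \<Longrightarrow> (\<And>z. z \<in> KC (\<gamma>' u) \<Longrightarrow> h u z = h' u z) \<Longrightarrow>
          (\<forall>z\<in>KC (\<gamma>' v). h v z = h' v z)"
      obtain d where d: "d > 0" "\<And>u v. 0 \<le> u \<Longrightarrow> v \<le> 1 \<Longrightarrow> u \<le> x \<Longrightarrow> x \<le> v \<Longrightarrow> v - u < d \<Longrightarrow>
          \<gamma> ` {u..v} \<subseteq> ball (\<gamma> x) \<rho>"
        using path_near_point[OF cont x \<rho>] by blast
      show ?thesis
      proof (intro exI[of _ d] conjI d(1) allI impI)
        fix u v assume uv: "u \<le> x \<and> x \<le> v \<and> v - u < d"
        show "P u v"
          unfolding P_def
        proof (intro impI)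
          assume b: "0 \<le> u" "u \<le> v" "v \<le> 1" and e: "\<forall>z\<in>KC (\<gamma> u). h u z = h' u z"
          have s: "{u..v} \<subseteq> {0..1}" using b by auto
          show "\<forall>z\<in>KC (\<gamma> v). h v z = h' v z"
          proof (rule un[OF b(2) continuous_on_subset[OF cont s]])
            show "\<gamma> ` {u..v} \<subseteq> ball (\<gamma> x) \<rho>" using d(2) uv b by blast
            show "conj_family \<gamma> u v h" "conj_family \<gamma> u v h'"
              by (rule conj_family_subset[OF h s], rule conj_family_subset[OF h' s])
            show "h u z = h' u z" if "z \<in> KC (\<gamma> u)" for z using e that by blast
          qed
        qed
      qed
    qed
  qed
  then show ?thesis using eq t z by (simp add: P_def)
qed

lemma continuation_conj_family:
  assumes "path \<gamma>" "path_image \<gamma> \<subseteq> HC"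
    and "conjugacy (henon (pathstart \<gamma>)) (KC (pathstart \<gamma>)) shift UNIV g"
  shows "conj_family \<gamma> 0 1 (continuation \<gamma> g)" "\<forall>z\<in>KC (pathstart \<gamma>). continuation \<gamma> g 0 z = g z"
proof -
  have "\<exists>h. continuous_conjugacies \<gamma> h \<and> (\<forall>z\<in>KC (pathstart \<gamma>). h 0 z = g z)"
    using continuation_exists[of \<gamma> g] assms
    by (simp add: path_def path_image_def pathstart_def continuous_conjugacies_eq)
  from someI_ex[OF this, folded continuation_def]
  show "conj_family \<gamma> 0 1 (continuation \<gamma> g)" "\<forall>z\<in>KC (pathstart \<gamma>). continuation \<gamma> g 0 z = g z"
    by (simp_all add: continuous_conjugacies_eq)
qed

section \<open>The symmetric loop and its monodromy\<close>

lemma conj2_continuous_path: "path \<alpha> \<Longrightarrow> path (conj2 \<circ> \<alpha>)"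
  by (intro path_continuous_image continuous_on_conj2)

lemma symmetric_loop:
  assumes \<alpha>: "path \<alpha>" "path_image \<alpha> \<subseteq> HC0" and start: "conj2 (pathstart \<alpha>) = pathstart \<alpha>"
    and finish: "conj2 (pathfinish \<alpha>) = pathfinish \<alpha>"
  shows "loop_in HC0 (pathstart \<alpha>) (symmetric_loop \<alpha>)" "symmetric_loop \<alpha> (1/2) = pathfinish \<alpha>"
    "t \<in> {0..1} \<Longrightarrow> symmetric_loop \<alpha> (1 - t) = conj2 (symmetric_loop \<alpha> t)"
proof -
  have j: "pathfinish \<alpha> = pathstart (reversepath (conj2 \<circ> \<alpha>))"
    using finish by (simp add: pathstart_compose pathfinish_compose)
  have "path (symmetric_loop \<alpha>)"
    unfolding symmetric_loop_def using \<alpha>(1) conj2_continuous_path[OF \<alpha>(1)] j by (intro path_join_imp) simp_all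
  moreover have "path_image (symmetric_loop \<alpha>) \<subseteq> HC0"
    unfolding symmetric_loop_def path_image_join[OF j] path_image_reversepath path_image_compose
    using \<alpha>(2) conj2_HC0 by blast
  ultimately show "loop_in HC0 (pathstart \<alpha>) (symmetric_loop \<alpha>)"
    unfolding loop_in_def using start by (simp add: symmetric_loop_def pathstart_compose pathfinish_compose)
  show half: "symmetric_loop \<alpha> (1/2) = pathfinish \<alpha>"
    by (simp add: symmetric_loop_def joinpaths_def pathfinish_def)
  show "symmetric_loop \<alpha> (1 - t) = conj2 (symmetric_loop \<alpha> t)" if "t \<in> {0..1}"
  proof -
    \<comment> \<open>The midpoint is separate because \<open>joinpaths\<close> assigns it to the
      first half, so \<open>t\<close> and \<open>1 - t\<close> fall into the same half; there the
      identity says that the endpoint is real.\<close>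
    consider "t < 1/2" | "t = 1/2" | "t > 1/2" by linarith
    then show ?thesis
    proof cases
      case 1
      then show ?thesis by (simp add: symmetric_loop_def joinpaths_def reversepath_def algebra_simps)
    next
      case 2
      then have t: "1 - t = 1/2" "t = 1/2" by simp_all
      show ?thesis unfolding t(1) unfolding t(2) half using finish by simp
    next
      case 3
      then show ?thesis by (simp add: symmetric_loop_def joinpaths_def reversepath_def algebra_simps)
    qed
  qed
qed

text \<open>Both \<open>\<lambda>t. h (1 - t) \<circ> conj2\<close> and \<open>\<lambda>t. \<rho> \<circ> h t\<close> continue \<open>h 1\<close> along the loop, so they agree;
  at \<open>t = 1/2\<close> this says that \<open>\<rho>\<close> is complex conjugation in symbolic coordinates.\<close>

lemma half_way_conjugacy:
  assumes \<alpha>: "path \<alpha>" "path_image \<alpha> \<subseteq> HC0" and start: "pathstart \<alpha> \<in> DN"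
    and finish: "pathfinish \<alpha> = p" "p \<in> R2"
    and h0: "conjugacy (henon (pathstart \<alpha>)) (KC (pathstart \<alpha>)) shift UNIV h0"
  shows "conjugacy (henon p) (KR p) shift (Fix (monodromy (symmetric_loop \<alpha>) h0))
    (continuation (symmetric_loop \<alpha>) h0 (1/2))"
proof -
  define \<gamma> where "\<gamma> = symmetric_loop \<alpha>"
  define h where "h = continuation \<gamma> h0"
  define b where "b = pathstart \<alpha>"
  have br: "conj2 b = b" using start by (auto simp: b_def conj2_fixed_iff R2_def DN_def)
  have pr: "conj2 p = p" using finish by (simp add: conj2_fixed_iff)
  have sym: "loop_in HC0 b \<gamma>" "\<gamma> (1/2) = p" "\<And>t. t \<in> {0..1} \<Longrightarrow> \<gamma> (1 - t) = conj2 (\<gamma> t)"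
    using symmetric_loop[OF \<alpha>] br pr finish(1) by (auto simp: \<gamma>_def b_def)
  have \<gamma>: "path \<gamma>" "path_image \<gamma> \<subseteq> HC" "pathstart \<gamma> = b" and \<gamma>01: "\<gamma> 0 = b" "\<gamma> 1 = b"
    using sym(1) HC0_subset_HC by (auto simp: loop_in_def pathstart_def pathfinish_def)
  have cont: "continuous_on {0..1} \<gamma>" and im: "\<gamma> ` {0..1} \<subseteq> HC"
    using \<gamma> by (simp_all add: path_def path_image_def)
  have a: "fst (\<gamma> t) \<noteq> 0" if "t \<in> {0..1}" for t
  proof -
    have "\<gamma> t \<in> HC" using im that by blast
    then show ?thesis by (simp add: HC_iff)
  qed
  have h0': "conjugacy (henon (pathstart \<gamma>)) (KC (pathstart \<gamma>)) shift UNIV h0"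
    using h0 \<gamma>(3) by (simp add: b_def)
  have h: "conj_family \<gamma> 0 1 h" and hh0: "\<And>z. z \<in> KC b \<Longrightarrow> h 0 z = h0 z"
    using continuation_conj_family[OF \<gamma>(1,2) h0'] \<gamma>(3) by (auto simp: h_def)
  have ht: "conjugacy (henon (\<gamma> t)) (KC (\<gamma> t)) shift UNIV (h t)" if "t \<in> {0..1}" for t
    by (rule conj_family_conjugacy[OF h that])
  have h0b: "conjugacy (henon b) (KC b) shift UNIV h0" using h0 by (simp add: b_def)
  define \<rho> where "\<rho> = h 1 \<circ> inv_into (KC b) h0"
  have \<rho>_eq: "monodromy (symmetric_loop \<alpha>) h0 = \<rho>"
    using \<gamma>(3) by (simp add: monodromy_def \<rho>_def h_def \<gamma>_def)
  have \<rho>: "conjugacy shift UNIV shift UNIV \<rho>"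
    unfolding \<rho>_def using conjugacy_compose[OF conjugacy_inverse[OF h0b]] ht[of 1] \<gamma>01 by simp
  have "conj_family \<gamma> 0 1 (\<lambda>t. \<rho> \<circ> h t)"
    unfolding conj_family_def
  proof (intro conjI ballI allI)
    show conj: "conjugacy (henon (\<gamma> t)) (KC (\<gamma> t)) shift UNIV (\<rho> \<circ> h t)" if "t \<in> {0..1}" for t
      by (rule conjugacy_compose[OF ht[OF that] \<rho>])
    fix s
    \<comment> \<open>\<open>\<rho>\<close> does not depend on \<open>t\<close>: the point with
      itinerary \<open>s\<close> under \<open>\<rho> \<circ> h t\<close> is the one with the fixed
      itinerary \<open>inv_into UNIV \<rho> s\<close> under \<open>h t\<close>, so continuity is
      inherited.\<close>
    have "inv_into (KC (\<gamma> t)) (\<rho> \<circ> h t) s = inv_into (KC (\<gamma> t)) (h t) (inv_into UNIV \<rho> s)" if t: "t \<in> {0..1}" for t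
      by (rule inv_into_eqI[OF conj[OF t] conjugacyD(6)[OF ht[OF t] UNIV_I]])
         (simp add: conjugacyD(7)[OF ht[OF t] UNIV_I] conjugacyD(7)[OF \<rho> UNIV_I])
    then show "continuous_on {0..1} (\<lambda>t. inv_into (KC (\<gamma> t)) (\<rho> \<circ> h t) s)"
      by (intro continuous_on_eq[OF conj_family_continuous[OF h, of "inv_into UNIV \<rho> s"]]) simp
  qed
  moreover have "conj_family \<gamma> 0 1 (\<lambda>t. h (1 - t) \<circ> conj2)"
    unfolding conj_family_def
  proof (intro conjI ballI allI)
    show conj: "conjugacy (henon (\<gamma> t)) (KC (\<gamma> t)) shift UNIV (h (1 - t) \<circ> conj2)" if t: "t \<in> {0..1}" for t
    proof (rule conjugacy_compose[OF conjugacy_conj2[OF a[OF t]]])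
      show "conjugacy (henon (conj2 (\<gamma> t))) (KC (conj2 (\<gamma> t))) shift UNIV (h (1 - t))"
        using ht[of "1 - t"] t sym(3)[OF t] by simp
    qed
    fix s
    have "inv_into (KC (\<gamma> t)) (h (1 - t) \<circ> conj2) s = conj2 (inv_into (KC (\<gamma> (1 - t))) (h (1 - t)) s)"
      if t: "t \<in> {0..1}" for t
    proof (rule inv_into_eqI[OF conj[OF t]])
      have t': "1 - t \<in> {0..1}" using t by simp
      show "conj2 (inv_into (KC (\<gamma> (1 - t))) (h (1 - t)) s) \<in> KC (\<gamma> t)"
        using KC_conj2_I[OF a[OF t'] conjugacyD(6)[OF ht[OF t'] UNIV_I]] sym(3)[OF t] by simp
      show "(h (1 - t) \<circ> conj2) (conj2 (inv_into (KC (\<gamma> (1 - t))) (h (1 - t)) s)) = s"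
        by (simp add: conjugacyD(7)[OF ht[OF t'] UNIV_I])
    qed
    moreover have "continuous_on {0..1} (\<lambda>t. conj2 (inv_into (KC (\<gamma> (1 - t))) (h (1 - t)) s))"
    proof (rule continuous_on_compose2[OF continuous_on_conj2[of UNIV]])
      show "continuous_on {0..1} (\<lambda>t. inv_into (KC (\<gamma> (1 - t))) (h (1 - t)) s)"
        by (rule continuous_on_compose2[OF conj_family_continuous[OF h, of s], of _ "\<lambda>t. 1 - t"])
           (auto intro!: continuous_intros)
    qed simp
    ultimately show "continuous_on {0..1} (\<lambda>t. inv_into (KC (\<gamma> t)) (h (1 - t) \<circ> conj2) s)"
      by (intro continuous_on_eq[where g = "\<lambda>t. inv_into (KC (\<gamma> t)) (h (1 - t) \<circ> conj2) s"]) simp_all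
  qed
  \<comment> \<open>Equality at time 0: there \<open>\<rho> \<circ> h 0\<close> is
    \<open>h 1\<close> by the definition of \<open>\<rho>\<close>, and \<open>conj2\<close> acts
    trivially because bounded orbits over \<open>DN\<close> are real.\<close>
  moreover have "(\<rho> \<circ> h 0) z = (h (1 - 0) \<circ> conj2) z" if "z \<in> KC (\<gamma> 0)" for z
  proof -
    have z: "z \<in> KC b" using that \<gamma>01 by simp
    then have "conj2 z = z" using KC_DN_real[OF start] unfolding b_def conj2_fixed_iff by blast
    then show ?thesis by (simp add: \<rho>_def hh0[OF z] conjugacyD(8)[OF h0b z])
  qed
  ultimately have "(\<rho> \<circ> h (1/2)) z = (h (1 - 1/2) \<circ> conj2) z" if "z \<in> KC (\<gamma> (1/2))" for z
    using continuation_unique[OF cont im, of "\<lambda>t. \<rho> \<circ> h t" "\<lambda>t. h (1 - t) \<circ> conj2" "1/2" z] that by simp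
  then have key: "\<rho> (h (1/2) z) = h (1/2) (conj2 z)" if "z \<in> KC p" for z
    using that sym(2) by simp
  have hp: "conjugacy (henon p) (KC p) shift UNIV (h (1/2))" using ht[of "1/2"] sym(2) by simp
  have ap: "fst p \<noteq> 0" using a[of "1/2"] sym(2) by simp
  \<comment> \<open>By injectivity of \<open>h (1/2)\<close> on \<open>KC p\<close>, an itinerary is
    fixed by \<open>\<rho>\<close> exactly when its point is fixed by \<open>conj2\<close>; reality
    of \<open>p\<close> keeps \<open>conj2 z\<close> in the same \<open>KC p\<close>.\<close>
  have fix_iff: "h (1/2) z \<in> Fix \<rho> \<longleftrightarrow> z \<in> R2" if z: "z \<in> KC p" for z
  proof -
    have cz: "conj2 z \<in> KC p" using KC_conj2_I[OF ap z] pr by simp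
    have "h (1/2) (conj2 z) = h (1/2) z \<longleftrightarrow> conj2 z = z"
      using conjugacyD(8)[OF hp cz] conjugacyD(8)[OF hp z] by metis
    then show ?thesis by (simp add: Fix_def key[OF z] conj2_fixed_iff)
  qed
  have "conjugacy (henon p) (KR p) shift (Fix \<rho>) (h (1/2))"
  proof (rule conjugacyI)
    show "henon p ` KR p \<subseteq> KR p"
      proof
      fix w assume "w \<in> henon p ` KR p"
      then obtain z where z: "w = henon p z" "z \<in> KC p" "conj2 z = z"
        by (auto simp: KR_def conj2_fixed_iff)
      then have "conj2 w = w" using henon_conj2[of p z] pr by simp
      then show "w \<in> KR p" using henon_in_KC[OF ap z(2)] z(1) by (simp add: KR_def conj2_fixed_iff)
    qed
    show "shift ` Fix \<rho> \<subseteq> Fix \<rho>"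
      using conjugacyD(3)[OF \<rho> UNIV_I] by (auto simp: Fix_def)
    show "homeomorphism (KR p) (Fix \<rho>) (h (1/2)) (inv_into (KC p) (h (1/2)))"
    proof (rule homeomorphism_of_subsets)
      show "homeomorphism (KC p) UNIV (h (1/2)) (inv_into (KC p) (h (1/2)))"
        using hp by (simp add: conjugacy_inv_into)
      show "h (1/2) ` KR p = Fix \<rho>"
      proof (intro subset_antisym subsetI)
        fix s assume s: "s \<in> Fix \<rho>"
        let ?z = "inv_into (KC p) (h (1/2)) s"
        have z: "?z \<in> KC p" "h (1/2) ?z = s" by (rule conjugacyD(6,7)[OF hp UNIV_I])+
        then have "?z \<in> KR p" using fix_iff[OF z(1)] s by (simp add: KR_def)
        then show "s \<in> h (1/2) ` KR p" using z(2) by (metis imageI)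
      qed (use fix_iff in \<open>auto simp: KR_def\<close>)
    qed (auto simp: KR_def)
    show "h (1/2) (henon p z) = shift (h (1/2) z)" if "z \<in> KR p" for z
      using conjugacyD(3)[OF hp] that by (simp add: KR_def)
  qed
  then show ?thesis by (simp add: \<rho>_eq) (simp add: h_def \<gamma>_def)
qed

theorem theorem3:
  fixes a c :: complex
  assumes "(a, c) \<in> HC0 \<inter> R2"
  shows "(\<exists>\<gamma> b. b \<in> DN \<and> loop_in HC0 b \<gamma> \<and> \<gamma> (1/2) = (a, c) \<and>
            (\<forall>h0. conjugacy (henon b) (KC b) shift UNIV h0 \<longrightarrow>
               topologically_conjugate (henon (a, c)) (KR (a, c)) shift (Fix (monodromy \<gamma> h0)))) \<and>
         (\<forall>\<alpha> h0. path \<alpha> \<and> path_image \<alpha> \<subseteq> HC0 \<and> pathstart \<alpha> \<in> DN \<and> pathfinish \<alpha> = (a, c) \<and>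
            conjugacy (henon (pathstart \<alpha>)) (KC (pathstart \<alpha>)) shift UNIV h0 \<longrightarrow>
            (let \<gamma> = symmetric_loop \<alpha> in
               loop_in HC0 (pathstart \<alpha>) \<gamma> \<and> \<gamma> (1/2) = (a, c) \<and>
               topologically_conjugate (henon (a, c)) (KR (a, c)) shift (Fix (monodromy \<gamma> h0)) \<and>
               conjugacy (henon (a, c)) (KR (a, c)) shift (Fix (monodromy \<gamma> h0))
                 (continuation \<gamma> h0 (1/2))))"
proof (intro conjI allI impI)
  have p0: "(a, c) \<in> HC0" and pR: "(a, c) \<in> R2" using assms by auto
  have pr: "conj2 (a, c) = (a, c)" using pR by (simp add: conj2_fixed_iff)
  have real: "conj2 b = b" if "b \<in> DN" for b
    using that by (auto simp: conj2_fixed_iff R2_def DN_def)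
  obtain b where b: "b \<in> DN" using DN_nonempty by blast
  have "b \<in> HC0" using b DN_subset_HOV HC0_component(2)[OF p0] by blast
  \<comment> \<open>Openness of \<open>HC\<close> upgrades connectedness of \<open>HC0\<close> to
    path connectedness, so a path from \<open>DN\<close> to \<open>(a, c)\<close> exists; its
    symmetric loop works for every choice of \<open>h0\<close>.\<close>
  then obtain \<alpha> where \<alpha>: "path \<alpha>" "path_image \<alpha> \<subseteq> HC0" "pathstart \<alpha> = b" "pathfinish \<alpha> = (a, c)"
    using path_connected_HC0 p0 unfolding path_connected_def by meson
  have loop: "loop_in HC0 b (symmetric_loop \<alpha>)" "symmetric_loop \<alpha> (1/2) = (a, c)"
    using symmetric_loop[OF \<alpha>(1,2)] real[OF b] pr \<alpha>(3,4) by simp_all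
  have "topologically_conjugate (henon (a, c)) (KR (a, c)) shift (Fix (monodromy (symmetric_loop \<alpha>) h0))"
    if "conjugacy (henon b) (KC b) shift UNIV h0" for h0
    unfolding topologically_conjugate_def
    using half_way_conjugacy[OF \<alpha>(1,2) _ \<alpha>(4) pR, of h0] \<alpha>(3) b that by auto
  with b loop show "\<exists>\<gamma> b. b \<in> DN \<and> loop_in HC0 b \<gamma> \<and> \<gamma> (1/2) = (a, c) \<and>
      (\<forall>h0. conjugacy (henon b) (KC b) shift UNIV h0 \<longrightarrow>
         topologically_conjugate (henon (a, c)) (KR (a, c)) shift (Fix (monodromy \<gamma> h0)))"
    by blast
next
  fix \<alpha> h0
  assume A: "path \<alpha> \<and> path_image \<alpha> \<subseteq> HC0 \<and> pathstart \<alpha> \<in> DN \<and> pathfinish \<alpha> = (a, c) \<and>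
    conjugacy (henon (pathstart \<alpha>)) (KC (pathstart \<alpha>)) shift UNIV h0"
  have pR: "(a, c) \<in> R2" using assms by auto
  have ends: "conj2 (pathstart \<alpha>) = pathstart \<alpha>" "conj2 (pathfinish \<alpha>) = pathfinish \<alpha>"
    using A pR by (auto simp: conj2_fixed_iff R2_def DN_def)
  have "loop_in HC0 (pathstart \<alpha>) (symmetric_loop \<alpha>)" "symmetric_loop \<alpha> (1/2) = (a, c)"
    using symmetric_loop[OF _ _ ends] A by simp_all
  moreover have "conjugacy (henon (a, c)) (KR (a, c)) shift (Fix (monodromy (symmetric_loop \<alpha>) h0))
      (continuation (symmetric_loop \<alpha>) h0 (1/2))"
    using half_way_conjugacy[OF _ _ _ _ pR] A by blast
  ultimately show "let \<gamma> = symmetric_loop \<alpha> in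
      loop_in HC0 (pathstart \<alpha>) \<gamma> \<and> \<gamma> (1/2) = (a, c) \<and>
      topologically_conjugate (henon (a, c)) (KR (a, c)) shift (Fix (monodromy \<gamma> h0)) \<and>
      conjugacy (henon (a, c)) (KR (a, c)) shift (Fix (monodromy \<gamma> h0)) (continuation \<gamma> h0 (1/2))"
    unfolding Let_def topologically_conjugate_def by blast
qed

end
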